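(* There is an absolute constant $c_0>0$ such that the following holds. Let $\varepsilon>0$, and let $\lambda$ be sufficiently large (depending on $\varepsilon$). Let $\varphi$ be a (nonzero, real-valued) eigenfunction of the Laplacian on $\mathbb{T}^2$ with eigenvalue $E=\lambda^2$ (in the normalization of the context), and let $\{C_\alpha\}$ be a collection of disjoint regular arcs contained in the nodal set $\mathcal{N}_\varphi$ satisfying $$w(C_\alpha)>\lambda^{-1+\varepsilon}\quad\text{for each }\alpha.$$ Then $$\operatorname{length}\Big(\mathcal{N}_\varphi\setminus\bigcup_\alpha C_\alpha\Big)>c_0\lambda.$$
   Context: $\mathbb{T}^2=\mathbb{R}^2/\mathbb{Z}^2$ is the standard flat torus and $e(t)=\exp(2\pi i t)$. An eigenfunction with eigenvalue $E=\lambda^2$ (the Laplace eigenvalue is actually $4\pi^2E$; $E$ is an integer which is a sum of two squares) is a nonzero real-valued function $\varphi(x)=\sum_{\xi\in\mathbb{Z}^2,\ |\xi|^2=E}a_\xi\, e(x\cdot\xi)$ with $\overline{a_\xi}=a_{-\xi}$. Its nodal set is $\mathcal{N}_\varphi=\{x\in\mathbb{T}^2:\varphi(x)=0\}$. Length means one-dimensional (Hausdorff) measure; apart from finitely many singular points the nodal set is a union of smooth curves. Regular arc: an arc $C\subset\mathbb{T}^2$ is regular if it admits an arc-length parametrization $\gamma:[0,\ell]\to C$, $0<\ell<1$, which is $C^2$ and such that for some $\kappa>0$ one has $\kappa<|\ddot\gamma|<2\kappa$ pointwise and $2\kappa\ell<1$. Width: for a convex curve $C$ in the plane, the width $w(C)$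 is the minimal distance between a pair of parallel supporting lines of the curve. A regular arc in $\mathbb{T}^2$ is viewed as a planar (convex) arc by lifting to $\mathbb{R}^2$. *)

theory Defs
  imports "HOL-Analysis.Analysis"
begin

definition int_lattice :: "(real^2) set" where
  "int_lattice = {x. \<forall>i. x $ i \<in> \<int>}"

lemma int_lattice_0 [simp]: "0 \<in> int_lattice"
  by (simp add: int_lattice_def)

lemma int_lattice_uminus: "x \<in> int_lattice \<Longrightarrow> - x \<in> int_lattice"
  by (simp add: int_lattice_def)

lemma int_lattice_add: "x \<in> int_lattice \<Longrightarrow> y \<in> int_lattice \<Longrightarrow> x + y \<in> int_lattice"
  by (simp add: int_lattice_def)

lemma int_lattice_diff: "x \<in> int_lattice \<Longrightarrow> y \<in> int_lattice \<Longrightarrow> x - y \<in> int_lattice"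
  by (simp add: int_lattice_def)

lemma closed_int_lattice: "closed int_lattice"
  unfolding int_lattice_def
  by (intro closed_Collect_all) (rule closed_vimage[OF closed_Ints, unfolded vimage_def], intro continuous_intros)

lemma infdist_int_lattice_uminus: "infdist (- x) int_lattice = infdist x int_lattice"
proof -
  have "uminus ` int_lattice = int_lattice"
    by (auto simp: image_iff intro: int_lattice_uminus dest: int_lattice_uminus)
      (metis int_lattice_uminus minus_minus)
  then have "infdist (- x) int_lattice = infdist (- x) (uminus ` int_lattice)"
    by simp
  also have "\<dots> = infdist x int_lattice"
    unfolding infdist_def by (simp add: image_image dist_minus)
  finally show ?thesis .
qed

lemma infdist_int_lattice_add_le:
  "infdist (x + y) int_lattice \<le> infdist x int_lattice + infdist y int_lattice"
proof -
  have ne: "int_lattice \<noteq> {}" using int_lattice_0 by blast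
  obtain a where a: "a \<in> int_lattice" "infdist x int_lattice = dist x a"
    using infdist_attains_inf[OF closed_int_lattice ne] by metis
  obtain b where b: "b \<in> int_lattice" "infdist y int_lattice = dist y b"
    using infdist_attains_inf[OF closed_int_lattice ne] by metis
  have "infdist (x + y) int_lattice \<le> dist (x + y) (a + b)"
    by (intro infdist_le int_lattice_add a b)
  also have "\<dots> \<le> dist x a + dist y b"
    by (rule dist_triangle_add)
  finally show ?thesis using a b by simp
qed

lemma infdist_int_lattice_eq_0: "infdist x int_lattice = 0 \<longleftrightarrow> x \<in> int_lattice"
  using in_closed_iff_infdist_zero[OF closed_int_lattice] int_lattice_0 by blast

quotient_type torus = "real^2" / "\<lambda>x y. x - y \<in> int_lattice"
  morphisms rep_torus torus_of
proof (rule equivpI)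
  show "reflp (\<lambda>x y. x - y \<in> int_lattice)"
    by (simp add: reflp_def)
  show "symp (\<lambda>x y. x - y \<in> int_lattice)"
    by (metis (no_types, lifting) sympI int_lattice_uminus minus_diff_eq)
  show "transp (\<lambda>x y. x - y \<in> int_lattice)"
    by (rule transpI) (metis int_lattice_add diff_add_cancel add_diff_eq)
qed

text \<open>The flat distance between two classes is the least distance between representatives.\<close>

instantiation torus :: metric_space
begin

lift_definition dist_torus :: "torus \<Rightarrow> torus \<Rightarrow> real"
  is "\<lambda>x y. infdist (x - y) int_lattice"
proof -
  have le: "infdist (x - y) int_lattice \<le> infdist (x' - y') int_lattice"
    if "x - x' \<in> int_lattice" "y - y' \<in> int_lattice" for x x' y y' :: "real^2"
  proof -
    have "x - y = (x' - y') + ((x - x') - (y - y'))" by simp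
    moreover have "infdist ((x - x') - (y - y')) int_lattice = 0"
      using that by (simp add: infdist_int_lattice_eq_0 int_lattice_diff)
    ultimately show ?thesis
      using infdist_int_lattice_add_le[of "x' - y'" "(x - x') - (y - y')"] by simp
  qed
  fix x x' y y' :: "real^2"
  assume xy: "x - x' \<in> int_lattice" "y - y' \<in> int_lattice"
  then have "x' - x \<in> int_lattice" "y' - y \<in> int_lattice"
    using int_lattice_uminus by (metis minus_diff_eq)+
  with xy show "infdist (x - y) int_lattice = infdist (x' - y') int_lattice"
    by (intro antisym le)
qed

definition uniformity_torus :: "(torus \<times> torus) filter" where
  "uniformity_torus = (INF e\<in>{0<..}. principal {(x, y). dist x y < e})"

definition open_torus :: "torus set \<Rightarrow> bool" where
  "open_torus U \<longleftrightarrow> (\<forall>x\<in>U. \<forall>\<^sub>F (x', y) in uniformity. x' = x \<longrightarrow> y \<in> U)"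

instance
proof
  fix x y z :: torus
  show "dist x y = 0 \<longleftrightarrow> x = y"
    by transfer (simp add: infdist_int_lattice_eq_0)
  show "dist x y \<le> dist x z + dist y z"
  proof transfer
    fix x y z :: "real^2"
    have "infdist (z - y) int_lattice = infdist (y - z) int_lattice"
      using infdist_int_lattice_uminus[of "y - z"] by simp
    then show "infdist (x - y) int_lattice \<le> infdist (x - z) int_lattice + infdist (y - z) int_lattice"
      using infdist_int_lattice_add_le[of "x - z" "z - y"] by simp
  qed
qed (simp_all add: uniformity_torus_def open_torus_def)

end

definition freqs :: "real \<Rightarrow> (real^2) set" where
  "freqs E = {\<xi> \<in> int_lattice. (norm \<xi>)\<^sup>2 = E}"

lemma finite_freqs: "finite (freqs E)"
proof -
  define N where "N = \<lceil>sqrt E\<rceil>"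
  define f where "f = (\<lambda>p :: int \<times> int. vector [of_int (fst p), of_int (snd p)] :: real^2)"
  have "freqs E \<subseteq> f ` ({-N..N} \<times> {-N..N})"
  proof
    fix x assume x: "x \<in> freqs E"
    obtain m n :: int where mn: "x $ 1 = of_int m" "x $ 2 = of_int n"
      using x by (auto simp: freqs_def int_lattice_def elim!: Ints_cases dest: spec)
        (metis Ints_cases)
    have nx: "norm x = sqrt E"
      using x by (auto simp: freqs_def)
    have b: "\<bar>k\<bar> \<le> N" if "\<bar>of_int k\<bar> \<le> norm x" for k :: int
      using that unfolding N_def nx by linarith
    have "\<bar>m\<bar> \<le> N" "\<bar>n\<bar> \<le> N"
      using component_le_norm_cart[of x 1] component_le_norm_cart[of x 2] mn by (auto intro!: b)
    moreover have "x = f (m, n)"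
      by (simp add: f_def vec_eq_iff forall_2 mn)
    ultimately show "x \<in> f ` ({-N..N} \<times> {-N..N})"
      by (intro image_eqI[of _ _ "(m, n)"]) (auto simp: abs_le_iff)
  qed
  then show ?thesis
    by (rule finite_subset) simp
qed

text \<open>The Laplace eigenvalue is \<open>4 \<pi>\<^sup>2 E\<close>. A nonzero such function exists only if \<open>E\<close> is a sum of two
  integer squares, so the real parameter \<open>E\<close> carries no further condition.\<close>

definition toral_eigenfunction :: "real \<Rightarrow> (torus \<Rightarrow> real) \<Rightarrow> bool" where
  "toral_eigenfunction E \<phi> \<longleftrightarrow>
     (\<exists>p. \<phi> p \<noteq> 0) \<and>
     (\<exists>a :: real^2 \<Rightarrow> complex.
        (\<forall>\<xi>\<in>freqs E. cnj (a \<xi>) = a (- \<xi>)) \<and>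
        (\<forall>x. complex_of_real (\<phi> (torus_of x)) =
           (\<Sum>\<xi>\<in>freqs E. a \<xi> * exp (2 * of_real pi * \<i> * of_real (x \<bullet> \<xi>)))))"

definition nodal_set :: "(torus \<Rightarrow> real) \<Rightarrow> torus set" where
  "nodal_set \<phi> = {p. \<phi> p = 0}"

text \<open>One-dimensional Hausdorff (outer) measure, normalised so that it is length on rectifiable
  curves. The covering sets are required to be bounded because \<^const>\<open>diameter\<close> is
  meaningless on unbounded sets.\<close>

definition hausdorff_length :: "'a::metric_space set \<Rightarrow> ennreal" where
  "hausdorff_length A =
     (SUP \<delta>\<in>{0<..}. INF U\<in>{U :: nat \<Rightarrow> 'a set. A \<subseteq> (\<Union>i. U i) \<and>
         (\<forall>i. bounded (U i) \<and> diameter (U i) \<le> \<delta>)}.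
       \<Sum>i. ennreal (diameter (U i)))"

definition regular_planar_arc :: "(real^2) set \<Rightarrow> bool" where
  "regular_planar_arc K \<longleftrightarrow>
     (\<exists>(\<gamma> :: real \<Rightarrow> real^2) \<gamma>' \<gamma>'' l \<kappa>.
        0 < l \<and> l < 1 \<and> K = \<gamma> ` {0..l} \<and> inj_on \<gamma> {0..l} \<and>
        (\<forall>t\<in>{0..l}. (\<gamma> has_vector_derivative \<gamma>' t) (at t within {0..l})) \<and>
        (\<forall>t\<in>{0..l}. (\<gamma>' has_vector_derivative \<gamma>'' t) (at t within {0..l})) \<and>
        continuous_on {0..l} \<gamma>'' \<and>
        (\<forall>t\<in>{0..l}. norm (\<gamma>' t) = 1) \<and>
        0 < \<kappa> \<and> (\<forall>t\<in>{0..l}. \<kappa> < norm (\<gamma>'' t) \<and> norm (\<gamma>'' t) < 2 * \<kappa>) \<and>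
        2 * \<kappa> * l < 1)"

text \<open>Parametrizations of arcs in the torus are differentiated through their lifts to the plane.\<close>

definition regular_lift :: "torus set \<Rightarrow> (real^2) set \<Rightarrow> bool" where
  "regular_lift C K \<longleftrightarrow> regular_planar_arc K \<and> inj_on torus_of K \<and> torus_of ` K = C"

definition regular_arc :: "torus set \<Rightarrow> bool" where
  "regular_arc C \<longleftrightarrow> (\<exists>K. regular_lift C K)"

text \<open>The lines \<open>u \<bullet> x = a\<close> and \<open>u \<bullet> x = b\<close> below are the two parallel supporting lines of \<open>K\<close> with
  unit normal \<open>u\<close>, having \<open>K\<close> between them; their distance is \<open>b - a\<close>.\<close>

definition planar_width :: "(real^2) set \<Rightarrow> real" where
  "planar_width K = Inf {b - a | (u :: real^2) a b. norm u = 1 \<and>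
     (\<forall>x\<in>K. a \<le> u \<bullet> x \<and> u \<bullet> x \<le> b) \<and> (\<exists>x\<in>K. u \<bullet> x = a) \<and> (\<exists>x\<in>K. u \<bullet> x = b)}"

text \<open>Two lifts of the same arc differ by a lattice translation, so the choice is immaterial.\<close>

definition arc_width :: "torus set \<Rightarrow> real" where
  "arc_width C = planar_width (SOME K. regular_lift C K)"

end

theory Submission
  imports Defs "HOL-Computational_Algebra.Primes" "HOL-Computational_Algebra.Polynomial"
begin

text \<open>Write \<open>e(t) = exp(2\<pi>it)\<close> and let \<open>N\<close> be the number of frequencies, which is \<open>\<lambda>\<^bsup>o(1)\<^esup>\<close> by
  the divisor bound. Let \<open>J\<close> be the cluster, at scale \<open>D = \<lambda>\<^bsup>1-\<epsilon>/2\<^esup>\<close>, of a frequency with the largest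
  coefficient. On a nodal arc of width \<open>w\<close> the cluster part \<open>\<phi>\<^sub>J\<close> equals \<open>- (\<phi> - \<phi>\<^sub>J)\<close>, and by van der
  Corput the products \<open>e((\<xi> - \<eta>) \<cdot> x)\<close> with \<open>\<xi>\<close> in \<open>J\<close> and \<open>\<eta>\<close> outside \<open>J\<close> average along the arc to
  \<open>O((w D)\<^bsup>-1/2\<^esup>)\<close>. So \<open>\<phi>\<^sub>J\<close> is small on all but a fraction \<open>\<lambda>\<^bsup>-c\<^esup>\<close> of the arcs, whose total length is
  \<open>O(\<lambda>)\<close> because axis-parallel lines meet the nodal set in \<open>O(\<lambda>)\<close> points. On the other hand, Zygmund's
  \<open>L\<^sup>4\<close> bound shows that \<open>\<phi>\<^sub>J\<close> is large on a positive proportion of the squares of side comparable to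
  \<open>1/\<lambda>\<close>, its modulus being almost constant there. Each of these contributes nodal length at least
  \<open>c/\<lambda>\<close>: the nodal set meets the boundary of every square whose first Dirichlet eigenvalue is that of
  \<open>\<phi>\<close>. The arcs cover only a negligible part of this length.\<close>

section \<open>Lattice points on circles\<close>

text \<open>The obstacle is that \<open>\<phi>\<close> vanishes on the arcs, so its own mean square
  there says nothing, while frequencies closer than 1/w are not separated by an arc of width w. A
  cluster avoids both: on an arc the squared modulus of its sum is minus a sum of products over
  pairs with one frequency inside and one outside \<open>J\<close>, all at distance more than D. It
  surrounds the largest coefficient so that the l2 norm of its coefficients dominates every
  coefficient; otherwise up to N^2 products could drown it. The scale D meets two demands: w D must
  be a positive power of \<lambda>, to beat N^2, and N^3 D must be small against \<lambda>, where
  N^2 comes from the diameter of the cluster and one more N from summing its coefficients. Length is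
  never computed on the possibly singular nodal set. It is bounded below by the Lebesgue measure of
  coordinate projections, taken in well separated windows, and what the arcs hide of a projection is
  at most the parameter time they spend in the window.\<close>

abbreviation divisor_count :: "nat \<Rightarrow> nat" where
  "divisor_count n \<equiv> card {d. d dvd n}"

lemma card_divisors_prime_mult_le:
  fixes p m :: nat
  assumes p: "prime p" and m: "m > 0"
  shows "divisor_count (p * m) \<le> 2 * divisor_count m"
proof -
  have fin: "finite {d. d dvd m}" using m by (simp add: finite_divisors_nat)
  have "{d. d dvd p * m} \<subseteq> {d. d dvd m} \<union> (*) p ` {d. d dvd m}"
  proof
    fix d assume "d \<in> {d. d dvd p * m}"
    then have d: "d dvd p * m" by simp
    show "d \<in> {d. d dvd m} \<union> (*) p ` {d. d dvd m}"
    proof (cases "p dvd d")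
      case True
      then obtain k where k: "d = p * k" by auto
      then have "k dvd m" using d p by (simp add: prime_gt_0_nat)
      then show ?thesis using k by auto
    next
      case False
      then have "coprime d p" using p by (metis prime_imp_coprime coprime_commute)
      then have "d dvd m" using d by (simp add: coprime_dvd_mult_right_iff)
      then show ?thesis by simp
    qed
  qed
  then have "divisor_count (p * m) \<le> card ({d. d dvd m} \<union> (*) p ` {d. d dvd m})"
    using fin by (intro card_mono) auto
  also have "\<dots> \<le> divisor_count m + card ((*) p ` {d. d dvd m})" by (rule card_Un_le)
  also have "\<dots> \<le> divisor_count m + divisor_count m" by (intro add_left_mono card_image_le fin)
  finally show ?thesis by simp
qed

lemma card_divisors_prime_power_mult_le:
  fixes p m :: nat
  assumes p: "prime p" and m: "m > 0"
  shows "divisor_count (p ^ a * m) \<le> (a + 1) * divisor_count m"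
proof -
  have fin: "finite {d. d dvd m}" using m by (simp add: finite_divisors_nat)
  have "{d. d dvd p ^ a * m} \<subseteq> (\<lambda>(i, d). p ^ i * d) ` ({..a} \<times> {d. d dvd m})"
  proof
    fix d assume "d \<in> {d. d dvd p ^ a * m}"
    then obtain x y where xy: "d = x * y" "x dvd p ^ a" "y dvd m"
      using division_decomp[of d "p ^ a" m] by auto
    moreover obtain i where "i \<le> a" "x = p ^ i"
      using xy(2) p by (auto simp: divides_primepow_nat)
    ultimately show "d \<in> (\<lambda>(i, d). p ^ i * d) ` ({..a} \<times> {d. d dvd m})" by auto
  qed
  then have "divisor_count (p ^ a * m) \<le> card ((\<lambda>(i, d). p ^ i * d) ` ({..a} \<times> {d. d dvd m}))"
    using fin by (intro card_mono) auto
  also have "\<dots> \<le> card ({..a} \<times> {d. d dvd m})" by (intro card_image_le) (use fin in auto)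
  finally show ?thesis by (simp add: card_cartesian_product)
qed

text \<open>Removing one prime factor p costs at most a factor 2 <= p^\<delta>, so the induction
  loses no constant.\<close>

lemma card_divisors_large_primes:
  fixes n :: nat
  assumes "\<delta> > 0" "n > 0" and "\<And>p. prime p \<Longrightarrow> p dvd n \<Longrightarrow> 2 \<le> real p powr \<delta>"
  shows "real (divisor_count n) \<le> real n powr \<delta>"
  using assms(2,3)
proof (induction n rule: less_induct)
  case (less n)
  show ?case
  proof (cases "n = 1")
    case True
    then have "{d. d dvd n} = {1}" by auto
    then show ?thesis using True by simp
  next
    case False
    then obtain p where p: "prime p" "p dvd n" using prime_factor_nat by blast
    then obtain m where m: "n = p * m" by auto
    have mp: "m > 0" "m < n" using m less.prems(1) prime_gt_1_nat[OF p(1)] by auto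
    have "real (divisor_count n) \<le> 2 * real (divisor_count m)"
    proof -
      have "divisor_count n \<le> 2 * divisor_count m"
        using card_divisors_prime_mult_le[OF p(1) mp(1)] unfolding m .
      then have "real (divisor_count n) \<le> real (2 * divisor_count m)" by (simp only: of_nat_le_iff)
      then show ?thesis by simp
    qed
    also have "\<dots> \<le> real p powr \<delta> * real m powr \<delta>"
      using less.IH[OF mp(2,1)] less.prems(2)[OF p] less.prems(2) m by (intro mult_mono) auto
    also have "\<dots> = real n powr \<delta>" using m by (simp add: powr_mult)
    finally show ?thesis .
  qed
qed

text \<open>Induction over the finite set of exceptional primes: the full power of each is stripped
  at once, and the constants multiply over \<open>S\<close>.\<close>

lemma card_divisors_small_primes:
  assumes "finite S" and \<delta>: "\<delta> > 0"
  shows "\<exists>C\<ge>0. \<forall>n::nat. n > 0 \<longrightarrow> (\<forall>p. prime p \<longrightarrow> p dvd n \<longrightarrow> p \<in> S \<or> 2 \<le> real p powr \<delta>) \<longrightarrow>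
    real (divisor_count n) \<le> C * real n powr \<delta>"
  using assms(1)
proof (induction S)
  case empty
  then show ?case using card_divisors_large_primes[OF \<delta>] by (intro exI[of _ 1]) auto
next
  case (insert p S)
  obtain C where C: "C \<ge> 0" "\<And>n::nat. n > 0 \<Longrightarrow> (\<And>p. prime p \<Longrightarrow> p dvd n \<Longrightarrow> p \<in> S \<or> 2 \<le> real p powr \<delta>) \<Longrightarrow>
    real (divisor_count n) \<le> C * real n powr \<delta>"
    using insert.IH by blast
  show ?case
  proof (cases "prime p")
    case False
    then show ?thesis using C by (intro exI[of _ C]) auto
  next
    case True
    \<comment> \<open>With this choice c * (a + 1) <= 1 + \<delta> * ln 2 * a <= 2^(\<delta> a), so
      the factor a + 1 contributed by the a-th power of p costs the constant 1/c.\<close>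
    define c where "c = min 1 (\<delta> * ln 2)"
    have c: "c > 0" "c \<le> 1" "c \<le> \<delta> * ln 2" using \<delta> by (auto simp: c_def)
    have pa: "real a + 1 \<le> (1 / c) * real (p ^ a) powr \<delta>" for a
    proof -
      have "c * (real a + 1) = c * real a + c" by (simp add: algebra_simps)
      also have "\<dots> \<le> \<delta> * ln 2 * real a + 1" using c by (intro add_mono mult_right_mono) auto
      also have "\<dots> \<le> exp (\<delta> * ln 2 * real a)" using exp_ge_add_one_self[of "\<delta> * ln 2 * real a"] by linarith
      also have "\<dots> = 2 powr (\<delta> * real a)" by (simp add: powr_def mult_ac)
      also have "\<dots> \<le> real p powr (\<delta> * real a)"
        using prime_ge_2_nat[OF True] \<delta> by (intro powr_mono2) auto
      also have "\<dots> = real (p ^ a) powr \<delta>"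
        using prime_gt_0_nat[OF True] by (simp add: powr_realpow[symmetric] powr_powr mult.commute)
      finally show ?thesis using c by (simp add: field_simps)
    qed
    have "real (divisor_count n) \<le> (1 / c * C) * real n powr \<delta>"
      if n: "n > 0" and pr: "\<And>q. prime q \<Longrightarrow> q dvd n \<Longrightarrow> q \<in> insert p S \<or> 2 \<le> real q powr \<delta>" for n
    proof -
      obtain m where m: "n = p ^ multiplicity p n * m" "\<not> p dvd m"
        using multiplicity_decompose'[of n p] n True by (metis not_prime_unit not_gr_zero)
      define a where "a = multiplicity p n"
      have mp: "m > 0" using m n by (cases m) auto
      have mC: "real (divisor_count m) \<le> C * real m powr \<delta>"
      proof (rule C(2)[OF mp])
        fix q assume q: "prime q" "q dvd m"
        then have "q \<noteq> p" using m by auto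
        moreover have "q dvd n" using q m by (metis dvd_mult)
        ultimately show "q \<in> S \<or> 2 \<le> real q powr \<delta>" using pr[OF q(1)] by auto
      qed
      have "real (divisor_count n) \<le> (real a + 1) * real (divisor_count m)"
      proof -
        have "divisor_count n \<le> (a + 1) * divisor_count m"
          using card_divisors_prime_power_mult_le[OF True mp, of a] m(1) by (simp add: a_def)
        then have "real (divisor_count n) \<le> real ((a + 1) * divisor_count m)" by (simp only: of_nat_le_iff)
        then show ?thesis by (simp add: algebra_simps)
      qed
      also have "\<dots> \<le> ((1 / c) * real (p ^ a) powr \<delta>) * (C * real m powr \<delta>)"
        using c by (intro mult_mono pa mC) auto
      also have "\<dots> = (1 / c * C) * (real (p ^ a) * real m) powr \<delta>" by (simp add: powr_mult)
      also have "real (p ^ a) * real m = real n" using m(1) by (metis a_def of_nat_mult)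
      finally show ?thesis .
    qed
    then show ?thesis using c C by (intro exI[of _ "1 / c * C"]) auto
  qed
qed

lemma card_divisors_subpolynomial:
  assumes \<delta>: "\<delta> > 0"
  shows "\<exists>C\<ge>0. \<forall>n::nat. n > 0 \<longrightarrow> real (divisor_count n) \<le> C * real n powr \<delta>"
proof -
  define B where "B = nat \<lceil>2 powr (1 / \<delta>)\<rceil>"
  have "2 \<le> real p powr \<delta>" if "\<not> p < B" for p
  proof -
    have "2 powr (1 / \<delta>) \<le> real p" using that unfolding B_def by linarith
    then have "(2 powr (1 / \<delta>)) powr \<delta> \<le> real p powr \<delta>" using \<delta> by (intro powr_mono2) auto
    then show ?thesis using \<delta> by (simp add: powr_powr)
  qed
  then show ?thesis using card_divisors_small_primes[OF _ \<delta>, of "{..<B}"] by (metis finite_lessThan lessThan_iff)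
qed

section \<open>Representations of an integer as a sum of two squares\<close>

lemma card_le_fibers:
  assumes "finite B" "f ` A \<subseteq> B" and fib: "\<And>b. b \<in> B \<Longrightarrow> finite {x \<in> A. f x = b} \<and> card {x \<in> A. f x = b} \<le> k"
  shows "finite A" "card A \<le> card B * k"
proof -
  have A: "A = (\<Union>b\<in>B. {x \<in> A. f x = b})" using assms(2) by auto
  show "finite A" by (subst A) (use assms(1) fib in auto)
  have "card A \<le> (\<Sum>b\<in>B. card {x \<in> A. f x = b})"
    by (subst A) (rule card_UN_le[OF assms(1)])
  also have "\<dots> \<le> (\<Sum>b\<in>B. k)" using fib by (intro sum_mono) auto
  finally show "card A \<le> card B * k" by simp
qed

text \<open>Read solutions as Gaussian integers z = m + i n and fix one solution z0. The gcds of E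
  with Im(conj(z) z0) and Im(z z0) replace the factorisation of z: they take at most |Dv|^2 values.
  Two solutions z1, z with the same gcds satisfy E | 2 Im(conj(z1) z), and together with |z1| |z| =
  E this leaves ten candidates for z.\<close>

lemma card_primitive_sum_two_squares:
  fixes E :: int
  assumes E: "E > 0"
  defines "P \<equiv> {(x, y). x\<^sup>2 + y\<^sup>2 = E \<and> coprime x y}"
  shows "finite P" "card P \<le> 10 * (card {d. 0 < d \<and> d dvd E})\<^sup>2"
proof -
  define Dv where "Dv = {d. 0 < d \<and> d dvd E}"
  have finD: "finite Dv"
    unfolding Dv_def by (rule finite_subset[of _ "{0..E}"]) (use E in \<open>auto intro: zdvd_imp_le\<close>)
  have "finite P \<and> card P \<le> card (Dv \<times> Dv) * 10"
  proof (cases "P = {}")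
    case True
    then show ?thesis by simp
  next
    case False
    then obtain m0 n0 where z0: "m0\<^sup>2 + n0\<^sup>2 = E" "coprime m0 n0" by (auto simp: P_def)
    define f where "f = (\<lambda>(m, n). (gcd (m * n0 - n * m0) E, gcd (m * n0 + n * m0) E))"
    have cop: "coprime m0 E" "coprime n0 E"
    proof -
      have "coprime m0 (n0 * n0)" "coprime n0 (m0 * m0)" using z0(2) by (simp_all add: coprime_commute)
      then have c: "coprime m0 (m0 * m0 + n0 * n0)" "coprime n0 (n0 * n0 + m0 * m0)"
        by (simp_all only: coprime_iff_gcd_eq_1 gcd_add_mult)
      show "coprime m0 E" using z0(1) c(1) by (simp add: power2_eq_square)
      show "coprime n0 E" using z0(1) c(2) by (simp add: power2_eq_square add.commute)
    qed
    have fD: "f ` P \<subseteq> Dv \<times> Dv" using E by (auto simp: f_def Dv_def)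
    have fib: "finite {z \<in> P. f z = b} \<and> card {z \<in> P. f z = b} \<le> 10" for b
    proof (cases "{z \<in> P. f z = b} = {}")
      case True
      show ?thesis unfolding True by simp
    next
      case False
      then obtain m1 n1 where z1: "m1\<^sup>2 + n1\<^sup>2 = E" "coprime m1 n1" "f (m1, n1) = b" by (auto simp: P_def)
      define w where "w = (\<lambda>(m2, n2). (2 * (m1 * n2 - m2 * n1) div E, m1 * m2 + n1 * n2 \<ge> 0))"
      \<comment> \<open>Both \<open>g\<close> and \<open>h\<close> divide D (cancel
        \<open>n0\<close>, which is prime to E), E divides \<open>g * h\<close>, and k = gcd g h
        divides 2 because it divides 2 m2 and 2 n2. Hence E divides g h, which divides k D, which
        divides 2 D.\<close>
      have key: "E dvd 2 * (m1 * n2 - m2 * n1)"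
        if z2: "m2\<^sup>2 + n2\<^sup>2 = E" "coprime m2 n2" "f (m2, n2) = b" for m2 n2
      proof -
        define g h where "g = gcd (m2 * n0 - n2 * m0) E" and "h = gcd (m2 * n0 + n2 * m0) E"
        define D where "D = m1 * n2 - m2 * n1"
        have g1: "gcd (m1 * n0 - n1 * m0) E = g" and h1: "gcd (m1 * n0 + n1 * m0) E = h"
          using z1(3) z2(3) by (auto simp: f_def g_def h_def)
        have gE: "g dvd E" "h dvd E" by (auto simp: g_def h_def)
        have gv: "g dvd m2 * n0 - n2 * m0" "g dvd m1 * n0 - n1 * m0" using gcd_dvd1[of "m1 * n0 - n1 * m0" E] unfolding g1 by (simp_all add: g_def)
        have hv: "h dvd m2 * n0 + n2 * m0" "h dvd m1 * n0 + n1 * m0" using gcd_dvd1[of "m1 * n0 + n1 * m0" E] unfolding h1 by (simp_all add: h_def)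
        have cg: "coprime g n0" "coprime h n0"
          using cop gE by (meson coprime_commute coprime_divisors dvd_refl)+
        have cg': "coprime g m0"
          using cop gE by (meson coprime_commute coprime_divisors dvd_refl)
        have "g dvd n2 * (m1 * n0 - n1 * m0) - n1 * (m2 * n0 - n2 * m0)" by (rule dvd_diff[OF dvd_mult[OF gv(2)] dvd_mult[OF gv(1)]])
        also have "\<dots> = D * n0" by (simp add: D_def algebra_simps)
        finally have gD: "g dvd D" using cg by (simp add: coprime_dvd_mult_left_iff)
        have "h dvd n2 * (m1 * n0 + n1 * m0) - n1 * (m2 * n0 + n2 * m0)" by (rule dvd_diff[OF dvd_mult[OF hv(2)] dvd_mult[OF hv(1)]])
        also have "\<dots> = D * n0" by (simp add: D_def algebra_simps)
        finally have hD: "h dvd D" using cg by (simp add: coprime_dvd_mult_left_iff)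
        have "(m2 * n0 - n2 * m0) * (m2 * n0 + n2 * m0) = m2\<^sup>2 * n0\<^sup>2 - n2\<^sup>2 * m0\<^sup>2"
          by (simp add: algebra_simps power2_eq_square)
        also have "\<dots> = m2\<^sup>2 * (E - m0\<^sup>2) - (E - m2\<^sup>2) * m0\<^sup>2"
        proof -
          have "n0\<^sup>2 = E - m0\<^sup>2" "n2\<^sup>2 = E - m2\<^sup>2" using z0(1) z2(1) by simp_all
          then show ?thesis by (simp only:)
        qed
        also have "\<dots> = E * (m2\<^sup>2 - m0\<^sup>2)" by (simp add: algebra_simps)
        finally have vv: "E dvd (m2 * n0 - n2 * m0) * (m2 * n0 + n2 * m0)" by simp
        have Egh: "E dvd g * h"
        proof -
          have "E dvd g * (m2 * n0 + n2 * m0)"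
          proof -
            have "E dvd gcd ((m2 * n0 - n2 * m0) * (m2 * n0 + n2 * m0)) (E * (m2 * n0 + n2 * m0))"
              using vv by (intro gcd_greatest) auto
            also have "\<dots> = \<bar>g * (m2 * n0 + n2 * m0)\<bar>"
              by (simp add: g_def gcd_mult_right[symmetric] gcd_mult_distrib_int abs_mult mult.commute)
            finally show ?thesis by simp
          qed
          then have "E dvd gcd (g * (m2 * n0 + n2 * m0)) (g * E)" by (intro gcd_greatest) auto
          also have "\<dots> = \<bar>g * h\<bar>" by (simp add: h_def gcd_mult_left abs_mult)
          finally show ?thesis by simp
        qed
        define k where "k = gcd g h"
        have kk: "k dvd m2 * n0 - n2 * m0" "k dvd m2 * n0 + n2 * m0"
          using dvd_trans[OF gcd_dvd1 gv(1)] dvd_trans[OF gcd_dvd2 hv(1)] unfolding k_def by blast+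
        have "k dvd (m2 * n0 - n2 * m0) + (m2 * n0 + n2 * m0)" by (rule dvd_add[OF kk])
        then have "k dvd 2 * m2 * n0" by (simp add: algebra_simps)
        moreover have "coprime k n0" by (rule coprime_divisors[OF _ dvd_refl cg(1)]) (simp add: k_def)
        ultimately have k1: "k dvd 2 * m2" by (simp add: coprime_dvd_mult_left_iff)
        have "k dvd (m2 * n0 + n2 * m0) - (m2 * n0 - n2 * m0)" by (rule dvd_diff[OF kk(2,1)])
        then have "k dvd 2 * n2 * m0" by (simp add: algebra_simps)
        moreover have "coprime k m0" by (rule coprime_divisors[OF _ dvd_refl cg']) (simp add: k_def)
        ultimately have k2: "k dvd 2 * n2" by (simp add: coprime_dvd_mult_left_iff)
        have "k dvd gcd (2 * m2) (2 * n2)" using k1 k2 by simp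
        then have "k dvd 2" using z2(2) by (simp add: gcd_mult_left coprime_iff_gcd_eq_1)
        \<comment> \<open>\<open>g * h\<close> divides \<open>g * D\<close> because h | D, and
          \<open>h * D\<close> because g | D; the gcd of these two is \<open>k * D\<close> up to
          sign.\<close>
        have "g * h dvd gcd (g * D) (h * D)" using gD hD by (intro gcd_greatest) (auto simp: mult.commute mult_dvd_mono)
        also have "gcd (g * D) (h * D) dvd k * D" by (simp add: k_def gcd_mult_right)
        also have "k * D dvd 2 * D" using \<open>k dvd 2\<close> by (rule mult_dvd_mono) simp
        finally show ?thesis using Egh D_def dvd_trans by blast
      qed
      have id1: "(m1 * n2 - m2 * n1)\<^sup>2 + (m1 * m2 + n1 * n2)\<^sup>2 = E\<^sup>2" if "m2\<^sup>2 + n2\<^sup>2 = E" for m2 n2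
      proof -
        have "(m1 * n2 - m2 * n1)\<^sup>2 + (m1 * m2 + n1 * n2)\<^sup>2 = (m1\<^sup>2 + n1\<^sup>2) * (m2\<^sup>2 + n2\<^sup>2)"
          by (simp add: algebra_simps power2_eq_square)
        then show ?thesis using z1 that by (simp add: power2_eq_square)
      qed
      \<comment> \<open>\<open>w\<close> keeps D = Im(conj(z1) z) and the sign of U = Re(conj(z1)
        z). By \<open>id1\<close> this fixes U, and E z = z1 (U + i D) recovers z.\<close>
      have winj: "inj_on w {z \<in> P. f z = b}"
      proof (rule inj_onI)
        fix z z' assume zz: "z \<in> {z \<in> P. f z = b}" "z' \<in> {z \<in> P. f z = b}" "w z = w z'"
        obtain m2 n2 where z: "z = (m2, n2)" "m2\<^sup>2 + n2\<^sup>2 = E" "coprime m2 n2"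
          using zz(1) by (auto simp: P_def)
        obtain m3 n3 where z': "z' = (m3, n3)" "m3\<^sup>2 + n3\<^sup>2 = E" "coprime m3 n3"
          using zz(2) by (auto simp: P_def)
        note z2 = z(2,3) and z3 = z'(2,3)
        have ff: "f (m2, n2) = b" "f (m3, n3) = b" and ww: "w (m2, n2) = w (m3, n3)"
          using zz z(1) z'(1) by auto
        have DD: "m1 * n2 - m2 * n1 = m1 * n3 - m3 * n1"
          using key[OF z2 ff(1)] key[OF z3 ff(2)] ww by (auto simp: w_def dvd_div_eq_iff E)
        have "(m1 * m2 + n1 * n2)\<^sup>2 = (m1 * m3 + n1 * n3)\<^sup>2"
          using id1[OF z2(1)] id1[OF z3(1)] DD by simp
        then have UU: "m1 * m2 + n1 * n2 = m1 * m3 + n1 * n3"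
          using ww by (auto simp: w_def power2_eq_iff)
        have "E * m2 = m1 * (m1 * m2 + n1 * n2) - n1 * (m1 * n2 - m2 * n1)"
          using z1(1) by (simp add: algebra_simps power2_eq_square flip: z1(1))
        also have "\<dots> = E * m3"
          unfolding UU DD by (simp add: algebra_simps power2_eq_square flip: z1(1))
        finally have "m2 = m3" using E by simp
        have "E * n2 = n1 * (m1 * m2 + n1 * n2) + m1 * (m1 * n2 - m2 * n1)"
          by (simp add: algebra_simps power2_eq_square flip: z1(1))
        also have "\<dots> = E * n3"
          unfolding UU DD by (simp add: algebra_simps power2_eq_square flip: z1(1))
        finally have "n2 = n3" using E by simp
        then show "z = z'" using \<open>m2 = m3\<close> z(1) z'(1) by simp
      qed
      \<comment> \<open>As |D| <= E, the quotient of 2 D by E is one of -2, ..., 2; with the sign of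
        U this makes ten values.\<close>
      have wsub: "w ` {z \<in> P. f z = b} \<subseteq> {-2..2} \<times> UNIV"
      proof (rule image_subsetI)
        fix z assume "z \<in> {z \<in> P. f z = b}"
        then obtain m2 n2 where z: "z = (m2, n2)" and z2: "m2\<^sup>2 + n2\<^sup>2 = E" by (auto simp: P_def)
        have "(m1 * n2 - m2 * n1)\<^sup>2 \<le> E\<^sup>2" using id1[OF z2] by (smt (verit) zero_le_power2)
        then have D: "\<bar>m1 * n2 - m2 * n1\<bar> \<le> E" using E by (simp add: abs_le_square_iff[symmetric])
        have "2 * (m1 * n2 - m2 * n1) div E \<le> 2 * E div E" using D E by (intro zdiv_mono1) auto
        moreover have "(-2) * E div E \<le> 2 * (m1 * n2 - m2 * n1) div E" using D E by (intro zdiv_mono1) auto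
        moreover have "(-2) * E div E = -2" "2 * E div E = 2" using E by (simp_all only: nonzero_mult_div_cancel_right)
        ultimately show "w z \<in> {-2..2} \<times> UNIV" unfolding w_def z by simp
      qed
      have "finite (({-2..2}::int set) \<times> (UNIV::bool set))" by simp
      moreover have "card (({-2..2}::int set) \<times> (UNIV::bool set)) = 10" by (simp add: card_cartesian_product)
      ultimately show ?thesis
        using card_inj_on_le[OF winj wsub] inj_on_finite[OF winj wsub] by simp
    qed
    show ?thesis using card_le_fibers[OF _ fD, of 10] finD fib by blast
  qed
  then show "finite P" "card P \<le> 10 * (card {d. 0 < d \<and> d dvd E})\<^sup>2"
    by (auto simp: card_cartesian_product power2_eq_square Dv_def)
qed

text \<open>Solutions are sorted by d = gcd x y. Division by d gives a primitive solution for E /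
  d^2, whose divisors are among those of E; the sum over the possible d adds the third
  power.\<close>

lemma card_sum_two_squares:
  fixes E :: int
  assumes E: "E > 0"
  shows "finite {(x, y). x\<^sup>2 + y\<^sup>2 = E}"
    and "card {(x, y). x\<^sup>2 + y\<^sup>2 = E} \<le> 10 * (card {d. 0 < d \<and> d dvd E}) ^ 3"
proof -
  define R where "R = {(x, y). x\<^sup>2 + y\<^sup>2 = E}"
  define Dv where "Dv = {d. 0 < d \<and> d dvd E}"
  have finD: "finite Dv"
    unfolding Dv_def by (rule finite_subset[of _ "{0..E}"]) (use E in \<open>auto intro: zdvd_imp_le\<close>)
  define f where "f = (\<lambda>(x::int, y). gcd x y)"
  have sq: "(gcd x y)\<^sup>2 dvd E" if "x\<^sup>2 + y\<^sup>2 = E" for x y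
    using that by (metis dvd_add dvd_power_same gcd_dvd1 gcd_dvd2)
  have fD: "f ` R \<subseteq> Dv"
  proof (rule image_subsetI)
    fix z assume "z \<in> R"
    then obtain x y where z: "z = (x, y)" and xy: "x\<^sup>2 + y\<^sup>2 = E" by (auto simp: R_def)
    have "gcd x y dvd (gcd x y)\<^sup>2" by (simp add: power2_eq_square)
    then have "gcd x y dvd E" using sq[OF xy] by (rule dvd_trans)
    moreover have "x \<noteq> 0 \<or> y \<noteq> 0" using xy E by auto
    then have "gcd x y > 0" by (simp only: gcd_pos_int)
    ultimately show "f z \<in> Dv" by (simp add: f_def Dv_def z)
  qed
  have fib: "finite {z \<in> R. f z = d} \<and> card {z \<in> R. f z = d} \<le> 10 * (card Dv)\<^sup>2" if d: "d \<in> Dv" for d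
  proof (cases "{z \<in> R. f z = d} = {}")
    case True
    show ?thesis unfolding True by simp
  next
    case False
    then obtain x0 y0 where "x0\<^sup>2 + y0\<^sup>2 = E" "gcd x0 y0 = d" by (auto simp: R_def f_def)
    then have dE: "d\<^sup>2 dvd E" using sq by metis
    have dp: "d > 0" using d by (simp add: Dv_def)
    define E' where "E' = E div d\<^sup>2"
    have EE: "E = d\<^sup>2 * E'" using dE by (simp add: E'_def)
    have E': "E' > 0" using E dp by (simp add: EE zero_less_mult_iff)
    define P where "P = {(x, y). x\<^sup>2 + y\<^sup>2 = E' \<and> coprime x y}"
    have "{z \<in> R. f z = d} \<subseteq> (\<lambda>(x, y). (d * x, d * y)) ` P"
    proof
      fix z assume "z \<in> {z \<in> R. f z = d}"
      then obtain x y where z: "z = (x, y)" and xy: "x\<^sup>2 + y\<^sup>2 = E" "gcd x y = d" by (auto simp: R_def f_def)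
      then obtain a b where ab: "x = d * a" "y = d * b" by (metis dvdE gcd_dvd1 gcd_dvd2)
      have "d\<^sup>2 * (a\<^sup>2 + b\<^sup>2) = d\<^sup>2 * E'" using xy ab EE by (simp add: algebra_simps power_mult_distrib)
      then have "a\<^sup>2 + b\<^sup>2 = E'" using dp by simp
      moreover have "coprime a b"
        using xy(2) ab dp by (simp add: gcd_mult_left coprime_iff_gcd_eq_1)
      ultimately show "z \<in> (\<lambda>(x, y). (d * x, d * y)) ` P" using ab z by (auto simp: P_def)
    qed
    moreover have P: "finite P" "card P \<le> 10 * (card {d. 0 < d \<and> d dvd E'})\<^sup>2"
      using card_primitive_sum_two_squares[OF E'] by (auto simp: P_def)
    ultimately have 1: "finite {z \<in> R. f z = d}" "card {z \<in> R. f z = d} \<le> card P"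
      using finite_subset surj_card_le[of P] by (blast, blast)
    have "card {d. 0 < d \<and> d dvd E'} \<le> card Dv"
      by (intro card_mono finD) (auto simp: Dv_def EE)
    then have "(card {d. 0 < d \<and> d dvd E'})\<^sup>2 \<le> (card Dv)\<^sup>2" by (intro power_mono) auto
    then show ?thesis using 1 P by linarith
  qed
  have "finite R" "card R \<le> card Dv * (10 * (card Dv)\<^sup>2)" using card_le_fibers[OF finD fD fib] by auto
  then show "finite {(x, y). x\<^sup>2 + y\<^sup>2 = E}"
    and "card {(x, y). x\<^sup>2 + y\<^sup>2 = E} \<le> 10 * (card {d. 0 < d \<and> d dvd E}) ^ 3"
    by (auto simp: R_def Dv_def power2_eq_square power3_eq_cube)
qed

lemma freqs_integer_coords:
  assumes "\<xi> \<in> freqs E"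
  obtains m n :: int where "\<xi> $ 1 = of_int m" "\<xi> $ 2 = of_int n" "of_int (m\<^sup>2 + n\<^sup>2) = E"
proof -
  obtain m n :: int where mn: "\<xi> $ 1 = of_int m" "\<xi> $ 2 = of_int n"
    using assms by (auto simp: freqs_def int_lattice_def elim!: Ints_cases dest: spec)
        (metis Ints_cases)
  have "(norm \<xi>)\<^sup>2 = (\<xi> $ 1)\<^sup>2 + (\<xi> $ 2)\<^sup>2"
    unfolding power2_norm_eq_inner by (simp add: inner_vec_def sum_2 power2_eq_square)
  then show thesis using that[OF mn] assms mn by (simp add: freqs_def)
qed

lemma card_freqs_subpolynomial:
  assumes \<delta>: "\<delta> > 0"
  shows "\<exists>C>0. \<forall>lam\<ge>1. real (card (freqs (lam\<^sup>2))) \<le> C * lam powr \<delta>"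
proof -
  \<comment> \<open>The exponent is \<delta>/6 because the divisor count enters cubed and E is the
    square of \<open>lam\<close>.\<close>
  obtain C where C: "C \<ge> 0" "\<And>n::nat. n > 0 \<Longrightarrow> real (divisor_count n) \<le> C * real n powr (\<delta> / 6)"
    using card_divisors_subpolynomial[of "\<delta> / 6"] \<delta> by auto
  have "real (card (freqs (lam\<^sup>2))) \<le> (10 * C ^ 3 + 1) * lam powr \<delta>" if lam: "lam \<ge> 1" for lam
  proof (cases "freqs (lam\<^sup>2) = {}")
    case True
    then show ?thesis using C by simp
  next
    case False
    then obtain \<xi> where "\<xi> \<in> freqs (lam\<^sup>2)" by auto
    then obtain m0 n0 :: int where "of_int (m0\<^sup>2 + n0\<^sup>2) = lam\<^sup>2" by (rule freqs_integer_coords)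
    then obtain E :: int where E: "of_int E = lam\<^sup>2" by blast
    have Ep: "E > 0"
    proof -
      have "real_of_int E > 0" unfolding E using lam by simp
      then show ?thesis by simp
    qed
    define n where "n = nat E"
    have n: "n > 0" "E = int n" "real n = lam\<^sup>2" using Ep E by (auto simp: n_def)
    have "freqs (lam\<^sup>2) \<subseteq> (\<lambda>(x, y). vector [of_int x, of_int y]) ` {(x, y). x\<^sup>2 + y\<^sup>2 = E}"
    proof
      fix \<xi> assume "\<xi> \<in> freqs (lam\<^sup>2)"
      then obtain a b :: int where ab: "\<xi> $ 1 = of_int a" "\<xi> $ 2 = of_int b" "of_int (a\<^sup>2 + b\<^sup>2) = lam\<^sup>2"
        by (rule freqs_integer_coords)
      have "a\<^sup>2 + b\<^sup>2 = E" using ab(3) E by (metis of_int_eq_iff)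
      moreover have "\<xi> = vector [of_int a, of_int b]" using ab by (simp add: vec_eq_iff forall_2)
      ultimately show "\<xi> \<in> (\<lambda>(x, y). vector [of_int x, of_int y]) ` {(x, y). x\<^sup>2 + y\<^sup>2 = E}" by auto
    qed
    then have "card (freqs (lam\<^sup>2)) \<le> card {(x, y). x\<^sup>2 + y\<^sup>2 = E}"
      using card_sum_two_squares(1)[OF Ep] surj_card_le by blast
    also have "\<dots> \<le> 10 * (card {d. 0 < d \<and> d dvd E}) ^ 3" by (rule card_sum_two_squares(2)[OF Ep])
    also have "card {d. 0 < d \<and> d dvd E} \<le> divisor_count n"
    proof (rule surj_card_le[where f = int])
      show "finite {d. d dvd n}" using n by simp
      show "{d. 0 < d \<and> d dvd E} \<subseteq> int ` {d. d dvd n}"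
      proof
        fix d assume "d \<in> {d. 0 < d \<and> d dvd E}"
        then have "d = int (nat d)" "nat d dvd n" using n(2) by (auto simp: nat_dvd_iff)
        then show "d \<in> int ` {d. d dvd n}" by blast
      qed
    qed
    finally have "card (freqs (lam\<^sup>2)) \<le> 10 * (divisor_count n) ^ 3" by simp
    then have "real (card (freqs (lam\<^sup>2))) \<le> real (10 * (divisor_count n) ^ 3)" by (simp only: of_nat_le_iff)
    also have "\<dots> = 10 * real (divisor_count n) ^ 3" by simp
    also have "\<dots> \<le> 10 * (C * real n powr (\<delta> / 6)) ^ 3"
      using C(2)[OF n(1)] by (intro mult_left_mono power_mono) auto
    also have "\<dots> = 10 * C ^ 3 * (real n powr (\<delta> / 6)) ^ 3" by (simp add: power_mult_distrib)
    also have "(real n powr (\<delta> / 6)) ^ 3 = lam powr \<delta>"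
    proof -
      have "real n = lam powr 2" using n lam by (simp add: powr_numeral)
      then have "real n powr (\<delta> / 6) = lam powr (2 * (\<delta> / 6))" by (simp only: powr_powr)
      moreover have "(lam powr (2 * (\<delta> / 6))) ^ 3 = (lam powr (2 * (\<delta> / 6))) powr real 3"
        by (rule powr_realpow[symmetric]) (use lam in simp)
      ultimately show ?thesis by (simp only: powr_powr) simp
    qed
    finally have "real (card (freqs (lam\<^sup>2))) \<le> 10 * C ^ 3 * lam powr \<delta>" .
    moreover have "0 \<le> lam powr \<delta>" by simp
    ultimately show ?thesis unfolding distrib_right by linarith
  qed
  moreover have "10 * C ^ 3 + 1 > 0" using C by (intro add_nonneg_pos) auto
  ultimately show ?thesis by blast
qed

section \<open>Oscillatory integrals\<close>

definition ee :: "real \<Rightarrow> complex" where "ee t = exp (2 * of_real pi * \<i> * of_real t)"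

locale phase_function =
  fixes f f' f'' :: "real \<Rightarrow> real" and a b :: real
  assumes ab: "a \<le> b"
    and d1: "\<And>t. t \<in> {a..b} \<Longrightarrow> (f has_vector_derivative f' t) (at t within {a..b})"
    and d2: "\<And>t. t \<in> {a..b} \<Longrightarrow> (f' has_vector_derivative f'' t) (at t within {a..b})"
    and c2: "continuous_on {a..b} f''"
begin

text \<open>Integration by parts: exp(i f) / (i f') has derivative exp(i f) + r with |r| = |f''| /
  f'^2, and its two boundary values give 2 / L.\<close>

lemma oscillatory_by_parts:
  assumes L: "L > 0" and lower: "\<And>t. t \<in> {a..b} \<Longrightarrow> \<bar>f' t\<bar> \<ge> L"
  shows "norm (integral {a..b} (\<lambda>t. exp (\<i> * of_real (f t))))
    \<le> 2 / L + integral {a..b} (\<lambda>t. \<bar>f'' t\<bar> / (f' t)\<^sup>2)"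
proof -
  define u where "u t = exp (\<i> * complex_of_real (f t))" for t
  define g where "g t = u t / (\<i> * of_real (f' t))" for t
  define r where "r t = \<i> * u t * of_real (f'' t / (f' t)\<^sup>2)" for t
  have nz: "f' t \<noteq> 0" if "t \<in> {a..b}" for t using lower[OF that] L by auto
  have cf: "continuous_on {a..b} f"
    using d1 by (intro continuous_on_vector_derivative) auto
  have cf': "continuous_on {a..b} f'"
    using d2 by (intro continuous_on_vector_derivative) auto
  have cu: "continuous_on {a..b} u"
    unfolding u_def by (intro continuous_intros cf)
  have cq: "continuous_on {a..b} (\<lambda>t. f'' t / (f' t)\<^sup>2)"
    by (intro continuous_intros c2 cf') (use nz in auto)
  have cr: "continuous_on {a..b} r"
    unfolding r_def by (intro continuous_intros cu cq)
  have "(g has_vector_derivative (u t + r t)) (at t within {a..b})" if t: "t \<in> {a..b}" for t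
  proof -
    have u': "(u has_vector_derivative (\<i> * of_real (f' t) * u t)) (at t within {a..b})"
    proof -
      have "((\<lambda>t. \<i> * complex_of_real (f t)) has_vector_derivative \<i> * of_real (f' t)) (at t within {a..b})"
        by (intro has_vector_derivative_mult_right has_vector_derivative_of_real) (use d1[OF t] in \<open>simp add: has_real_derivative_iff_has_vector_derivative\<close>)
      then have "((exp \<circ> (\<lambda>t. \<i> * complex_of_real (f t))) has_vector_derivative
          (\<i> * of_real (f' t)) * exp (\<i> * complex_of_real (f t))) (at t within {a..b})"
        by (rule field_vector_diff_chain_within) (rule has_field_derivative_at_within[OF DERIV_exp])
      then show ?thesis unfolding o_def u_def .
    qed
    have "((\<lambda>t. inverse (f' t)) has_vector_derivative (- f'' t / (f' t)\<^sup>2)) (at t within {a..b})"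
      using d2[OF t] nz[OF t] unfolding has_real_derivative_iff_has_vector_derivative[symmetric]
      by (auto intro!: derivative_eq_intros simp: power2_eq_square divide_simps)
    then have "((\<lambda>t. complex_of_real (inverse (f' t))) has_vector_derivative of_real (- f'' t / (f' t)\<^sup>2)) (at t within {a..b})"
      by (intro has_vector_derivative_of_real) (simp add: has_real_derivative_iff_has_vector_derivative)
    from has_vector_derivative_mult[OF u' this]
    have "((\<lambda>t. u t * of_real (inverse (f' t))) has_vector_derivative
        (u t * of_real (- f'' t / (f' t)\<^sup>2) + \<i> * of_real (f' t) * u t * of_real (inverse (f' t)))) (at t within {a..b})" .
    from has_vector_derivative_mult_right[OF this, of "-\<i>"]
    have "((\<lambda>t. -\<i> * (u t * of_real (inverse (f' t)))) has_vector_derivative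
        -\<i> * (u t * of_real (- f'' t / (f' t)\<^sup>2) + \<i> * of_real (f' t) * u t * of_real (inverse (f' t)))) (at t within {a..b})" .
    moreover have "-\<i> * (u t * of_real (- f'' t / (f' t)\<^sup>2) + \<i> * of_real (f' t) * u t * of_real (inverse (f' t))) = u t + r t"
      using nz[OF t] unfolding r_def by (simp add: field_simps)
    moreover have "(\<lambda>t. -\<i> * (u t * of_real (inverse (f' t)))) = g"
      by (rule ext) (simp add: g_def divide_inverse inverse_mult_distrib)
    ultimately show ?thesis by simp
  qed
  then have "((\<lambda>t. u t + r t) has_integral (g b - g a)) {a..b}"
    using ab by (intro fundamental_theorem_of_calculus) auto
  moreover have "(r has_integral integral {a..b} r) {a..b}"
    by (intro integrable_integral integrable_continuous_real cr)
  ultimately have "((\<lambda>t. (u t + r t) - r t) has_integral (g b - g a) - integral {a..b} r) {a..b}"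
    by (rule has_integral_diff)
  then have eq: "integral {a..b} u = (g b - g a) - integral {a..b} r"
    by (simp add: integral_unique)
  have ng: "norm (g t) \<le> 1 / L" if "t \<in> {a..b}" for t
    using lower[OF that] L by (simp add: g_def u_def norm_divide norm_mult divide_simps)
  have "norm (integral {a..b} r) \<le> integral {a..b} (\<lambda>t. \<bar>f'' t\<bar> / (f' t)\<^sup>2)"
  proof (rule integral_norm_bound_integral)
    show "r integrable_on {a..b}" by (intro integrable_continuous_real cr)
    show "(\<lambda>t. \<bar>f'' t\<bar> / (f' t)\<^sup>2) integrable_on {a..b}"
      by (intro integrable_continuous_real continuous_intros c2 cf') (use nz in auto)
    fix t assume "t \<in> {a..b}"
    then show "norm (r t) \<le> \<bar>f'' t\<bar> / (f' t)\<^sup>2"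
      by (simp add: r_def u_def norm_mult norm_divide norm_power)
  qed
  moreover have "norm (g b) \<le> 1/L" "norm (g a) \<le> 1/L" using ng ab by auto
  moreover have "norm (integral {a..b} u) \<le> norm (g b) + norm (g a) + norm (integral {a..b} r)"
    unfolding eq by norm
  ultimately show ?thesis unfolding u_def by (simp add: u_def)
qed

text \<open>Serves frequencies with a large component along the tangent of the arc, where f'' may
  change sign and is merely bounded above.\<close>

lemma oscillatory_nonstationary:
  assumes L: "L > 0" and lower: "\<And>t. t \<in> {a..b} \<Longrightarrow> \<bar>f' t\<bar> \<ge> L"
    and upper: "\<And>t. t \<in> {a..b} \<Longrightarrow> \<bar>f'' t\<bar> \<le> M"
  shows "norm (integral {a..b} (\<lambda>t. exp (\<i> * of_real (f t)))) \<le> 2 / L + (b - a) * M / L\<^sup>2"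
proof -
  have nz: "f' t \<noteq> 0" if "t \<in> {a..b}" for t using lower[OF that] L by auto
  have cf': "continuous_on {a..b} f'"
    using d2 by (intro continuous_on_vector_derivative) auto
  have "integral {a..b} (\<lambda>t. \<bar>f'' t\<bar> / (f' t)\<^sup>2) \<le> integral {a..b} (\<lambda>t. M / L\<^sup>2)"
  proof (rule integral_le)
    show "(\<lambda>t. \<bar>f'' t\<bar> / (f' t)\<^sup>2) integrable_on {a..b}"
      by (intro integrable_continuous_real continuous_intros c2 cf') (use nz in auto)
    show "(\<lambda>t. M / L\<^sup>2) integrable_on {a..b}" by (intro integrable_continuous_real continuous_intros)
    fix t assume t: "t \<in> {a..b}"
    have "L\<^sup>2 \<le> (f' t)\<^sup>2" using lower[OF t] L by (simp add: abs_le_square_iff[symmetric])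
    then show "\<bar>f'' t\<bar> / (f' t)\<^sup>2 \<le> M / L\<^sup>2"
      using upper[OF t] L by (intro frac_le) auto
  qed
  also have "\<dots> = (b - a) * M / L\<^sup>2" using ab by simp
  finally show ?thesis using oscillatory_by_parts[OF L lower] by linarith
qed

text \<open>The sign of f'' makes |f''| / f'^2 the exact derivative of -1/f', so the remainder is at
  most 2 / L however large f'' is.\<close>

lemma oscillatory_monotone:
  assumes L: "L > 0" and lower: "\<And>t. t \<in> {a..b} \<Longrightarrow> \<bar>f' t\<bar> \<ge> L"
    and pos: "\<And>t. t \<in> {a..b} \<Longrightarrow> f'' t \<ge> 0"
  shows "norm (integral {a..b} (\<lambda>t. exp (\<i> * of_real (f t)))) \<le> 4 / L"
proof -
  have nz: "f' t \<noteq> 0" if "t \<in> {a..b}" for t using lower[OF that] L by auto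
  have "((\<lambda>t. - inverse (f' t)) has_vector_derivative (\<bar>f'' t\<bar> / (f' t)\<^sup>2)) (at t within {a..b})"
    if t: "t \<in> {a..b}" for t
    using d2[OF t] nz[OF t] pos[OF t] unfolding has_real_derivative_iff_has_vector_derivative[symmetric]
    by (auto intro!: derivative_eq_intros simp: power2_eq_square divide_simps)
  then have "((\<lambda>t. \<bar>f'' t\<bar> / (f' t)\<^sup>2) has_integral (- inverse (f' b) - - inverse (f' a))) {a..b}"
    using ab by (intro fundamental_theorem_of_calculus) auto
  then have "integral {a..b} (\<lambda>t. \<bar>f'' t\<bar> / (f' t)\<^sup>2) = inverse (f' a) - inverse (f' b)"
    by (simp add: integral_unique)
  moreover have "\<bar>inverse (f' t)\<bar> \<le> 1 / L" if "t \<in> {a..b}" for t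
    using lower[OF that] L by (simp add: divide_simps)
  then have "\<bar>inverse (f' a)\<bar> \<le> 1 / L" "\<bar>inverse (f' b)\<bar> \<le> 1 / L" using ab by auto
  moreover have "2 / L + (1 / L + 1 / L) = 4 / L" by (simp add: field_simps)
  ultimately show ?thesis using oscillatory_by_parts[OF L lower] by linarith
qed

text \<open>Van der Corput's second derivative bound: f' grows at rate at least \<mu>, so |f'| >=
  \<mu> |t - c| for some c. A short interval around c is estimated by its length, the two remaining
  pieces by the monotone case.\<close>

lemma oscillatory_stationary_pos:
  assumes mu: "\<mu> > 0" and lower: "\<And>t. t \<in> {a..b} \<Longrightarrow> f'' t \<ge> \<mu>"
  shows "norm (integral {a..b} (\<lambda>t. exp (\<i> * of_real (f t)))) \<le> 10 / sqrt \<mu>"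
proof -
  let ?u = "\<lambda>t. exp (\<i> * complex_of_real (f t))"
  have cf: "continuous_on {a..b} f"
    using d1 by (intro continuous_on_vector_derivative) auto
  have cf': "continuous_on {a..b} f'"
    using d2 by (intro continuous_on_vector_derivative) auto
  have grow: "f' y - f' x \<ge> \<mu> * (y - x)" if "a \<le> x" "x \<le> y" "y \<le> b" for x y
  proof -
    have 1: "(f'' has_integral (f' y - f' x)) {x..y}"
      using that by (intro fundamental_theorem_of_calculus has_vector_derivative_within_subset[OF d2]) auto
    have 2: "((\<lambda>_. \<mu>) has_integral (\<mu> * (y - x))) {x..y}"
      using has_integral_const_real[of \<mu> x y] that by (simp add: mult.commute)
    show ?thesis
      by (rule has_integral_le[OF 2 1]) (use that in \<open>auto intro!: lower\<close>)
  qed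
  \<comment> \<open>c is the zero of f', or the endpoint nearest to it when f' keeps one
    sign.\<close>
  obtain c where c: "c \<in> {a..b}" "\<And>t. t \<in> {a..b} \<Longrightarrow> \<bar>f' t\<bar> \<ge> \<mu> * \<bar>t - c\<bar>"
  proof -
    have "f' a \<ge> 0 \<or> f' b \<le> 0 \<or> (f' a \<le> 0 \<and> f' b \<ge> 0)" by linarith
    then consider (1) "f' a \<ge> 0" | (2) "f' b \<le> 0" | (3) "f' a \<le> 0" "f' b \<ge> 0" by blast
    then show thesis
    proof cases
      case 1
      have *: "\<bar>f' t\<bar> \<ge> \<mu> * \<bar>t - a\<bar>" if "t \<in> {a..b}" for t
      proof -
        have "\<bar>t - a\<bar> = t - a" using that by simp
        then show ?thesis using grow[of a t] that 1 by simp
      qed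
      show thesis by (rule that[of a]) (use * ab in auto)
    next
      case 2
      have *: "\<bar>f' t\<bar> \<ge> \<mu> * \<bar>t - b\<bar>" if "t \<in> {a..b}" for t
      proof -
        have "\<bar>t - b\<bar> = b - t" using that by simp
        then show ?thesis using grow[of t b] that 2 by simp
      qed
      show thesis by (rule that[of b]) (use * ab in auto)
    next
      case 3
      then obtain c where c: "a \<le> c" "c \<le> b" "f' c = 0"
        using IVT'[of f' a 0 b] ab cf' by auto
      have *: "\<bar>f' t\<bar> \<ge> \<mu> * \<bar>t - c\<bar>" if t: "t \<in> {a..b}" for t
      proof (cases "t \<le> c")
        case True
        then have "\<bar>t - c\<bar> = c - t" by simp
        then show ?thesis using grow[of t c] t c True by simp
      next
        case False
        then have "\<bar>t - c\<bar> = t - c" by simp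
        then show ?thesis using grow[of c t] t c False by simp
      qed
      show thesis by (rule that[of c]) (use * c in auto)
    qed
  qed
  \<comment> \<open>This radius balances the trivial bound 2 \<delta> near c against 4 / (\<mu>
    \<delta>) on either side; the total 2 + 4 + 4 is the constant 10.\<close>
  define \<delta> where "\<delta> = 1 / sqrt \<mu>"
  have \<delta>: "\<delta> > 0" "\<mu> * \<delta> = sqrt \<mu>"
    using mu by (auto simp: \<delta>_def real_div_sqrt)
  define p where "p = max a (c - \<delta>)"
  define q where "q = min b (c + \<delta>)"
  have pq: "a \<le> p" "p \<le> c" "c \<le> q" "q \<le> b" using c \<delta> by (auto simp: p_def q_def)
  have int: "?u integrable_on {x..y}" if "a \<le> x" "y \<le> b" for x y
    by (intro integrable_continuous_real continuous_intros continuous_on_subset[OF cf]) (use that in auto)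
  have piece: "norm (integral {x..y} ?u) \<le> 4 / sqrt \<mu>"
    if "a \<le> x" "x \<le> y" "y \<le> b" and far: "\<And>t. t \<in> {x..y} \<Longrightarrow> \<bar>t - c\<bar> \<ge> \<delta>" for x y
  proof (rule phase_function.oscillatory_monotone[where f' = f' and f'' = f''])
    show "sqrt \<mu> > 0" using mu by simp
    show "\<bar>f' t\<bar> \<ge> sqrt \<mu>" if "t \<in> {x..y}" for t
    proof -
      have "\<mu> * \<bar>t - c\<bar> \<ge> \<mu> * \<delta>" using far[OF that] mu by simp
      then show ?thesis using c(2)[of t] that \<open>a \<le> x\<close> \<open>y \<le> b\<close> \<delta>(2) by auto
    qed
    show "f'' t \<ge> 0" if "t \<in> {x..y}" for t
      using lower[of t] mu that \<open>a \<le> x\<close> \<open>y \<le> b\<close> by force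
    show "phase_function f f' f'' x y"
    proof
      show "(f has_vector_derivative f' t) (at t within {x..y})" if "t \<in> {x..y}" for t
        using that \<open>a \<le> x\<close> \<open>y \<le> b\<close> by (intro has_vector_derivative_within_subset[OF d1]) auto
      show "(f' has_vector_derivative f'' t) (at t within {x..y})" if "t \<in> {x..y}" for t
        using that \<open>a \<le> x\<close> \<open>y \<le> b\<close> by (intro has_vector_derivative_within_subset[OF d2]) auto
      show "continuous_on {x..y} f''"
        using \<open>a \<le> x\<close> \<open>y \<le> b\<close> by (intro continuous_on_subset[OF c2]) auto
    qed fact
  qed
  have "integral {a..b} ?u = integral {a..p} ?u + integral {p..b} ?u"
    using pq by (intro Henstock_Kurzweil_Integration.integral_combine[symmetric] int) auto
  also have "integral {p..b} ?u = integral {p..q} ?u + integral {q..b} ?u"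
    using pq by (intro Henstock_Kurzweil_Integration.integral_combine[symmetric] int) auto
  finally have eq: "integral {a..b} ?u = integral {a..p} ?u + (integral {p..q} ?u + integral {q..b} ?u)" .
  have "norm (integral {p..q} ?u) \<le> integral {p..q} (\<lambda>_. 1::real)"
    using pq by (intro integral_norm_bound_integral int integrable_continuous_real) auto
  also have "\<dots> = q - p" using pq by simp
  also have "\<dots> \<le> 2 * \<delta>" by (simp add: p_def q_def)
  finally have m: "norm (integral {p..q} ?u) \<le> 2 / sqrt \<mu>" by (simp add: \<delta>_def)
  have l: "norm (integral {a..p} ?u) \<le> 4 / sqrt \<mu>"
  proof (cases "p = a")
    case True then show ?thesis using mu by simp
  next
    case False
    then have "p = c - \<delta>" by (auto simp: p_def max_def split: if_splits)
    then show ?thesis using pq by (intro piece) auto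
  qed
  have r: "norm (integral {q..b} ?u) \<le> 4 / sqrt \<mu>"
  proof (cases "q = b")
    case True then show ?thesis using mu by simp
  next
    case False
    then have "q = c + \<delta>" by (auto simp: q_def min_def split: if_splits)
    then show ?thesis using pq by (intro piece) auto
  qed
  have "norm (integral {a..b} ?u) \<le> norm (integral {a..p} ?u) + (norm (integral {p..q} ?u) + norm (integral {q..b} ?u))"
    unfolding eq by norm
  also have "\<dots> \<le> 4 / sqrt \<mu> + (2 / sqrt \<mu> + 4 / sqrt \<mu>)" using l m r by linarith
  finally show ?thesis by (simp add: add_divide_distrib[symmetric])
qed

text \<open>A continuous f'' bounded away from zero keeps its sign, and complex conjugation
  exchanges the two signs.\<close>

lemma oscillatory_stationary:
  assumes mu: "\<mu> > 0" and lower: "\<And>t. t \<in> {a..b} \<Longrightarrow> \<bar>f'' t\<bar> \<ge> \<mu>"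
  shows "norm (integral {a..b} (\<lambda>t. exp (\<i> * of_real (f t)))) \<le> 10 / sqrt \<mu>"
proof -
  have "connected (f'' ` {a..b})" by (intro connected_continuous_image c2) simp
  then have ivl: "is_interval (f'' ` {a..b})" by (simp add: is_interval_connected_1)
  have nz: "0 \<notin> f'' ` {a..b}" using lower mu by force
  have "(\<forall>t\<in>{a..b}. f'' t \<ge> \<mu>) \<or> (\<forall>t\<in>{a..b}. f'' t \<le> - \<mu>)"
  proof (rule ccontr)
    assume "\<not> ?thesis"
    then obtain s t where s: "s \<in> {a..b}" "f'' s < \<mu>" and t: "t \<in> {a..b}" "f'' t > - \<mu>"
      by (auto simp: not_le)
    then have "f'' s \<le> 0" "f'' t \<ge> 0" using lower[of s] lower[of t] by auto
    then have "0 \<in> f'' ` {a..b}" using ivl s t unfolding is_interval_1 by blast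
    then show False using nz by simp
  qed
  then show ?thesis
  proof
    assume "\<forall>t\<in>{a..b}. f'' t \<ge> \<mu>"
    then show ?thesis by (intro oscillatory_stationary_pos[OF mu]) auto
  next
    assume neg: "\<forall>t\<in>{a..b}. f'' t \<le> - \<mu>"
    have "norm (integral {a..b} (\<lambda>t. exp (\<i> * of_real (- f t)))) \<le> 10 / sqrt \<mu>"
    proof (rule phase_function.oscillatory_stationary_pos[OF _ mu])
      show "phase_function (\<lambda>t. - f t) (\<lambda>t. - f' t) (\<lambda>t. - f'' t) a b"
        by unfold_locales (auto intro!: has_vector_derivative_minus d1 d2 c2 continuous_intros ab)
    qed (use neg in \<open>auto simp: le_minus_iff\<close>)
    moreover have "integral {a..b} (\<lambda>t. exp (\<i> * of_real (- f t))) = cnj (integral {a..b} (\<lambda>t. exp (\<i> * of_real (f t))))"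
      by (simp add: integral_cnj exp_cnj)
    ultimately show ?thesis by simp
  qed
qed

end

section \<open>Curved arcs\<close>

lemma ee_eq: "ee t = exp (\<i> * of_real (2 * pi * t))"
  by (simp add: ee_def mult_ac)

abbreviation trig_sum :: "(real^2 \<Rightarrow> complex) \<Rightarrow> (real^2) set \<Rightarrow> real^2 \<Rightarrow> complex" where
  "trig_sum a S z \<equiv> \<Sum>\<xi>\<in>S. a \<xi> * ee (z \<bullet> \<xi>)"

lemma norm_ee [simp]: "norm (ee t) = 1"
  unfolding ee_eq by simp

lemma vector_mean_value_bound:
  fixes f :: "real \<Rightarrow> 'a::banach"
  assumes "\<And>t. t \<in> {a..b} \<Longrightarrow> (f has_vector_derivative f' t) (at t within {a..b})"
    and "\<And>t. t \<in> {a..b} \<Longrightarrow> norm (f' t) \<le> B"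
    and st: "s \<in> {a..b}" "t \<in> {a..b}"
  shows "norm (f t - f s) \<le> B * \<bar>t - s\<bar>"
proof -
  have "norm (f t - f s) \<le> B * norm (t - s)"
  proof (rule differentiable_bound[OF convex_real_interval(5) _ _ st(2,1)])
    fix u assume u: "u \<in> {a..b}"
    show "(f has_derivative (\<lambda>h. h *\<^sub>R f' u)) (at u within {a..b})"
      using assms(1)[OF u] by (simp add: has_vector_derivative_def)
    show "onorm (\<lambda>h. h *\<^sub>R f' u) \<le> B"
      using assms(2)[OF u] by (intro onorm_le) (simp add: mult.commute[of B] mult_left_mono)
  qed
  then show ?thesis by simp
qed

definition rot :: "real^2 \<Rightarrow> real^2" where "rot v = vector [- v $ 2, v $ 1]"

lemma inner_real2: "(x :: real^2) \<bullet> y = x $ 1 * y $ 1 + x $ 2 * y $ 2"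
  by (simp add: inner_vec_def sum_2)

lemma norm_real2_sq: "(norm (x :: real^2))\<^sup>2 = (x $ 1)\<^sup>2 + (x $ 2)\<^sup>2"
  unfolding power2_norm_eq_inner by (simp add: inner_real2 power2_eq_square)

lemma rot_simps [simp]: "rot v $ 1 = - v $ 2" "rot v $ 2 = v $ 1"
  by (simp_all add: rot_def)

lemma rot_diff: "rot (v - w) = rot v - rot w"
  by (simp add: vec_eq_iff forall_2)

lemma norm_rot [simp]: "norm (rot v) = norm v"
proof -
  have "(norm (rot v))\<^sup>2 = (norm v)\<^sup>2" by (simp add: norm_real2_sq)
  then show ?thesis by (simp add: power2_eq_iff_nonneg)
qed

lemma inner_rot_self [simp]: "rot v \<bullet> v = 0"
  by (simp add: inner_real2)

lemma inner_sq_plus_inner_rot_sq: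
  assumes "norm u = 1"
  shows "(\<eta> \<bullet> u)\<^sup>2 + (\<eta> \<bullet> rot u)\<^sup>2 = (norm \<eta>)\<^sup>2"
proof -
  have "(\<eta> \<bullet> u)\<^sup>2 + (\<eta> \<bullet> rot u)\<^sup>2 = ((\<eta> $ 1)\<^sup>2 + (\<eta> $ 2)\<^sup>2) * ((u $ 1)\<^sup>2 + (u $ 2)\<^sup>2)"
    by (simp add: inner_real2 power2_eq_square algebra_simps)
  also have "(u $ 1)\<^sup>2 + (u $ 2)\<^sup>2 = 1" using norm_real2_sq[of u] assms by simp
  finally show ?thesis by (simp add: norm_real2_sq)
qed

text \<open>In the plane v is a multiple of \<open>rot u\<close>. Applied to curvature vectors, it
  turns \<eta> \<bullet> \<gamma>'' into curvature times the normal component of \<eta>.\<close>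

lemma abs_inner_orthogonal:
  assumes u: "norm u = 1" and v: "v \<bullet> u = 0"
  shows "\<bar>\<eta> \<bullet> v\<bar> = norm v * \<bar>\<eta> \<bullet> rot u\<bar>"
proof -
  define k where "k = v \<bullet> rot u"
  have uu: "u $ 1 * u $ 1 + u $ 2 * u $ 2 = 1" using norm_real2_sq[of u] u by (simp add: power2_eq_square)
  have vu: "v $ 1 * u $ 1 = - (v $ 2 * u $ 2)" using v by (simp add: inner_real2)
  have "v $ 1 = v $ 1 * (u $ 1 * u $ 1 + u $ 2 * u $ 2)" by (simp add: uu)
  also have "\<dots> = (v $ 1 * u $ 1) * u $ 1 + v $ 1 * u $ 2 * u $ 2" by (simp add: algebra_simps)
  also have "\<dots> = k * (rot u $ 1)" unfolding vu by (simp add: k_def inner_real2 algebra_simps)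
  finally have 1: "v $ 1 = k * (rot u $ 1)" .
  have "v $ 2 = v $ 2 * (u $ 1 * u $ 1 + u $ 2 * u $ 2)" by (simp add: uu)
  also have "\<dots> = v $ 2 * u $ 1 * u $ 1 - (v $ 1 * u $ 1) * u $ 2" unfolding vu by (simp add: algebra_simps)
  also have "\<dots> = k * (rot u $ 2)" by (simp add: k_def inner_real2 algebra_simps)
  finally have 2: "v $ 2 = k * (rot u $ 2)" .
  have "v = k *\<^sub>R rot u" using 1 2 by (simp add: vec_eq_iff forall_2)
  then show ?thesis using u by (simp add: abs_mult)
qed

locale curved_arc =
  fixes \<gamma> \<gamma>' \<gamma>'' :: "real \<Rightarrow> real^2" and l \<kappa> :: real
  assumes l: "0 < l"
    and d1: "\<And>t. t \<in> {0..l} \<Longrightarrow> (\<gamma> has_vector_derivative \<gamma>' t) (at t within {0..l})"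
    and d2: "\<And>t. t \<in> {0..l} \<Longrightarrow> (\<gamma>' has_vector_derivative \<gamma>'' t) (at t within {0..l})"
    and c2: "continuous_on {0..l} \<gamma>''"
    and unit: "\<And>t. t \<in> {0..l} \<Longrightarrow> norm (\<gamma>' t) = 1"
    and kappa: "0 < \<kappa>"
    and curv: "\<And>t. t \<in> {0..l} \<Longrightarrow> \<kappa> < norm (\<gamma>'' t)" "\<And>t. t \<in> {0..l} \<Longrightarrow> norm (\<gamma>'' t) < 2 * \<kappa>"
    and turn: "2 * \<kappa> * l < 1"
begin

lemma mid: "l / 2 \<in> {0..l}" using l by simp

lemma continuous_on_arc: "continuous_on {0..l} \<gamma>"
  using d1 by (intro continuous_on_vector_derivative) auto

lemma arc_lipschitz: "s \<in> {0..l} \<Longrightarrow> t \<in> {0..l} \<Longrightarrow> norm (\<gamma> t - \<gamma> s) \<le> \<bar>t - s\<bar>"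
  using vector_mean_value_bound[of 0 l \<gamma> \<gamma>' 1 s t] d1 unit by simp

text \<open>Curvature below 2 \<kappa> over length l turns the tangent by less than 1 in all.
  Measured from the midpoint the bound halves, so fixed thresholds above 1/2 at the midpoint survive
  along the whole arc.\<close>

lemma tangent_near_mid:
  assumes t: "t \<in> {0..l}"
  shows "norm (\<gamma>' t - \<gamma>' (l / 2)) \<le> \<kappa> * l" "norm (\<gamma>' t - \<gamma>' (l / 2)) \<le> 1 / 2"
proof -
  have "norm (\<gamma>' t - \<gamma>' (l / 2)) \<le> 2 * \<kappa> * \<bar>t - l / 2\<bar>"
    by (rule vector_mean_value_bound[OF d2 _ mid t]) (use curv in \<open>auto intro: less_imp_le\<close>)
  also have "\<dots> \<le> 2 * \<kappa> * (l / 2)"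
  proof (rule mult_left_mono)
    show "\<bar>t - l / 2\<bar> \<le> l / 2" using t unfolding atLeastAtMost_iff by linarith
  qed (use kappa in simp)
  finally show "norm (\<gamma>' t - \<gamma>' (l / 2)) \<le> \<kappa> * l" by simp
  then show "norm (\<gamma>' t - \<gamma>' (l / 2)) \<le> 1 / 2" using turn by simp
qed

lemma curvature_orthogonal:
  assumes t: "t \<in> {0..l}"
  shows "\<gamma>'' t \<bullet> \<gamma>' t = 0"
proof -
  have "((\<lambda>t. \<gamma>' t \<bullet> \<gamma>' t) has_vector_derivative (\<gamma>' t \<bullet> \<gamma>'' t + \<gamma>'' t \<bullet> \<gamma>' t)) (at t within {0..l})"
    by (rule bounded_bilinear.has_vector_derivative[OF bounded_bilinear_inner d2[OF t] d2[OF t]])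
  moreover have "((\<lambda>t. \<gamma>' t \<bullet> \<gamma>' t) has_vector_derivative 0) (at t within {0..l})"
  proof (rule has_vector_derivative_transform[OF t])
    show "((\<lambda>_. 1::real) has_vector_derivative 0) (at t within {0..l})" by simp
    show "\<And>s. s \<in> {0..l} \<Longrightarrow> \<gamma>' s \<bullet> \<gamma>' s = 1"
      using unit by (simp add: power2_norm_eq_inner[symmetric])
  qed
  ultimately have "\<gamma>' t \<bullet> \<gamma>'' t + \<gamma>'' t \<bullet> \<gamma>' t = 0"
    using vector_derivative_unique_within_closed_interval[of 0 l t] l t by (metis cbox_interval)
  then show ?thesis by (simp add: inner_commute)
qed

text \<open>At the midpoint \<eta> is largely normal or largely tangential to the arc. In the first
  case curvature keeps the second derivative of the phase large, in the second the first derivative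
  is large throughout.\<close>

lemma arc_exponential_integral:
  assumes W: "1 \<le> W" "W \<le> \<kappa> * l\<^sup>2 * norm \<eta>"
  shows "norm (integral {0..l} (\<lambda>t. ee (\<eta> \<bullet> \<gamma> t))) \<le> 20 * l / sqrt W"
proof -
  define f where "f t = 2 * pi * (\<eta> \<bullet> \<gamma> t)" for t
  define f' where "f' t = 2 * pi * (\<eta> \<bullet> \<gamma>' t)" for t
  define f'' where "f'' t = 2 * pi * (\<eta> \<bullet> \<gamma>'' t)" for t
  have fd: "(f has_vector_derivative f' t) (at t within {0..l})" if "t \<in> {0..l}" for t
    unfolding f_def f'_def
    by (intro has_vector_derivative_mult_right bounded_linear.has_vector_derivative[OF bounded_linear_inner_right] d1 that)
  have fd': "(f' has_vector_derivative f'' t) (at t within {0..l})" if "t \<in> {0..l}" for t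
    unfolding f'_def f''_def
    by (intro has_vector_derivative_mult_right bounded_linear.has_vector_derivative[OF bounded_linear_inner_right] d2 that)
  have fc: "continuous_on {0..l} f''" unfolding f''_def by (intro continuous_intros c2)
  interpret phase_function f f' f'' 0 l by unfold_locales (use l fd fd' fc in auto)
  have int: "integral {0..l} (\<lambda>t. ee (\<eta> \<bullet> \<gamma> t)) = integral {0..l} (\<lambda>t. exp (\<i> * of_real (f t)))"
    unfolding f_def ee_eq ..
  have \<eta>: "norm \<eta> > 0" using W kappa l by (cases "\<eta> = 0") auto
  have sW: "sqrt W > 0" "sqrt W \<le> W"
  proof -
    show "sqrt W > 0" using W by simp
    have "sqrt W * 1 \<le> sqrt W * sqrt W" using W by (intro mult_left_mono) auto
    then show "sqrt W \<le> W" using W by simp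
  qed
  have pi3: "pi > 3" "pi < 3.5" using pi_approx by auto
  show ?thesis
  \<comment> \<open>The thresholds 0.6 and 0.8 have squares adding to 1, so one of them is reached.
    Both exceed the tangent variation 1/2, which leaves 0.1 and 0.3 of the norm along the whole
    arc.\<close>
  proof (cases "\<bar>\<eta> \<bullet> rot (\<gamma>' (l / 2))\<bar> \<ge> 0.6 * norm \<eta>")
    case True
    have low: "\<bar>f'' t\<bar> \<ge> \<kappa> * norm \<eta> / 4" if t: "t \<in> {0..l}" for t
    proof -
      have "\<bar>\<eta> \<bullet> rot (\<gamma>' t) - \<eta> \<bullet> rot (\<gamma>' (l / 2))\<bar> = \<bar>\<eta> \<bullet> rot (\<gamma>' t - \<gamma>' (l / 2))\<bar>"
        by (simp add: rot_diff inner_diff_right)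
      also have "\<dots> \<le> norm \<eta> * norm (\<gamma>' t - \<gamma>' (l / 2))"
        using Cauchy_Schwarz_ineq2[of \<eta> "rot (\<gamma>' t - \<gamma>' (l / 2))"] by simp
      also have "\<dots> \<le> norm \<eta> * (1 / 2)" using tangent_near_mid(2)[OF t] by (intro mult_left_mono) auto
      finally have "\<bar>\<eta> \<bullet> rot (\<gamma>' t)\<bar> \<ge> 0.1 * norm \<eta>" using True by linarith
      moreover have "\<bar>f'' t\<bar> = 2 * pi * (norm (\<gamma>'' t) * \<bar>\<eta> \<bullet> rot (\<gamma>' t)\<bar>)"
        unfolding f''_def abs_mult abs_inner_orthogonal[OF unit[OF t] curvature_orthogonal[OF t]] by simp
      moreover have "\<kappa> * (0.1 * norm \<eta>) \<le> norm (\<gamma>'' t) * (0.1 * norm \<eta>)"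
        using curv(1)[OF t] by (intro mult_right_mono) auto
      moreover have "norm (\<gamma>'' t) * (0.1 * norm \<eta>) \<le> norm (\<gamma>'' t) * \<bar>\<eta> \<bullet> rot (\<gamma>' t)\<bar>"
        using calculation(1) by (intro mult_left_mono) auto
      ultimately have "\<bar>f'' t\<bar> \<ge> 2 * pi * (\<kappa> * (0.1 * norm \<eta>))" by simp
      also have "2 * pi * (\<kappa> * (0.1 * norm \<eta>)) \<ge> 2.5 * (\<kappa> * (0.1 * norm \<eta>))"
        using pi3 kappa by (intro mult_right_mono) auto
      finally show ?thesis by simp
    qed
    have "norm (integral {0..l} (\<lambda>t. exp (\<i> * of_real (f t)))) \<le> 10 / sqrt (\<kappa> * norm \<eta> / 4)"
      by (rule oscillatory_stationary[OF _ low]) (use kappa \<eta> in auto)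
    also have "\<dots> = 20 * l / sqrt (\<kappa> * l\<^sup>2 * norm \<eta>)"
    proof -
      have "sqrt (\<kappa> * l\<^sup>2 * norm \<eta>) = l * sqrt (\<kappa> * norm \<eta>)" using l by (simp add: real_sqrt_mult)
      moreover have "sqrt (\<kappa> * norm \<eta> / 4) = sqrt (\<kappa> * norm \<eta>) / 2" by (simp add: real_sqrt_divide)
      ultimately show ?thesis using l by (simp only:) simp
    qed
    also have "\<dots> \<le> 20 * l / sqrt W" using W sW l by (intro divide_left_mono mult_pos_pos) auto
    finally show ?thesis unfolding int .
  next
    case False
    have "(0.6 * norm \<eta>)\<^sup>2 \<ge> (\<eta> \<bullet> rot (\<gamma>' (l / 2)))\<^sup>2" using False by (simp add: abs_le_square_iff[symmetric])
    then have "(\<eta> \<bullet> \<gamma>' (l / 2))\<^sup>2 \<ge> (0.8 * norm \<eta>)\<^sup>2"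
      using inner_sq_plus_inner_rot_sq[OF unit[OF mid], of \<eta>] by (simp add: power2_eq_square)
    then have mid_low: "\<bar>\<eta> \<bullet> \<gamma>' (l / 2)\<bar> \<ge> 0.8 * norm \<eta>"
      using abs_le_square_iff[of "0.8 * norm \<eta>" "\<eta> \<bullet> \<gamma>' (l / 2)"] by simp
    have low: "\<bar>f' t\<bar> \<ge> norm \<eta>" if t: "t \<in> {0..l}" for t
    proof -
      have "\<bar>\<eta> \<bullet> \<gamma>' t - \<eta> \<bullet> \<gamma>' (l / 2)\<bar> = \<bar>\<eta> \<bullet> (\<gamma>' t - \<gamma>' (l / 2))\<bar>"
        by (simp add: inner_diff_right)
      also have "\<dots> \<le> norm \<eta> * norm (\<gamma>' t - \<gamma>' (l / 2))" by (rule Cauchy_Schwarz_ineq2)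
      also have "\<dots> \<le> norm \<eta> * (1 / 2)" using tangent_near_mid(2)[OF t] by (intro mult_left_mono) auto
      finally have "\<bar>\<eta> \<bullet> \<gamma>' t\<bar> \<ge> 0.3 * norm \<eta>" using mid_low by linarith
      then have "2 * pi * \<bar>\<eta> \<bullet> \<gamma>' t\<bar> \<ge> 6 * (0.3 * norm \<eta>)" using pi3 by (intro mult_mono) auto
      moreover have "\<bar>f' t\<bar> = 2 * pi * \<bar>\<eta> \<bullet> \<gamma>' t\<bar>" by (simp add: f'_def abs_mult)
      ultimately show ?thesis using \<eta> by linarith
    qed
    have up: "\<bar>f'' t\<bar> \<le> 14 * \<kappa> * norm \<eta>" if t: "t \<in> {0..l}" for t
    proof -
      have "\<bar>\<eta> \<bullet> \<gamma>'' t\<bar> \<le> norm \<eta> * norm (\<gamma>'' t)" by (rule Cauchy_Schwarz_ineq2)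
      also have "\<dots> \<le> norm \<eta> * (2 * \<kappa>)" using curv(2)[OF t] by (intro mult_left_mono) auto
      finally have "2 * pi * \<bar>\<eta> \<bullet> \<gamma>'' t\<bar> \<le> 7 * (norm \<eta> * (2 * \<kappa>))" using pi3 by (intro mult_mono) auto
      then show ?thesis by (simp add: f''_def abs_mult mult_ac)
    qed
    have "norm (integral {0..l} (\<lambda>t. exp (\<i> * of_real (f t)))) \<le> 2 / norm \<eta> + (l - 0) * (14 * \<kappa> * norm \<eta>) / (norm \<eta>)\<^sup>2"
      by (rule oscillatory_nonstationary[OF \<eta> low up])
    also have "\<dots> = (2 + 7 * (2 * \<kappa> * l)) / norm \<eta>" using \<eta> by (simp add: power2_eq_square field_simps)
    also have "\<dots> \<le> 9 / norm \<eta>" using turn \<eta> by (intro divide_right_mono) auto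
    also have "\<dots> \<le> 20 * l / sqrt W"
    proof -
      \<comment> \<open>\<open>turn\<close> gives \<kappa> l < 1/2, which trades the hypothesis on W
        for a bound by l times the norm of \<eta>.\<close>
      have "sqrt W \<le> \<kappa> * l * (l * norm \<eta>)" using W sW by (simp add: power2_eq_square mult_ac)
      also have "\<dots> \<le> (1 / 2) * (l * norm \<eta>)" using turn l \<eta> by (intro mult_right_mono) auto
      finally have "9 * sqrt W \<le> 20 * (l * norm \<eta>)" using mult_pos_pos[OF l \<eta>] by linarith
      then show ?thesis using sW(1) \<eta> by (simp add: field_simps)
    qed
    finally show ?thesis unfolding int .
  qed
qed

text \<open>The supporting lines are taken parallel to the tangent at the midpoint: the height above
  it changes at rate at most \<kappa> l. Through this inequality a lower bound on the width feeds
  the oscillation estimate.\<close>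

lemma arc_width_le: "planar_width (\<gamma> ` {0..l}) \<le> \<kappa> * l\<^sup>2"
proof -
  define u where "u = rot (\<gamma>' (l / 2))"
  have u: "norm u = 1" using unit[OF mid] by (simp add: u_def)
  define h where "h t = u \<bullet> \<gamma> t" for t
  have hd: "(h has_vector_derivative (u \<bullet> \<gamma>' t)) (at t within {0..l})" if "t \<in> {0..l}" for t
    unfolding h_def by (intro bounded_linear.has_vector_derivative[OF bounded_linear_inner_right] d1 that)
  have hd_le: "norm (u \<bullet> \<gamma>' t) \<le> \<kappa> * l" if t: "t \<in> {0..l}" for t
  proof -
    have "u \<bullet> \<gamma>' t = u \<bullet> (\<gamma>' t - \<gamma>' (l / 2))" by (simp add: inner_diff_right u_def)
    also have "norm \<dots> \<le> norm u * norm (\<gamma>' t - \<gamma>' (l / 2))" using Cauchy_Schwarz_ineq2 by auto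
    also have "\<dots> \<le> \<kappa> * l" using u tangent_near_mid(1)[OF t] by simp
    finally show ?thesis .
  qed
  have hc: "continuous_on {0..l} h" unfolding h_def by (intro continuous_intros continuous_on_arc)
  have ne: "{0..l} \<noteq> {}" using l by auto
  obtain s where s: "s \<in> {0..l}" "\<And>t. t \<in> {0..l} \<Longrightarrow> h s \<le> h t"
    using continuous_attains_inf[OF _ ne hc] by auto
  obtain t where t: "t \<in> {0..l}" "\<And>r. r \<in> {0..l} \<Longrightarrow> h r \<le> h t"
    using continuous_attains_sup[OF _ ne hc] by auto
  have "planar_width (\<gamma> ` {0..l}) \<le> h t - h s"
    unfolding planar_width_def
  proof (rule cInf_lower)
    show "h t - h s \<in> {b - a |(u :: real^2) a b. norm u = 1 \<and> (\<forall>x\<in>\<gamma> ` {0..l}. a \<le> u \<bullet> x \<and> u \<bullet> x \<le> b) \<and>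
        (\<exists>x\<in>\<gamma> ` {0..l}. u \<bullet> x = a) \<and> (\<exists>x\<in>\<gamma> ` {0..l}. u \<bullet> x = b)}"
      using u s t unfolding h_def by blast
    show "bdd_below {b - a |(u :: real^2) a b. norm u = 1 \<and> (\<forall>x\<in>\<gamma> ` {0..l}. a \<le> u \<bullet> x \<and> u \<bullet> x \<le> b) \<and>
        (\<exists>x\<in>\<gamma> ` {0..l}. u \<bullet> x = a) \<and> (\<exists>x\<in>\<gamma> ` {0..l}. u \<bullet> x = b)}"
      by (rule bdd_belowI[of _ 0]) force
  qed
  also have "\<dots> \<le> norm (h t - h s)" by simp
  also have "\<dots> \<le> \<kappa> * l * \<bar>t - s\<bar>"
    by (rule vector_mean_value_bound[OF hd hd_le s(1) t(1)])
  also have "\<dots> \<le> \<kappa> * l * l" using s t kappa l by (intro mult_left_mono) auto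
  finally show ?thesis by (simp add: power2_eq_square)
qed

text \<open>Some coordinate of the unit tangent at the midpoint is at least 0.7 in modulus, since
  0.49 < 1/2, hence at least 0.2 along the arc; the mean value theorem then gives the factor
  5.\<close>

lemma arc_projection_length: "\<exists>d. l \<le> 5 * \<bar>\<gamma> l $ d - \<gamma> 0 $ d\<bar>"
proof -
  have "(\<gamma>' (l / 2) $ 1)\<^sup>2 + (\<gamma>' (l / 2) $ 2)\<^sup>2 = 1" using norm_real2_sq[of "\<gamma>' (l / 2)"] unit[OF mid] by simp
  then have "(\<gamma>' (l / 2) $ 1)\<^sup>2 \<ge> 0.7\<^sup>2 \<or> (\<gamma>' (l / 2) $ 2)\<^sup>2 \<ge> 0.7\<^sup>2" by (simp add: power2_eq_square) linarith
  then obtain d where "(\<gamma>' (l / 2) $ d)\<^sup>2 \<ge> 0.7\<^sup>2" by auto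
  then have d: "\<bar>\<gamma>' (l / 2) $ d\<bar> \<ge> 0.7" using abs_le_square_iff[of "0.7" "\<gamma>' (l / 2) $ d"] by simp
  have low: "\<bar>\<gamma>' t $ d\<bar> \<ge> 0.2" if t: "t \<in> {0..l}" for t
    using component_le_norm_cart[of "\<gamma>' t - \<gamma>' (l / 2)" d] tangent_near_mid(2)[OF t] d by simp
  have "((\<lambda>t. \<gamma> t $ d) has_derivative (\<lambda>h. h * (\<gamma>' t $ d))) (at t within {0..l})" if "0 \<le> t" "t \<le> l" for t
    using bounded_linear.has_vector_derivative[OF bounded_linear_vec_nth d1, of t d] that
    by (simp add: has_vector_derivative_def)
  then obtain t where t: "t \<in> {0..l}" "\<gamma> l $ d - \<gamma> 0 $ d = (l - 0) * (\<gamma>' t $ d)"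
    using mvt_very_simple[of 0 l "\<lambda>t. \<gamma> t $ d" "\<lambda>t h. h * (\<gamma>' t $ d)"] l by auto
  have "l * 0.2 \<le> l * \<bar>\<gamma>' t $ d\<bar>" using low[OF t(1)] l by (intro mult_left_mono) auto
  also have "\<dots> = \<bar>\<gamma> l $ d - \<gamma> 0 $ d\<bar>" using t(2) l by (simp add: abs_mult)
  finally show ?thesis by (intro exI[of _ d]) simp
qed

end

lemma regular_planar_arc_curved_arc:
  assumes "regular_planar_arc K"
  obtains \<gamma> \<gamma>' \<gamma>'' l \<kappa> where "curved_arc \<gamma> \<gamma>' \<gamma>'' l \<kappa>" "l < 1" "K = \<gamma> ` {0..l}" "inj_on \<gamma> {0..l}"
  using assms unfolding regular_planar_arc_def curved_arc_def by metis

section \<open>Sign changes on small squares\<close>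

lemma ee_0 [simp]: "ee 0 = 1" by (simp add: ee_def)

lemma ee_add: "ee (x + y) = ee x * ee y"
  by (simp add: ee_eq exp_add[symmetric] algebra_simps)

lemma continuous_on_ee [continuous_intros]: "continuous_on A f \<Longrightarrow> continuous_on A (\<lambda>x. ee (f x))"
  unfolding ee_def by (intro continuous_intros)

text \<open>The integrand is the derivative of the explicit \<open>G\<close>. The factor c^2 - p^2
  stays on the integral side, so that the identity includes the resonance p^2 = c^2.\<close>

lemma sine_transform:
  fixes s x :: real
  assumes s: "s > 0"
  defines "c \<equiv> pi / s"
  defines "p \<equiv> 2 * pi * x"
  shows "((\<lambda>t. of_real (c\<^sup>2 - p\<^sup>2) * (of_real (sin (c * t)) * ee (t * x))) has_integral
           of_real c * (1 + ee (s * x))) {0..s}"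
proof -
  define G where "G t = ee (t * x) * (\<i> * of_real p * of_real (sin (c * t)) - of_real c * of_real (cos (c * t)))" for t
  have e: "ee (t * x) = exp (\<i> * of_real p * of_real t)" for t
    by (simp add: ee_def p_def mult_ac)
  have "(G has_vector_derivative (of_real (c\<^sup>2 - p\<^sup>2) * (of_real (sin (c * t)) * ee (t * x)))) (at t within {0..s})" for t
  proof -
    let ?D = "\<i> * of_real p * exp (\<i> * of_real p * of_real t) * (\<i> * of_real p * sin (of_real c * of_real t) - of_real c * cos (of_real c * of_real t))
         + exp (\<i> * of_real p * of_real t) * (\<i> * of_real p * (of_real c * cos (of_real c * of_real t)) + of_real c * (of_real c * sin (of_real c * of_real t)))"
    have "((\<lambda>z. exp (\<i> * of_real p * z) * (\<i> * of_real p * sin (of_real c * z) - of_real c * cos (of_real c * z)))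
        has_field_derivative
        ?D)
        (at (of_real t))"
      by (auto intro!: derivative_eq_intros simp: algebra_simps)
    from has_vector_derivative_real_field[OF this, of "{0..s}"]
    have "(G has_vector_derivative
        ?D)
        (at t within {0..s})"
      unfolding G_def e by (simp add: sin_of_real[symmetric] cos_of_real[symmetric])
    moreover have "?D
       = of_real (c\<^sup>2 - p\<^sup>2) * (of_real (sin (c * t)) * ee (t * x))"
      unfolding e by (simp add: sin_of_real[symmetric] algebra_simps power2_eq_square)
    ultimately show ?thesis by simp
  qed
  then have "((\<lambda>t. of_real (c\<^sup>2 - p\<^sup>2) * (of_real (sin (c * t)) * ee (t * x))) has_integral (G s - G 0)) {0..s}"
    using s by (intro fundamental_theorem_of_calculus) auto
  moreover have "G s - G 0 = of_real c * (1 + ee (s * x))"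
    using s by (simp add: G_def c_def algebra_simps)
  ultimately show ?thesis by simp
qed

text \<open>At resonance s x = 1/2 or -1/2, so the factor contributed by a pair of opposite sides
  vanishes.\<close>

lemma ee_half_odd:
  assumes "s > 0" "(pi / s)\<^sup>2 = (2 * pi * x)\<^sup>2"
  shows "1 + ee (s * x) = 0"
proof -
  have "pi / s = 2 * pi * x \<or> pi / s = - (2 * pi * x)" using assms(2) by (simp only: power2_eq_iff)
  then have "pi = pi * (2 * s * x) \<or> pi = pi * (- (2 * s * x))" using assms(1) by (auto simp: field_simps)
  then have "s * x = 1/2 \<or> s * x = - 1/2" by (simp only: mult_cancel_left1) (simp; linarith?)
  moreover have "ee (1/2) = -1" by (simp add: ee_eq cis_conv_exp[symmetric])
  moreover have "ee (- 1/2) = -1" by (simp add: ee_eq exp_minus)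
  ultimately show ?thesis by (metis add.right_inverse)
qed

text \<open>The sine weights are the boundary normal derivatives of the first Dirichlet eigenfunction of
  a square of side \<open>s\<close>, whose eigenvalue \<open>2 (\<pi> / s)\<^sup>2\<close> equals that of the plane wave; Green's formula.\<close>

lemma plane_wave_weighted_boundary:
  fixes s x y :: real
  assumes s: "s > 0" and e: "2 * s\<^sup>2 * (x\<^sup>2 + y\<^sup>2) = 1"
  shows "((\<lambda>t. of_real (sin (pi / s * t)) * (ee (t * x) * (1 + ee (s * y)) + ee (t * y) * (1 + ee (s * x)))) has_integral 0) {0..s}"
proof -
  define c where "c = pi / s"
  define A B where "A = 1 + ee (s * x)" and "B = 1 + ee (s * y)"
  define k where "k = c\<^sup>2 - (2 * pi * x)\<^sup>2"
  have "x\<^sup>2 + y\<^sup>2 = 1 / (2 * s\<^sup>2)" using s e by (simp add: field_simps)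
  then have "4 * pi\<^sup>2 * (x\<^sup>2 + y\<^sup>2) = 2 * c\<^sup>2" using s by (simp add: c_def power_divide)
  \<comment> \<open>The relation between s and the frequency makes the defects of the two
    coordinates opposite. The two transforms then contribute A B c / k and -A B c / k, which
    cancel.\<close>
  then have k': "c\<^sup>2 - (2 * pi * y)\<^sup>2 = - k" by (simp add: k_def power_mult_distrib algebra_simps)
  have "((\<lambda>t. of_real (sin (c * t)) * (ee (t * x) * B + ee (t * y) * A)) has_integral 0) {0..s}"
  proof (cases "k = 0")
    case True
    then have "A = 0" "B = 0" using ee_half_odd[OF s] k' unfolding k_def A_def B_def c_def by simp_all
    then show ?thesis by simp
  next
    case False
    have "((\<lambda>t. of_real (1 / k) * B * (of_real k * (of_real (sin (c * t)) * ee (t * x)))) has_integral of_real (1 / k) * B * (of_real c * A)) {0..s}"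
      using sine_transform[OF s, of x] unfolding c_def[symmetric] k_def[symmetric] A_def[symmetric] by (rule has_integral_mult_right)
    moreover have "((\<lambda>t. of_real (- 1 / k) * A * (of_real (- k) * (of_real (sin (c * t)) * ee (t * y)))) has_integral of_real (- 1 / k) * A * (of_real c * B)) {0..s}"
      using sine_transform[OF s, of y] unfolding c_def[symmetric] k' B_def[symmetric] by (rule has_integral_mult_right)
    ultimately have "((\<lambda>t. of_real (1 / k) * B * (of_real k * (of_real (sin (c * t)) * ee (t * x))) +
        of_real (- 1 / k) * A * (of_real (- k) * (of_real (sin (c * t)) * ee (t * y)))) has_integral
        (of_real (1 / k) * B * (of_real c * A) + of_real (- 1 / k) * A * (of_real c * B))) {0..s}"
      by (rule has_integral_add)
    then show ?thesis
      by (rule has_integral_eq_rhs[OF has_integral_eq[rotated]]) (use False in \<open>simp_all add: algebra_simps\<close>)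
  qed
  then show ?thesis unfolding c_def A_def B_def .
qed

lemma continuous_nonzero_same_sign:
  fixes h :: "real \<Rightarrow> real"
  assumes "continuous_on {a..b} h" "\<And>t. t \<in> {a..b} \<Longrightarrow> h t \<noteq> 0" and st: "s \<in> {a..b}" "t \<in> {a..b}"
  shows "sgn (h s) = sgn (h t)"
proof -
  have "is_interval (h ` {a..b})"
    using connected_continuous_image[OF assms(1)] by (simp add: is_interval_connected_1)
  moreover have "0 \<notin> h ` {a..b}" using assms(2) by force
  ultimately have "\<not> (h s \<le> 0 \<and> 0 \<le> h t)" "\<not> (h t \<le> 0 \<and> 0 \<le> h s)"
    using st unfolding is_interval_1 by blast+
  then show ?thesis by (auto simp: sgn_if)
qed

definition pt :: "real \<Rightarrow> real \<Rightarrow> real^2" where "pt x y = vector [x, y]"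

lemma pt_simps [simp]: "pt x y $ 1 = x" "pt x y $ 2 = y"
  by (simp_all add: pt_def)

lemma pt_inner [simp]: "pt x y \<bullet> \<xi> = x * \<xi> $ 1 + y * \<xi> $ 2"
  by (simp add: inner_real2)

text \<open>Without a zero, one sign prevails on the whole boundary. Summing the identity for plane
  waves over the frequencies shows, however, that a boundary integral with positive sine weights
  vanishes.\<close>

lemma zero_on_square_boundary:
  fixes \<Phi> :: "real^2 \<Rightarrow> real" and S :: "(real^2) set"
  assumes fin: "finite S" and rep: "\<And>z. of_real (\<Phi> z) = trig_sum a S z"
    and E: "\<And>\<xi>. \<xi> \<in> S \<Longrightarrow> (norm \<xi>)\<^sup>2 = E" and s: "s > 0" "2 * s\<^sup>2 * E = 1"
  shows "\<exists>t\<in>{0..s}. \<Phi> (pt (x + t) y) = 0 \<or> \<Phi> (pt (x + t) (y + s)) = 0 \<or>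
    \<Phi> (pt x (y + t)) = 0 \<or> \<Phi> (pt (x + s) (y + t)) = 0"
proof (rule ccontr)
  assume neg: "\<not> ?thesis"
  define h1 h2 h3 h4 where "h1 t = \<Phi> (pt (x + t) y)" and "h2 t = \<Phi> (pt (x + t) (y + s))"
    and "h3 t = \<Phi> (pt x (y + t))" and "h4 t = \<Phi> (pt (x + s) (y + t))" for t
  have Re: "\<Phi> z = Re (trig_sum a S z)" for z using rep[of z] by (metis Re_complex_of_real)
  have cont: "continuous_on {0..s} h1" "continuous_on {0..s} h2" "continuous_on {0..s} h3" "continuous_on {0..s} h4"
    unfolding h1_def h2_def h3_def h4_def Re by (auto intro!: continuous_intros)
  have nz: "h1 t \<noteq> 0" "h2 t \<noteq> 0" "h3 t \<noteq> 0" "h4 t \<noteq> 0" if "t \<in> {0..s}" for t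
    using neg that unfolding h1_def h2_def h3_def h4_def by auto
  have same1: "sgn (h1 u) = sgn (h1 t)" if "u \<in> {0..s}" "t \<in> {0..s}" for u t
    using continuous_nonzero_same_sign[OF cont(1) _ that] nz(1) by blast
  have same2: "sgn (h2 u) = sgn (h2 t)" if "u \<in> {0..s}" "t \<in> {0..s}" for u t
    using continuous_nonzero_same_sign[OF cont(2) _ that] nz(2) by blast
  have same3: "sgn (h3 u) = sgn (h3 t)" if "u \<in> {0..s}" "t \<in> {0..s}" for u t
    using continuous_nonzero_same_sign[OF cont(3) _ that] nz(3) by blast
  have same4: "sgn (h4 u) = sgn (h4 t)" if "u \<in> {0..s}" "t \<in> {0..s}" for u t
    using continuous_nonzero_same_sign[OF cont(4) _ that] nz(4) by blast
  \<comment> \<open>Adjacent sides share a corner, so the sign at one corner spreads to all four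
    sides.\<close>
  define \<sigma> where "\<sigma> = sgn (h1 0)"
  have 0: "0 \<in> {0..s}" and ss: "s \<in> {0..s}" using s by auto
  have sg1: "sgn (h1 t) = \<sigma>" if "t \<in> {0..s}" for t using same1[OF that 0] by (simp add: \<sigma>_def)
  have sg3: "sgn (h3 t) = \<sigma>" if "t \<in> {0..s}" for t
    using same3[OF that 0] by (simp add: \<sigma>_def h1_def h3_def)
  have sg4: "sgn (h4 t) = \<sigma>" if "t \<in> {0..s}" for t
    using same4[OF that 0] sg1[OF ss] by (simp add: h1_def h4_def)
  have sg2: "sgn (h2 t) = \<sigma>" if "t \<in> {0..s}" for t
    using same2[OF that 0] sg3[OF ss] by (simp add: h2_def h3_def)
  define H where "H t = h1 t + h2 t + h3 t + h4 t" for t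
  have pos: "\<sigma> * H t > 0" if t: "t \<in> {0..s}" for t
    using nz[OF t] sg1[OF t] sg2[OF t] sg3[OF t] sg4[OF t]
    by (auto simp: H_def sgn_if split: if_splits)
  have "((\<lambda>t. of_real (sin (pi / s * t)) * complex_of_real (H t)) has_integral 0) {0..s}"
  proof -
    have "((\<lambda>t. \<Sum>\<xi>\<in>S. a \<xi> * ee (x * \<xi> $ 1 + y * \<xi> $ 2) *
       (of_real (sin (pi / s * t)) * (ee (t * \<xi> $ 1) * (1 + ee (s * \<xi> $ 2)) + ee (t * \<xi> $ 2) * (1 + ee (s * \<xi> $ 1)))))
       has_integral (\<Sum>\<xi>\<in>S. a \<xi> * ee (x * \<xi> $ 1 + y * \<xi> $ 2) * 0)) {0..s}"
    proof (intro has_integral_sum fin has_integral_mult_right plane_wave_weighted_boundary s(1))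
      fix \<xi> assume "\<xi> \<in> S"
      then show "2 * s\<^sup>2 * ((\<xi> $ 1)\<^sup>2 + (\<xi> $ 2)\<^sup>2) = 1" using E[of \<xi>] s(2) by (simp add: norm_real2_sq)
    qed
    moreover have "(\<Sum>\<xi>\<in>S. a \<xi> * ee (x * \<xi> $ 1 + y * \<xi> $ 2) *
       (of_real (sin (pi / s * t)) * (ee (t * \<xi> $ 1) * (1 + ee (s * \<xi> $ 2)) + ee (t * \<xi> $ 2) * (1 + ee (s * \<xi> $ 1)))))
      = of_real (sin (pi / s * t)) * complex_of_real (H t)" for t
      unfolding H_def h1_def h2_def h3_def h4_def of_real_add rep sum.distrib[symmetric] sum_distrib_left
      by (intro sum.cong refl) (simp add: ee_add algebra_simps)
    ultimately show ?thesis by simp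
  qed
  from has_integral_Re[OF this]
  have "((\<lambda>t. sin (pi / s * t) * H t) has_integral 0) {0..s}" by simp
  from has_integral_mult_right[OF this, of \<sigma>]
  have int: "((\<lambda>t. \<sigma> * (sin (pi / s * t) * H t)) has_integral 0) (cbox 0 s)" by simp
  \<comment> \<open>A continuous nonnegative function with integral zero vanishes everywhere; the
    midpoint is tested because the sine weight is 1 there.\<close>
  have "\<sigma> * (sin (pi / s * (s / 2)) * H (s / 2)) = 0"
  proof (rule has_integral_0_cbox_imp_0[OF _ _ int])
    show "continuous_on (cbox 0 s) (\<lambda>t. \<sigma> * (sin (pi / s * t) * H t))"
      unfolding H_def using cont s(1) by (auto intro!: continuous_intros)
    fix t assume t: "t \<in> box 0 s"
    then have "0 \<le> pi / s * t" "pi / s * t \<le> pi" using s by (auto simp: field_simps)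
    then have "sin (pi / s * t) \<ge> 0" by (rule sin_ge_zero)
    moreover have "0 \<le> \<sigma> * H t" using pos[of t] t by (simp add: less_imp_le)
    ultimately have "0 \<le> sin (pi / s * t) * (\<sigma> * H t)" by (rule mult_nonneg_nonneg)
    then show "0 \<le> \<sigma> * (sin (pi / s * t) * H t)" by (simp add: mult_ac)
  next
    show "box 0 s \<noteq> {}" using s(1) by simp
    show "s / 2 \<in> cbox 0 s" using s(1) by simp
  qed
  moreover have "pi / s * (s / 2) = pi / 2" using s(1) by simp
  ultimately show False using pos[of "s / 2"] s(1) by auto
qed

text \<open>The window contains every square of side s whose lower left corner (x, y) lies in its
  lower left quarter. If x and x + s avoid the first projection while y and y + s avoid the second,
  that square has no zero on its boundary. So for some coordinate the projection and its translate
  by s cover an interval of length s.\<close>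

lemma window_projection_measure:
  fixes \<Phi> :: "real^2 \<Rightarrow> real" and S :: "(real^2) set" and c :: "real^2"
  assumes fin: "finite S" and rep: "\<And>z. of_real (\<Phi> z) = trig_sum a S z"
    and E: "\<And>\<xi>. \<xi> \<in> S \<Longrightarrow> (norm \<xi>)\<^sup>2 = E" and s: "s > 0" "2 * s\<^sup>2 * E = 1"
  defines "A \<equiv> {z. (\<forall>d. c $ d \<le> z $ d \<and> z $ d \<le> c $ d + 2 * s) \<and> \<Phi> z = 0}"
  shows "compact A" "\<exists>d. ennreal (s / 2) \<le> emeasure lborel ((\<lambda>z. z $ d) ` A)"
proof -
  have A: "A = cbox c (\<chi> d. c $ d + 2 * s) \<inter> \<Phi> -` {0}"
    by (auto simp: A_def mem_box_cart)
  have Re: "\<Phi> z = Re (trig_sum a S z)" for z using rep[of z] by (metis Re_complex_of_real)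
  have "continuous_on UNIV \<Phi>" unfolding Re by (intro continuous_intros)
  then have "closed (\<Phi> -` {0})" by (simp add: continuous_on_closed_vimage)
  then show cA: "compact A" unfolding A by (intro compact_Int_closed compact_cbox)
  define X where "X d = (\<lambda>z. z $ d) ` A" for d
  have Xm: "X d \<in> sets borel" for d
    unfolding X_def by (intro borel_compact compact_continuous_image cA continuous_intros)
  have half: "ennreal (s / 2) \<le> emeasure lborel (X d)"
    if "\<And>u. u \<in> {c $ d..c $ d + s} \<Longrightarrow> u \<in> X d \<or> u + s \<in> X d" for d
  proof -
    have trm: "(\<lambda>u. s + u) -` X d \<in> sets borel"
      using measurable_sets_borel[of "\<lambda>u. s + u" borel] Xm by simp
    have "ennreal s = emeasure lborel {c $ d..c $ d + s}" using s by simp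
    also have "\<dots> \<le> emeasure lborel (X d \<union> (\<lambda>u. s + u) -` X d)"
    proof (rule emeasure_mono)
      show "{c $ d..c $ d + s} \<subseteq> X d \<union> (\<lambda>u. s + u) -` X d"
      proof
        fix u assume "u \<in> {c $ d..c $ d + s}"
        from that[OF this] show "u \<in> X d \<union> (\<lambda>u. s + u) -` X d" by (simp add: add.commute)
      qed
      show "X d \<union> (\<lambda>u. s + u) -` X d \<in> sets lborel" using Xm trm by simp
    qed
    also have "\<dots> \<le> emeasure lborel (X d) + emeasure lborel ((\<lambda>u. s + u) -` X d)"
      using Xm trm by (intro emeasure_subadditive) auto
    also have "emeasure lborel ((\<lambda>u. s + u) -` X d) = emeasure (distr lborel borel ((+) s)) (X d)"
      using Xm by (subst emeasure_distr) auto
    also have "\<dots> = emeasure lborel (X d)" by (simp add: lborel_distr_plus)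
    finally have *: "ennreal s \<le> emeasure lborel (X d) + emeasure lborel (X d)" .
    show ?thesis
    proof (rule ccontr)
      assume "\<not> ?thesis"
      then have lt: "emeasure lborel (X d) < ennreal (s / 2)" by simp
      then have "emeasure lborel (X d) + emeasure lborel (X d) < ennreal (s / 2) + ennreal (s / 2)"
        by (intro add_strict_mono)
      also have "\<dots> = ennreal s" using s by (simp add: ennreal_plus[symmetric] del: ennreal_plus)
      finally show False using * by simp
    qed
  qed
  show "\<exists>d. ennreal (s / 2) \<le> emeasure lborel ((\<lambda>z. z $ d) ` A)"
  proof (rule ccontr)
    assume neg: "\<not> ?thesis"
    have "\<exists>u\<in>{c $ d..c $ d + s}. u \<notin> X d \<and> u + s \<notin> X d" for d
      using half[of d] neg unfolding X_def by blast
    then obtain x y where x: "x \<in> {c $ 1..c $ 1 + s}" "x \<notin> X 1" "x + s \<notin> X 1"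
      and y: "y \<in> {c $ 2..c $ 2 + s}" "y \<notin> X 2" "y + s \<notin> X 2" by metis
    have in1: "u \<in> X 1" if "c $ 1 \<le> u" "u \<le> c $ 1 + 2 * s" "c $ 2 \<le> v" "v \<le> c $ 2 + 2 * s" "\<Phi> (pt u v) = 0" for u v
      unfolding X_def A_def using that by (intro image_eqI[of _ _ "pt u v"]) (auto simp: forall_2)
    have in2: "v \<in> X 2" if "c $ 1 \<le> u" "u \<le> c $ 1 + 2 * s" "c $ 2 \<le> v" "v \<le> c $ 2 + 2 * s" "\<Phi> (pt u v) = 0" for u v
      unfolding X_def A_def using that by (intro image_eqI[of _ _ "pt u v"]) (auto simp: forall_2)
    obtain t where t: "t \<in> {0..s}" "\<Phi> (pt (x + t) y) = 0 \<or> \<Phi> (pt (x + t) (y + s)) = 0 \<or>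
      \<Phi> (pt x (y + t)) = 0 \<or> \<Phi> (pt (x + s) (y + t)) = 0"
      using zero_on_square_boundary[OF fin rep E s, of x y] by blast
    \<comment> \<open>A zero on a vertical side has first coordinate x or x + s, one on a horizontal
      side has second coordinate y or y + s.\<close>
    show False
      using t x y in1[of x "y + t"] in1[of "x + s" "y + t"] in2[of "x + t" y] in2[of "x + t" "y + s"] s(1) by auto
  qed
qed

section \<open>Zeros of trigonometric polynomials and the length of nodal arcs\<close>

lemma ee_of_int [simp]: "ee (of_int n) = 1"
proof -
  have "ee (of_int n) = exp (2 * of_real pi * \<i> * of_int n)" by (simp add: ee_def)
  then show ?thesis using exp_integer_2pi[of "of_int n"] by (simp add: mult_ac)
qed

lemma ee_eq_1_iff: "ee x = 1 \<longleftrightarrow> x \<in> \<int>"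
proof
  assume "ee x = 1"
  then obtain n where "2 * pi * x = of_int (2 * n) * pi" by (auto simp: ee_eq exp_eq_1)
  then have "x = of_int n" by simp
  then show "x \<in> \<int>" by simp
qed (auto elim: Ints_cases)

lemma ee_neq_0 [simp]: "ee x \<noteq> 0"
  by (simp add: ee_def)

lemma ee_minus: "ee (- x) = inverse (ee x)"
  by (simp add: ee_def exp_minus)

lemma ee_diff: "ee (x - y) = ee x / ee y"
  by (simp add: ee_def exp_diff algebra_simps)

lemma ee_power: "ee x ^ n = ee (of_nat n * x)"
  by (simp add: ee_def exp_of_nat_mult[symmetric] mult_ac)

lemma inj_on_ee: "inj_on ee {0..<1}"
proof (rule inj_onI)
  fix x y :: real assume xy: "x \<in> {0..<1}" "y \<in> {0..<1}" "ee x = ee y"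
  then have "ee (x - y) = 1" by (simp add: ee_diff)
  then obtain n where "x - y = of_int n" unfolding ee_eq_1_iff by (auto elim: Ints_cases)
  moreover from this have "n = 0" using xy by auto
  ultimately show "x = y" by simp
qed

lemma ee_lattice:
  assumes "v \<in> int_lattice" "\<xi> \<in> int_lattice"
  shows "ee (v \<bullet> \<xi>) = 1"
  using assms unfolding ee_eq_1_iff inner_real2 by (auto simp: int_lattice_def)

abbreviation trig_poly :: "nat \<Rightarrow> (int \<Rightarrow> complex) \<Rightarrow> real \<Rightarrow> complex" where
  "trig_poly N c x \<equiv> \<Sum>k\<in>{- int N..int N}. c k * ee (of_int k * x)"

text \<open>Multiplied by \<open>ee (N * x)\<close>, the sum becomes a nonzero polynomial of degree
  at most 2 N in \<open>ee x\<close>, and \<open>ee\<close> is injective on [0, 1).\<close>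

lemma trig_poly_zeros:
  fixes c :: "int \<Rightarrow> complex"
  assumes "k \<in> {- int N..int N}" "c k \<noteq> 0"
  defines "Z \<equiv> {x \<in> {0..<1}. trig_poly N c x = 0}"
  shows "finite Z" "card Z \<le> 2 * N"
proof -
  define p where "p = (\<Sum>j\<le>2 * N. monom (c (int j - int N)) j)"
  have co: "coeff p j = c (int j - int N)" if "j \<le> 2 * N" for j
    using that by (simp add: p_def coeff_sum sum.delta)
  have "coeff p (nat (k + int N)) = c k" using assms(1) by (subst co) auto
  then have p0: "p \<noteq> 0" using assms(2) by auto
  have deg: "degree p \<le> 2 * N"
    unfolding p_def by (intro degree_sum_le) (auto intro: order_trans[OF degree_monom_le])
  have "poly p (ee x) = ee (real N * x) * (trig_poly N c x)" for x
  proof -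
    have "poly p (ee x) = (\<Sum>j\<le>2 * N. c (int j - int N) * ee (of_nat j * x))"
      by (simp add: p_def poly_sum poly_monom ee_power)
    also have "\<dots> = (\<Sum>k\<in>{- int N..int N}. c k * ee (of_int (k + int N) * x))"
      by (rule sum.reindex_bij_witness[of _ "\<lambda>k. nat (k + int N)" "\<lambda>j. int j - int N"]) auto
    also have "\<dots> = ee (real N * x) * (trig_poly N c x)"
    proof -
      have "ee (of_int (k + int N) * x) = ee (real N * x) * ee (of_int k * x)" for k
        by (simp add: ee_add[symmetric] algebra_simps)
      then show ?thesis unfolding sum_distrib_left by (intro sum.cong refl) (simp add: mult_ac)
    qed
    finally show ?thesis .
  qed
  then have "ee ` Z \<subseteq> {z. poly p z = 0}" by (auto simp: Z_def)
  moreover have "inj_on ee Z" using inj_on_ee by (rule inj_on_subset) (auto simp: Z_def)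
  moreover have "finite {z. poly p z = 0}" "card {z. poly p z = 0} \<le> degree p"
    using p0 by (auto simp: poly_roots_finite card_poly_roots_bound)
  ultimately show "finite Z" "card Z \<le> 2 * N"
    using inj_on_finite card_inj_on_le deg by (blast, meson order_trans)
qed

lemma countable_trig_poly_zeros:
  fixes c :: "int \<Rightarrow> complex"
  assumes "k \<in> {- int N..int N}" "c k \<noteq> 0"
  shows "countable {x. trig_poly N c x = 0}"
proof -
  define Z where "Z = {x \<in> {0..<1}. trig_poly N c x = 0}"
  have "finite Z" unfolding Z_def by (rule trig_poly_zeros(1)[of k N c, OF assms])
  have "{x. trig_poly N c x = 0} \<subseteq> (\<Union>n::int. (\<lambda>x. x + of_int n) ` Z)"
  proof
    fix x assume "x \<in> {x. trig_poly N c x = 0}"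
    moreover have "ee (of_int k * frac x) = ee (of_int k * x)" for k
    proof -
      have "of_int k * frac x = of_int k * x - of_int (k * \<lfloor>x\<rfloor>)" by (simp add: frac_def algebra_simps)
      then show ?thesis by (simp only: ee_diff ee_of_int) simp
    qed
    ultimately have "frac x \<in> Z" by (simp add: Z_def frac_lt_1)
    moreover have "x = frac x + of_int \<lfloor>x\<rfloor>" by (simp add: frac_def)
    ultimately show "x \<in> (\<Union>n::int. (\<lambda>x. x + of_int n) ` Z)" by blast
  qed
  moreover have "countable (\<Union>n::int. (\<lambda>x. x + of_int n) ` Z)" using \<open>finite Z\<close> by (simp add: countable_finite)
  ultimately show ?thesis by (rule countable_subset)
qed

text \<open>On a line the sum is a trigonometric polynomial in y whose coefficients are
  trigonometric polynomials in x. The coefficient belonging to the d'-coordinate of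
  \<open>\<xi>\<^sub>0\<close> is not identically zero, so it vanishes for countably many x only;
  for all others the degree bounds the number of zeros.\<close>

lemma exponential_sum_line_zeros:
  fixes a :: "real^2 \<Rightarrow> complex" and d d' :: 2
  assumes fin: "finite S" and lat: "S \<subseteq> int_lattice" and N: "\<And>\<xi> i. \<xi> \<in> S \<Longrightarrow> \<bar>\<xi> $ i\<bar> \<le> real N"
    and dd: "d \<noteq> d'" and \<xi>0: "\<xi>\<^sub>0 \<in> S" "a \<xi>\<^sub>0 \<noteq> 0"
  defines "Z \<equiv> \<lambda>x. {y \<in> {0..<1}. (\<Sum>\<xi>\<in>S. a \<xi> * ee (x * \<xi> $ d + y * \<xi> $ d')) = 0}"
  shows "countable {x. \<not> (finite (Z x) \<and> card (Z x) \<le> 2 * N)}"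
proof -
  have dcases: "i = d \<or> i = d'" for i using dd exhaust_2[of d] exhaust_2[of d'] exhaust_2[of i] by auto
  have fl: "of_int \<lfloor>\<xi> $ i\<rfloor> = \<xi> $ i" if "\<xi> \<in> S" for \<xi> i
  proof -
    have "\<xi> $ i \<in> \<int>" using lat that by (auto simp: int_lattice_def)
    then show ?thesis by (elim Ints_cases) simp
  qed
  have fN: "\<lfloor>\<xi> $ i\<rfloor> \<in> {- int N..int N}" if "\<xi> \<in> S" for \<xi> i
  proof -
    have "\<bar>real_of_int \<lfloor>\<xi> $ i\<rfloor>\<bar> \<le> real N" unfolding fl[OF that] by (rule N[OF that])
    then show ?thesis by auto
  qed
  define b where "b k x = (\<Sum>\<xi>\<in>{\<xi> \<in> S. \<lfloor>\<xi> $ d'\<rfloor> = k}. a \<xi> * ee (x * \<xi> $ d))" for k x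
  have sum_b: "(\<Sum>\<xi>\<in>S. a \<xi> * ee (x * \<xi> $ d + y * \<xi> $ d')) = trig_poly N (\<lambda>k. b k x) y" for x y
  proof -
    have "(\<Sum>\<xi>\<in>S. a \<xi> * ee (x * \<xi> $ d + y * \<xi> $ d')) =
        (\<Sum>k\<in>{- int N..int N}. \<Sum>\<xi>\<in>{\<xi> \<in> S. \<lfloor>\<xi> $ d'\<rfloor> = k}. a \<xi> * ee (x * \<xi> $ d + y * \<xi> $ d'))"
      by (rule sum.group[symmetric]) (use fin fN in auto)
    also have "\<dots> = trig_poly N (\<lambda>k. b k x) y"
      unfolding b_def sum_distrib_right
    proof (intro sum.cong refl)
      fix k \<xi> assume "\<xi> \<in> {\<xi> \<in> S. \<lfloor>\<xi> $ d'\<rfloor> = k}"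
      then have "\<xi> \<in> S" "k = \<lfloor>\<xi> $ d'\<rfloor>" by auto
      then have "\<xi> $ d' = of_int k" by (simp only: fl)
      then show "a \<xi> * ee (x * \<xi> $ d + y * \<xi> $ d') = a \<xi> * ee (x * \<xi> $ d) * ee (of_int k * y)"
        by (simp add: ee_add mult_ac)
    qed
    finally show ?thesis .
  qed
  define k0 where "k0 = \<lfloor>\<xi>\<^sub>0 $ d'\<rfloor>"
  define S0 where "S0 = {\<xi> \<in> S. \<lfloor>\<xi> $ d'\<rfloor> = k0}"
  define c where "c m = (\<Sum>\<xi>\<in>{\<xi> \<in> S0. \<lfloor>\<xi> $ d\<rfloor> = m}. a \<xi>)" for m
  have b0: "b k0 x = trig_poly N c x" for x
  proof -
    have "b k0 x = (\<Sum>\<xi>\<in>S0. a \<xi> * ee (x * \<xi> $ d))" by (simp add: b_def S0_def)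
    also have "\<dots> = (\<Sum>m\<in>{- int N..int N}. \<Sum>\<xi>\<in>{\<xi> \<in> S0. \<lfloor>\<xi> $ d\<rfloor> = m}. a \<xi> * ee (x * \<xi> $ d))"
      by (rule sum.group[symmetric]) (use fin fN in \<open>auto simp: S0_def\<close>)
    also have "\<dots> = trig_poly N c x"
      unfolding c_def sum_distrib_right
    proof (intro sum.cong refl)
      fix m \<xi> assume "\<xi> \<in> {\<xi> \<in> S0. \<lfloor>\<xi> $ d\<rfloor> = m}"
      then have "\<xi> \<in> S" "m = \<lfloor>\<xi> $ d\<rfloor>" by (auto simp: S0_def)
      then have "\<xi> $ d = of_int m" by (simp only: fl)
      then show "a \<xi> * ee (x * \<xi> $ d) = a \<xi> * ee (of_int m * x)"
        by (simp add: mult_ac)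
    qed
    finally show ?thesis .
  qed
  \<comment> \<open>Both coordinates of \<xi> are prescribed here, so the coefficient in question is
    the single number \<open>a \<xi>\<^sub>0\<close>.\<close>
  have "{\<xi> \<in> S0. \<lfloor>\<xi> $ d\<rfloor> = \<lfloor>\<xi>\<^sub>0 $ d\<rfloor>} = {\<xi>\<^sub>0}"
  proof -
    have "\<xi> = \<xi>\<^sub>0" if "\<xi> \<in> S" "\<lfloor>\<xi> $ d'\<rfloor> = \<lfloor>\<xi>\<^sub>0 $ d'\<rfloor>" "\<lfloor>\<xi> $ d\<rfloor> = \<lfloor>\<xi>\<^sub>0 $ d\<rfloor>" for \<xi>
    proof -
      have "\<xi> $ d = \<xi>\<^sub>0 $ d" using that(3) fl[OF that(1), of d] fl[OF \<xi>0(1), of d] by metis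
      moreover have "\<xi> $ d' = \<xi>\<^sub>0 $ d'" using that(2) fl[OF that(1), of d'] fl[OF \<xi>0(1), of d'] by metis
      ultimately have "\<xi> $ i = \<xi>\<^sub>0 $ i" for i using dcases[of i] by auto
      then show ?thesis by (simp add: vec_eq_iff)
    qed
    then show ?thesis using \<xi>0(1) by (auto simp: S0_def k0_def)
  qed
  then have c0: "c \<lfloor>\<xi>\<^sub>0 $ d\<rfloor> \<noteq> 0" using \<xi>0(2) by (simp add: c_def)
  have "{x. \<not> (finite (Z x) \<and> card (Z x) \<le> 2 * N)} \<subseteq> {x. b k0 x = 0}"
  proof (rule subsetI, rule CollectI, rule ccontr)
    fix x assume x: "x \<in> {x. \<not> (finite (Z x) \<and> card (Z x) \<le> 2 * N)}" and "b k0 x \<noteq> 0"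
    then show False
      using trig_poly_zeros[of k0 N "\<lambda>k. b k x"] fN[OF \<xi>0(1)] by (simp add: Z_def sum_b k0_def)
  qed
  moreover have "countable {x. b k0 x = 0}"
    unfolding b0 by (rule countable_trig_poly_zeros[where c = c, OF fN[OF \<xi>0(1)] c0])
  ultimately show ?thesis by (rule countable_subset)
qed

section \<open>Total length of disjoint nodal arcs\<close>

text \<open>The sum of lengths is the integral of the number of intervals over x, and this number is
  at most k off a null set.\<close>

lemma sum_lengths_le_of_multiplicity:
  fixes p q :: "'i \<Rightarrow> real"
  assumes fin: "finite I" and pq: "\<And>i. i \<in> I \<Longrightarrow> 0 \<le> p i \<and> p i \<le> q i \<and> q i \<le> B"
    and bad: "countable Bad" and mult: "\<And>x. x \<notin> Bad \<Longrightarrow> card {i \<in> I. p i \<le> x \<and> x \<le> q i} \<le> k"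
  shows "(\<Sum>i\<in>I. q i - p i) \<le> real k * max B 0"
proof -
  have "(\<Sum>i\<in>I. ennreal (q i - p i)) = (\<Sum>i\<in>I. \<integral>\<^sup>+x. indicator {p i..q i} x \<partial>lborel)"
    by (intro sum.cong refl) (use pq in auto)
  also have "\<dots> = (\<integral>\<^sup>+x. (\<Sum>i\<in>I. indicator {p i..q i} x) \<partial>lborel)"
    by (rule nn_integral_sum[symmetric]) auto
  also have "\<dots> \<le> (\<integral>\<^sup>+x. of_nat k * indicator {0..max B 0} x \<partial>lborel)"
  proof (rule nn_integral_mono_AE)
    have "AE x in lborel. x \<notin> Bad" using bad by (intro AE_not_in countable_imp_null_set_lborel)
    then show "AE x in lborel. (\<Sum>i\<in>I. indicator {p i..q i} x) \<le> (of_nat k * indicator {0..max B 0} x :: ennreal)"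
    proof eventually_elim
      fix x assume x: "x \<notin> Bad"
      have eq: "(\<Sum>i\<in>I. indicator {p i..q i} x :: ennreal) = of_nat (card {i \<in> I. p i \<le> x \<and> x \<le> q i})"
      proof -
        have "(\<Sum>i\<in>I. indicator {p i..q i} x :: ennreal) = (\<Sum>i\<in>{i \<in> I. p i \<le> x \<and> x \<le> q i}. 1)"
          by (rule sum.mono_neutral_cong_right) (use fin in \<open>auto simp: indicator_def\<close>)
        then show ?thesis by simp
      qed
      show "(\<Sum>i\<in>I. indicator {p i..q i} x) \<le> (of_nat k * indicator {0..max B 0} x :: ennreal)"
      proof (cases "{i \<in> I. p i \<le> x \<and> x \<le> q i} = {}")
        case True
        then show ?thesis unfolding eq True by simp
      next
        case False
        then obtain i where "i \<in> I" "p i \<le> x" "x \<le> q i" by auto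
        then have "x \<in> {0..max B 0}" using pq[of i] by auto
        then show ?thesis unfolding eq using mult[OF x] by simp
      qed
    qed
  qed
  also have "\<dots> = of_nat k * ennreal (max B 0)" by (subst nn_integral_cmult_indicator) auto
  also have "\<dots> = ennreal (real k * max B 0)" by (simp add: ennreal_mult ennreal_of_nat_eq_real_of_nat)
  finally have "(\<Sum>i\<in>I. ennreal (q i - p i)) \<le> ennreal (real k * max B 0)" .
  then have "ennreal (\<Sum>i\<in>I. q i - p i) \<le> ennreal (real k * max B 0)"
    using pq by (subst sum_ennreal[symmetric]) (auto simp del: sum_ennreal)
  then show ?thesis by (subst (asm) ennreal_le_iff) auto
qed

lemma torus_of_eq_iff: "torus_of x = torus_of y \<longleftrightarrow> x - y \<in> int_lattice"
  by (rule torus.abs_eq_iff)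

text \<open>Arcs are projected to a coordinate axis along which they are transversal; a line orthogonal to
  the axis meets the nodal set in at most as many points as a trigonometric polynomial has zeros.\<close>

lemma sum_arc_lengths_le:
  fixes \<gamma> :: "'i \<Rightarrow> real \<Rightarrow> real^2" and a :: "real^2 \<Rightarrow> complex"
  assumes fin: "finite I" and arcs: "\<And>i. i \<in> I \<Longrightarrow> curved_arc (\<gamma> i) (\<gamma>' i) (\<gamma>'' i) (l i) (\<kappa> i)"
    and short: "\<And>i. i \<in> I \<Longrightarrow> l i < 1"
    and disj: "\<And>i j s t. i \<in> I \<Longrightarrow> j \<in> I \<Longrightarrow> s \<in> {0..l i} \<Longrightarrow> t \<in> {0..l j} \<Longrightarrow>
       torus_of (\<gamma> i s) = torus_of (\<gamma> j t) \<Longrightarrow> i = j"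
    and zero: "\<And>i t. i \<in> I \<Longrightarrow> t \<in> {0..l i} \<Longrightarrow> trig_sum a S (\<gamma> i t) = 0"
    and S: "finite S" "S \<subseteq> int_lattice" and N: "\<And>\<xi> i. \<xi> \<in> S \<Longrightarrow> \<bar>\<xi> $ i\<bar> \<le> real N"
    and \<xi>0: "\<xi>\<^sub>0 \<in> S" "a \<xi>\<^sub>0 \<noteq> 0"
  shows "(\<Sum>i\<in>I. l i) \<le> 40 * real N"
proof -
  define J where "J d = {i \<in> I. l i \<le> 5 * \<bar>\<gamma> i (l i) $ d - \<gamma> i 0 $ d\<bar>}" for d :: 2
  have JI: "finite (J d)" "J d \<subseteq> I" for d using fin by (auto simp: J_def)
  have "I = J 1 \<union> J 2"
  proof -
    have "i \<in> J 1 \<union> J 2" if i: "i \<in> I" for i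
    proof -
      obtain d where "i \<in> J d"
        using curved_arc.arc_projection_length[OF arcs[OF i]] i unfolding J_def by blast
      then show ?thesis using exhaust_2[of d] by auto
    qed
    then show ?thesis using JI(2) by auto
  qed
  have *: "(\<Sum>i\<in>J d. l i) \<le> 20 * real N" if dd: "d \<noteq> d'" for d d' :: 2
  proof -
    have dcases: "i = d \<or> i = d'" for i using dd exhaust_2[of d] exhaust_2[of d'] exhaust_2[of i] by auto
    define p0 where "p0 i = min (\<gamma> i 0 $ d) (\<gamma> i (l i) $ d)" for i
    define q0 where "q0 i = max (\<gamma> i 0 $ d) (\<gamma> i (l i) $ d)" for i
    \<comment> \<open>Each projected arc is shifted by an integer so that it starts in [0, 1); being
      shorter than 1, it then lies in [0, 2].\<close>
    define p where "p i = p0 i - of_int \<lfloor>p0 i\<rfloor>" for i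
    define q where "q i = q0 i - of_int \<lfloor>p0 i\<rfloor>" for i
    define Z where "Z x = {y \<in> {0..<1}. (\<Sum>\<xi>\<in>S. a \<xi> * ee (x * \<xi> $ d + y * \<xi> $ d')) = 0}" for x
    define Bad where "Bad = {x. \<not> (finite (Z x) \<and> card (Z x) \<le> 2 * N)}"
    have Bad: "countable Bad"
      unfolding Bad_def Z_def by (rule exponential_sum_line_zeros[where a = a, OF S N dd \<xi>0])
    have len: "q i - p i = \<bar>\<gamma> i (l i) $ d - \<gamma> i 0 $ d\<bar>" for i
      by (simp add: p_def q_def p0_def q0_def)
    have pq: "0 \<le> p i \<and> p i \<le> q i \<and> q i \<le> 2" if i: "i \<in> I" for i
    proof -
      interpret curved_arc "\<gamma> i" "\<gamma>' i" "\<gamma>'' i" "l i" "\<kappa> i" by (rule arcs[OF i])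
      have "0 \<le> p i" "p i < 1" unfolding p_def by linarith+
      moreover have "\<bar>\<gamma> i (l i) $ d - \<gamma> i 0 $ d\<bar> \<le> l i"
        using component_le_norm_cart[of "\<gamma> i (l i) - \<gamma> i 0" d] arc_lipschitz[of 0 "l i"] l by simp
      ultimately show ?thesis using len[of i] short[OF i] by linarith
    qed
    have mult: "card {i \<in> J d. p i \<le> x \<and> x \<le> q i} \<le> 2 * N" if x: "x \<notin> Bad" for x
    proof -
      have "\<exists>t\<in>{0..l i}. \<gamma> i t $ d = x + of_int \<lfloor>p0 i\<rfloor>" if i: "i \<in> I" "p i \<le> x" "x \<le> q i" for i
      proof -
        interpret curved_arc "\<gamma> i" "\<gamma>' i" "\<gamma>'' i" "l i" "\<kappa> i" by (rule arcs[OF i(1)])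
        have "continuous_on {0..l i} (\<lambda>t. \<gamma> i t $ d)" by (intro continuous_intros continuous_on_arc)
        then have ivl: "is_interval ((\<lambda>t. \<gamma> i t $ d) ` {0..l i})"
          using connected_continuous_image[of "{0..l i}"] by (simp add: is_interval_connected_1)
        have le: "p0 i \<le> x + of_int \<lfloor>p0 i\<rfloor>" "x + of_int \<lfloor>p0 i\<rfloor> \<le> q0 i"
          using i by (auto simp: p_def q_def)
        have mem: "p0 i \<in> (\<lambda>t. \<gamma> i t $ d) ` {0..l i}" "q0 i \<in> (\<lambda>t. \<gamma> i t $ d) ` {0..l i}"
          using l by (auto simp: p0_def q0_def min_def max_def)
        have "x + of_int \<lfloor>p0 i\<rfloor> \<in> (\<lambda>t. \<gamma> i t $ d) ` {0..l i}"
          by (rule mem_is_interval_1_I[OF ivl mem le])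
        then obtain t where "x + of_int \<lfloor>p0 i\<rfloor> = \<gamma> i t $ d" "t \<in> {0..l i}" by (rule imageE)
        then show ?thesis by (intro bexI[of _ t]) simp_all
      qed
      then obtain \<tau> where \<tau>: "\<And>i. i \<in> I \<Longrightarrow> p i \<le> x \<Longrightarrow> x \<le> q i \<Longrightarrow> \<tau> i \<in> {0..l i} \<and> \<gamma> i (\<tau> i) $ d = x + of_int \<lfloor>p0 i\<rfloor>"
        by metis
      let ?J = "{i \<in> J d. p i \<le> x \<and> x \<le> q i}"
      \<comment> \<open>Each arc over x yields a zero on one period of the line. Distinct arcs are
        disjoint in the torus, so the zeros differ and their number is at most 2 N.\<close>
      define f where "f i = frac (\<gamma> i (\<tau> i) $ d')" for i
      have "f ` ?J \<subseteq> Z x"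
      proof (rule image_subsetI)
        fix i assume "i \<in> ?J"
        then have i: "i \<in> I" "p i \<le> x" "x \<le> q i" using JI by auto
        have "(\<Sum>\<xi>\<in>S. a \<xi> * ee (x * \<xi> $ d + f i * \<xi> $ d')) = trig_sum a S (\<gamma> i (\<tau> i))"
        proof (intro sum.cong refl arg_cong2[where f = "(*)"])
          fix \<xi> assume \<xi>: "\<xi> \<in> S"
          have U: "(UNIV :: 2 set) = {d, d'}" using dcases by auto
          have "\<gamma> i (\<tau> i) \<bullet> \<xi> = \<gamma> i (\<tau> i) $ d * \<xi> $ d + \<gamma> i (\<tau> i) $ d' * \<xi> $ d'"
            unfolding inner_vec_def U using dd by simp
          also have "\<dots> = (x * \<xi> $ d + f i * \<xi> $ d') + (of_int \<lfloor>p0 i\<rfloor> * \<xi> $ d + of_int \<lfloor>\<gamma> i (\<tau> i) $ d'\<rfloor> * \<xi> $ d')"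
            using \<tau>[OF i] by (simp add: f_def frac_def algebra_simps)
          finally have "ee (\<gamma> i (\<tau> i) \<bullet> \<xi>) = ee (x * \<xi> $ d + f i * \<xi> $ d') * ee (of_int \<lfloor>p0 i\<rfloor> * \<xi> $ d + of_int \<lfloor>\<gamma> i (\<tau> i) $ d'\<rfloor> * \<xi> $ d')"
            by (simp only: ee_add)
          moreover have "ee (of_int \<lfloor>p0 i\<rfloor> * \<xi> $ d + of_int \<lfloor>\<gamma> i (\<tau> i) $ d'\<rfloor> * \<xi> $ d') = 1"
            using \<xi> S(2) unfolding ee_eq_1_iff by (auto simp: int_lattice_def)
          ultimately show "ee (x * \<xi> $ d + f i * \<xi> $ d') = ee (\<gamma> i (\<tau> i) \<bullet> \<xi>)" by simp
        qed
        also have "\<dots> = 0" using zero i \<tau>[OF i] by simp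
        finally show "f i \<in> Z x" by (simp add: Z_def f_def frac_lt_1)
      qed
      moreover have "inj_on f ?J"
      proof (rule inj_onI)
        fix i j assume ij: "i \<in> ?J" "j \<in> ?J" "f i = f j"
        then have i: "i \<in> I" "p i \<le> x" "x \<le> q i" and j: "j \<in> I" "p j \<le> x" "x \<le> q j" using JI by auto
        have "(\<gamma> i (\<tau> i) - \<gamma> j (\<tau> j)) $ d = of_int (\<lfloor>p0 i\<rfloor> - \<lfloor>p0 j\<rfloor>)"
          using \<tau>[OF i] \<tau>[OF j] by simp
        moreover have "(\<gamma> i (\<tau> i) - \<gamma> j (\<tau> j)) $ d' = of_int (\<lfloor>\<gamma> i (\<tau> i) $ d'\<rfloor> - \<lfloor>\<gamma> j (\<tau> j) $ d'\<rfloor>)"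
          using ij(3) by (simp add: f_def frac_def)
        ultimately have "(\<gamma> i (\<tau> i) - \<gamma> j (\<tau> j)) $ k \<in> \<int>" for k
          using dcases[of k] by (metis Ints_of_int)
        then have "torus_of (\<gamma> i (\<tau> i)) = torus_of (\<gamma> j (\<tau> j))"
          unfolding torus_of_eq_iff int_lattice_def by blast
        then show "i = j" using disj[OF i(1) j(1)] \<tau>[OF i] \<tau>[OF j] by blast
      qed
      moreover have "finite (Z x)" "card (Z x) \<le> 2 * N" using x by (auto simp: Bad_def)
      ultimately show ?thesis using card_inj_on_le[of f ?J "Z x"] by linarith
    qed
    \<comment> \<open>Multiplicity 2 N over an interval of length 2, times the projection factor 5,
      gives 20 N per axis.\<close>
    have "(\<Sum>i\<in>J d. q i - p i) \<le> real (2 * N) * max 2 0"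
      by (rule sum_lengths_le_of_multiplicity[OF JI(1) _ Bad mult]) (use pq JI in auto)
    moreover have "(\<Sum>i\<in>J d. l i) \<le> (\<Sum>i\<in>J d. 5 * (q i - p i))"
      by (intro sum_mono) (simp add: len J_def)
    moreover have "(\<Sum>i\<in>J d. 5 * (q i - p i)) = 5 * (\<Sum>i\<in>J d. q i - p i)" by (rule sum_distrib_left[symmetric])
    ultimately show ?thesis by simp
  qed
  have "(\<Sum>i\<in>I. l i) \<le> (\<Sum>i\<in>J 1. l i) + (\<Sum>i\<in>J 2. l i)"
  proof -
    have lpos: "0 \<le> l i" if "i \<in> I" for i using curved_arc.l[OF arcs[OF that]] by simp
    have "(\<Sum>i\<in>I. l i) + (\<Sum>i\<in>J 1 \<inter> J 2. l i) = (\<Sum>i\<in>J 1. l i) + (\<Sum>i\<in>J 2. l i)"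
      unfolding \<open>I = J 1 \<union> J 2\<close> by (rule sum.union_inter[OF JI(1) JI(1)])
    moreover have "0 \<le> (\<Sum>i\<in>J 1 \<inter> J 2. l i)" using JI lpos by (intro sum_nonneg) auto
    ultimately show ?thesis by linarith
  qed
  then show ?thesis using *[of 1 2] *[of 2 1] by simp
qed

section \<open>Moments over a grid\<close>

abbreviation grid :: "nat \<Rightarrow> (nat \<times> nat) set" where
  "grid n \<equiv> {..<n} \<times> {..<n}"

abbreviation grid_point :: "nat \<Rightarrow> nat \<times> nat \<Rightarrow> real^2" where
  "grid_point n z \<equiv> pt (real (fst z) / real n) (real (snd z) / real n)"

lemma cnj_ee: "cnj (ee x) = ee (- x)"
  by (simp add: ee_def exp_cnj)

lemma roots_of_unity_sum:
  assumes n: "n > 0" and m: "m \<in> \<int>" "\<bar>m\<bar> < real n"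
  shows "(\<Sum>i<n. ee (real i / real n * m)) = (if m = 0 then of_nat n else 0)"
proof (cases "m = 0")
  case False
  have "ee (m / real n) \<noteq> 1"
  proof
    assume "ee (m / real n) = 1"
    then obtain k where k: "m / real n = of_int k" unfolding ee_eq_1_iff by (auto elim: Ints_cases)
    have "\<bar>m / real n\<bar> < 1" using m n by (simp add: abs_divide)
    then have "k = 0" unfolding k by linarith
    then show False using k False n by simp
  qed
  moreover have "ee (real i / real n * m) = ee (m / real n) ^ i" for i
    by (simp add: ee_power)
  moreover have "ee (m / real n) ^ n = 1"
    using n m by (simp add: ee_power ee_eq_1_iff)
  ultimately show ?thesis using False by (simp add: sum_gp_strict)
qed simp

lemma grid_orthogonality:
  assumes n: "n > 0" and k: "k \<in> int_lattice" "norm k < real n"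
  shows "(\<Sum>p\<in>grid n. ee (grid_point n p \<bullet> k)) = (if k = 0 then (of_nat n)\<^sup>2 else 0)"
proof -
  have kd: "k $ d \<in> \<int>" "\<bar>k $ d\<bar> < real n" for d
    using k component_le_norm_cart[of k d] by (auto simp: int_lattice_def)
  have "(\<Sum>p\<in>grid n. ee (grid_point n p \<bullet> k))
     = (\<Sum>i<n. ee (real i / real n * k $ 1)) * (\<Sum>j<n. ee (real j / real n * k $ 2))"
    unfolding sum_product sum.cartesian_product by (intro sum.cong refl) (auto simp: ee_add)
  also have "\<dots> = (if k = 0 then (of_nat n)\<^sup>2 else 0)"
    unfolding roots_of_unity_sum[OF n kd] by (auto simp: vec_eq_iff forall_2 power2_eq_square)
  finally show ?thesis .
qed

text \<open>Frequencies differing by less than n do not alias on the grid, so Parseval holds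
  exactly. Coinciding frequencies are allowed, since the fourth moment applies this to the family of
  sums of two frequencies.\<close>

lemma grid_mean_square:
  fixes \<omega> :: "'p \<Rightarrow> real^2" and b :: "'p \<Rightarrow> complex"
  assumes n: "n > 0" and P: "finite P" and lat: "\<And>p. p \<in> P \<Longrightarrow> \<omega> p \<in> int_lattice"
    and diam: "\<And>p q. p \<in> P \<Longrightarrow> q \<in> P \<Longrightarrow> norm (\<omega> p - \<omega> q) < real n"
  shows "(\<Sum>z\<in>grid n. of_real ((norm (\<Sum>p\<in>P. b p * ee (grid_point n z \<bullet> \<omega> p)))\<^sup>2))
    = (of_nat n)\<^sup>2 * (\<Sum>p\<in>P. \<Sum>q\<in>{q \<in> P. \<omega> q = \<omega> p}. b p * cnj (b q))"
proof -
  define x where "x z = grid_point n z" for z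
  have "of_real ((norm (\<Sum>p\<in>P. b p * ee (x z \<bullet> \<omega> p)))\<^sup>2) = (\<Sum>p\<in>P. \<Sum>q\<in>P. b p * cnj (b q) * ee (x z \<bullet> (\<omega> p - \<omega> q)))" for z
    unfolding complex_norm_square cnj_sum sum_product
    by (intro sum.cong refl) (simp add: cnj_ee ee_add[symmetric] inner_diff_right ee_minus ee_diff divide_inverse mult_ac del: pt_inner)
  then have "(\<Sum>z\<in>grid n. of_real ((norm (\<Sum>p\<in>P. b p * ee (x z \<bullet> \<omega> p)))\<^sup>2))
     = (\<Sum>z\<in>grid n. \<Sum>p\<in>P. \<Sum>q\<in>P. b p * cnj (b q) * ee (x z \<bullet> (\<omega> p - \<omega> q)))" by simp
  also have "\<dots> = (\<Sum>p\<in>P. \<Sum>q\<in>P. \<Sum>z\<in>grid n. b p * cnj (b q) * ee (x z \<bullet> (\<omega> p - \<omega> q)))"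
    by (subst sum.swap, intro sum.cong refl, subst sum.swap, rule refl)
  also have "\<dots> = (\<Sum>p\<in>P. \<Sum>q\<in>P. if \<omega> q = \<omega> p then (of_nat n)\<^sup>2 * (b p * cnj (b q)) else 0)"
  proof (intro sum.cong refl)
    fix p q assume pq: "p \<in> P" "q \<in> P"
    have "(\<Sum>z\<in>grid n. b p * cnj (b q) * ee (x z \<bullet> (\<omega> p - \<omega> q)))
       = b p * cnj (b q) * (if \<omega> p - \<omega> q = 0 then (of_nat n)\<^sup>2 else 0)"
      unfolding sum_distrib_left[symmetric] x_def
      by (subst grid_orthogonality[OF n]) (use pq lat diam in \<open>auto intro: int_lattice_diff\<close>)
    then show "(\<Sum>z\<in>grid n. b p * cnj (b q) * ee (x z \<bullet> (\<omega> p - \<omega> q)))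
       = (if \<omega> q = \<omega> p then (of_nat n)\<^sup>2 * (b p * cnj (b q)) else 0)" by auto
  qed
  also have "\<dots> = (of_nat n)\<^sup>2 * (\<Sum>p\<in>P. \<Sum>q\<in>{q \<in> P. \<omega> q = \<omega> p}. b p * cnj (b q))"
    unfolding sum_distrib_left by (rule sum.cong[OF refl]) (simp add: sum.inter_filter[OF P])
  finally show ?thesis unfolding x_def .
qed

text \<open>Equal norms make w - u and w - v perpendicular to u + v and to each other. Two vectors
  perpendicular to a common nonzero vector are parallel in the plane, so one of them is
  zero.\<close>

lemma equal_norm_sum_unique:
  fixes u v w z :: "real^2"
  assumes eq: "u + v = w + z" and nz: "u + v \<noteq> 0"
    and norm: "norm u = R" "norm v = R" "norm w = R" "norm z = R"
  shows "w = u \<or> w = v"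
proof -
  define k where "k = u + v"
  have dot: "(norm k)\<^sup>2 = 2 * R\<^sup>2 + 2 * (u \<bullet> v)" "(norm k)\<^sup>2 = 2 * R\<^sup>2 + 2 * (w \<bullet> z)"
    using norm unfolding k_def dot_norm[of u v] eq dot_norm[of w z] by (simp_all add: field_simps)
  have sq: "u \<bullet> u = R\<^sup>2" "v \<bullet> v = R\<^sup>2" "w \<bullet> w = R\<^sup>2" "z \<bullet> z = R\<^sup>2"
    using norm by (auto simp: power2_norm_eq_inner[symmetric])
  have ku: "k \<bullet> u = R\<^sup>2 + u \<bullet> v" "k \<bullet> v = R\<^sup>2 + u \<bullet> v"
    unfolding k_def by (simp_all add: inner_add_left sq inner_commute[of v u])
  have kw: "k \<bullet> w = R\<^sup>2 + w \<bullet> z"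
    unfolding k_def eq by (simp add: inner_add_left sq inner_commute[of z w])
  have 1: "k \<bullet> (w - u) = 0" "k \<bullet> (w - v) = 0"
    using dot ku kw by (simp_all add: inner_diff_right)
  have "(w - u) \<bullet> (w - v) = w \<bullet> w - k \<bullet> w + u \<bullet> v"
    by (simp add: k_def inner_diff_left inner_diff_right inner_add_left inner_commute[of w v])
  also have "\<dots> = 0" using dot kw sq by simp
  finally have 2: "(w - u) \<bullet> (w - v) = 0" .
  have perp: "x = 0 \<or> y = 0" if "k \<bullet> x = 0" "k \<bullet> y = 0" "x \<bullet> y = 0" for x y :: "real^2"
  proof -
    have "norm k \<noteq> 0" using nz by (simp add: k_def)
    define e where "e = k /\<^sub>R norm k"
    have e: "norm e = 1" "e \<bullet> x = 0" "e \<bullet> y = 0" using that \<open>norm k \<noteq> 0\<close> by (auto simp: e_def)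
    have "\<bar>y \<bullet> x\<bar> = norm x * norm y"
    proof -
      have "(y \<bullet> rot e)\<^sup>2 = (norm y)\<^sup>2" using inner_sq_plus_inner_rot_sq[of e y] e by (simp add: inner_commute)
      then have "\<bar>y \<bullet> rot e\<bar> = norm y" using power2_eq_iff_nonneg[of "\<bar>y \<bullet> rot e\<bar>" "norm y"] by simp
      then show ?thesis using abs_inner_orthogonal[of e x y] e by (simp add: inner_commute)
    qed
    then show ?thesis using that(3) by (simp add: inner_commute)
  qed
  from perp[OF 1 2] show ?thesis by auto
qed

text \<open>Zygmund's argument: the fourth power is the squared modulus of the square of the sum,
  and a nonzero sum of two points of a circle determines the unordered pair, whence the factor 2.
  The diameter bound n/2 prevents aliasing of sums and, with \<open>nE\<close>, excludes antipodal
  pairs, whose sum is zero.\<close>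

lemma grid_fourth_moment:
  fixes a :: "real^2 \<Rightarrow> complex"
  assumes n: "n > 0" and J: "J \<subseteq> freqs E" and nE: "real n / 2 \<le> 2 * sqrt E"
    and diam: "\<And>\<xi> \<eta>. \<xi> \<in> J \<Longrightarrow> \<eta> \<in> J \<Longrightarrow> norm (\<xi> - \<eta>) < real n / 2"
  defines "u \<equiv> \<lambda>z. (norm (trig_sum a J (grid_point n z)))\<^sup>2"
  shows "(\<Sum>z\<in>grid n. u z) = (real n)\<^sup>2 * (\<Sum>\<xi>\<in>J. (norm (a \<xi>))\<^sup>2)"
    and "(\<Sum>z\<in>grid n. (u z)\<^sup>2) \<le> 2 * (real n)\<^sup>2 * (\<Sum>\<xi>\<in>J. (norm (a \<xi>))\<^sup>2)\<^sup>2"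
proof -
  let ?s = "\<Sum>\<xi>\<in>J. (norm (a \<xi>))\<^sup>2"
  have fin: "finite J" using J finite_freqs finite_subset by blast
  have lat: "\<xi> \<in> int_lattice" and nrm: "norm \<xi> = sqrt E" if "\<xi> \<in> J" for \<xi>
    using that J by (auto simp: freqs_def)
  have "(\<Sum>z\<in>grid n. of_real (u z)) = (of_nat n)\<^sup>2 * (\<Sum>\<xi>\<in>J. \<Sum>\<eta>\<in>{\<eta> \<in> J. \<eta> = \<xi>}. a \<xi> * cnj (a \<eta>))"
    unfolding u_def
  proof (rule grid_mean_square[OF n fin lat])
    show "norm (p - q) < real n" if "p \<in> J" "q \<in> J" for p q
      using diam[OF that] n by simp
  qed
  also have "(\<Sum>\<xi>\<in>J. \<Sum>\<eta>\<in>{\<eta> \<in> J. \<eta> = \<xi>}. a \<xi> * cnj (a \<eta>)) = (\<Sum>\<xi>\<in>J. a \<xi> * cnj (a \<xi>))"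
  proof (intro sum.cong refl)
    fix \<xi> assume "\<xi> \<in> J"
    then have "{\<eta> \<in> J. \<eta> = \<xi>} = {\<xi>}" by auto
    then show "(\<Sum>\<eta>\<in>{\<eta> \<in> J. \<eta> = \<xi>}. a \<xi> * cnj (a \<eta>)) = a \<xi> * cnj (a \<xi>)" by simp
  qed
  finally have eq1: "(\<Sum>z\<in>grid n. complex_of_real (u z)) = (of_nat n)\<^sup>2 * (\<Sum>\<xi>\<in>J. a \<xi> * cnj (a \<xi>))" .
  have "complex_of_real ((real n)\<^sup>2) = (of_nat n)\<^sup>2" by simp
  then have "of_real (\<Sum>z\<in>grid n. u z) = complex_of_real ((real n)\<^sup>2 * ?s)"
    by (simp add: complex_norm_square eq1 del: of_real_power)
  then show "(\<Sum>z\<in>grid n. u z) = (real n)\<^sup>2 * ?s"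
    by (simp only: of_real_eq_iff)
  define b where "b p = a (fst p) * a (snd p)" for p
  define \<omega> where "\<omega> p = fst p + snd p" for p :: "(real^2) \<times> (real^2)"
  let ?R = "\<Sum>p\<in>J \<times> J. \<Sum>q\<in>{q \<in> J \<times> J. \<omega> q = \<omega> p}. b p * cnj (b q)"
  have u2: "(u z)\<^sup>2 = (norm (\<Sum>p\<in>J \<times> J. b p * ee (grid_point n z \<bullet> \<omega> p)))\<^sup>2" for z
  proof -
    have "(trig_sum a J (grid_point n z)) *
        (trig_sum a J (grid_point n z))
      = (\<Sum>p\<in>J \<times> J. b p * ee (grid_point n z \<bullet> \<omega> p))"
      unfolding sum_product sum.cartesian_product b_def \<omega>_def
      by (intro sum.cong refl) (auto simp: inner_add_right ee_add mult_ac simp del: pt_inner)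
    from arg_cong[OF this, of "\<lambda>w. (norm w)\<^sup>2"] show ?thesis
      unfolding u_def norm_mult by (simp add: power2_eq_square)
  qed
  have "complex_of_real (\<Sum>z\<in>grid n. (u z)\<^sup>2) = (\<Sum>z\<in>grid n. of_real ((norm (\<Sum>p\<in>J \<times> J. b p * ee (grid_point n z \<bullet> \<omega> p)))\<^sup>2))"
    unfolding of_real_sum u2 ..
  also have "\<dots> = (of_nat n)\<^sup>2 * ?R"
  proof (rule grid_mean_square[OF n])
    show "finite (J \<times> J)" using fin by simp
    show "\<omega> p \<in> int_lattice" if "p \<in> J \<times> J" for p
      using that lat by (auto simp: \<omega>_def intro: int_lattice_add)
    show "norm (\<omega> p - \<omega> q) < real n" if "p \<in> J \<times> J" "q \<in> J \<times> J" for p q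
    proof -
      have "norm (\<omega> p - \<omega> q) \<le> norm (fst p - fst q) + norm (snd p - snd q)"
        using norm_triangle_ineq[of "fst p - fst q" "snd p - snd q"] by (simp add: \<omega>_def algebra_simps)
      also have "\<dots> < real n / 2 + real n / 2" using that by (intro add_strict_mono diam) auto
      finally show ?thesis by simp
    qed
  qed
  finally have eq: "complex_of_real (\<Sum>z\<in>grid n. (u z)\<^sup>2) = (of_nat n)\<^sup>2 * ?R" .
  have "norm (\<Sum>q\<in>{q \<in> J \<times> J. \<omega> q = \<omega> p}. b p * cnj (b q)) \<le> 2 * (norm (b p))\<^sup>2" if p: "p \<in> J \<times> J" for p
  proof -
    have sub: "{q \<in> J \<times> J. \<omega> q = \<omega> p} \<subseteq> {p, prod.swap p}"
    proof
      fix q assume "q \<in> {q \<in> J \<times> J. \<omega> q = \<omega> p}"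
      then have q: "fst q \<in> J" "snd q \<in> J" "fst p + snd p = fst q + snd q" by (auto simp: \<omega>_def)
      have p': "fst p \<in> J" "snd p \<in> J" using p by auto
      have "fst p + snd p \<noteq> 0"
      proof
        assume "fst p + snd p = 0"
        then have "snd p = - fst p" by (simp add: eq_neg_iff_add_eq_0 add.commute)
        then have "fst p - snd p = 2 *\<^sub>R fst p" by (simp add: scaleR_2)
        then have "norm (fst p - snd p) = 2 * sqrt E" using nrm[OF p'(1)] by simp
        then show False using diam[OF p'] nE by simp
      qed
      from equal_norm_sum_unique[OF q(3) this nrm[OF p'(1)] nrm[OF p'(2)] nrm[OF q(1)] nrm[OF q(2)]]
      have "fst q = fst p \<or> fst q = snd p" .
      then show "q \<in> {p, prod.swap p}"
        using q(3) by (cases p; cases q) (auto simp: add.commute)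
    qed
    have "norm (\<Sum>q\<in>{q \<in> J \<times> J. \<omega> q = \<omega> p}. b p * cnj (b q)) \<le> (\<Sum>q\<in>{q \<in> J \<times> J. \<omega> q = \<omega> p}. (norm (b p))\<^sup>2)"
    proof (rule sum_norm_le)
      fix q assume "q \<in> {q \<in> J \<times> J. \<omega> q = \<omega> p}"
      then have "q \<in> {p, prod.swap p}" using sub by blast
      then have "norm (b q) = norm (b p)" by (auto simp: b_def norm_mult mult.commute)
      then show "norm (b p * cnj (b q)) \<le> (norm (b p))\<^sup>2" by (simp add: norm_mult power2_eq_square)
    qed
    also have "\<dots> = real (card {q \<in> J \<times> J. \<omega> q = \<omega> p}) * (norm (b p))\<^sup>2" by simp
    also have "\<dots> \<le> 2 * (norm (b p))\<^sup>2"
    proof (rule mult_right_mono)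
      have "card {q \<in> J \<times> J. \<omega> q = \<omega> p} \<le> card {p, prod.swap p}" by (intro card_mono sub) simp
      also have "\<dots> \<le> 2" by (simp add: card_insert_if)
      finally show "real (card {q \<in> J \<times> J. \<omega> q = \<omega> p}) \<le> 2" by simp
    qed simp
    finally show ?thesis .
  qed
  then have "norm ?R \<le> (\<Sum>p\<in>J \<times> J. 2 * (norm (b p))\<^sup>2)"
    by (intro sum_norm_le)
  also have "\<dots> = 2 * ?s\<^sup>2"
  proof -
    have "(\<Sum>p\<in>J \<times> J. (norm (b p))\<^sup>2) = ?s * ?s"
      unfolding sum_product sum.cartesian_product
      by (intro sum.cong refl) (auto simp: b_def norm_mult power_mult_distrib)
    then show ?thesis by (simp add: sum_distrib_left[symmetric] power2_eq_square)
  qed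
  finally have "(real n)\<^sup>2 * norm ?R \<le> (real n)\<^sup>2 * (2 * ?s\<^sup>2)"
    by (rule mult_left_mono) simp
  moreover have "norm (complex_of_real (\<Sum>z\<in>grid n. (u z)\<^sup>2)) = (real n)\<^sup>2 * norm ?R"
    unfolding eq by (simp add: norm_mult norm_power)
  moreover have "norm (complex_of_real (\<Sum>z\<in>grid n. (u z)\<^sup>2)) = (\<Sum>z\<in>grid n. (u z)\<^sup>2)"
    unfolding norm_of_real by (intro abs_of_nonneg sum_nonneg) simp
  ultimately show "(\<Sum>z\<in>grid n. (u z)\<^sup>2) \<le> 2 * (real n)\<^sup>2 * ?s\<^sup>2"
    by (simp add: mult_ac)
qed

text \<open>Points with u < s/4 carry at most a quarter of the total. Cauchy-Schwarz on the rest
  gives (3/4)^2 |G| <= 2 |A|, which is the ratio 9 to 32.\<close>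

lemma finite_paley_zygmund:
  fixes u :: "'z \<Rightarrow> real"
  assumes G: "finite G" and s: "s > 0"
    and u0: "\<And>z. z \<in> G \<Longrightarrow> u z \<ge> 0"
    and u1: "(\<Sum>z\<in>G. u z) = real (card G) * s" and u2: "(\<Sum>z\<in>G. (u z)\<^sup>2) \<le> 2 * real (card G) * s\<^sup>2"
  shows "9 * real (card G) \<le> 32 * real (card {z \<in> G. u z \<ge> s / 4})"
proof (cases "G = {}")
  case False
  define A where "A = {z \<in> G. u z \<ge> s / 4}"
  have A: "finite A" "A \<subseteq> G" using G by (auto simp: A_def)
  have cG: "real (card G) > 0" using G False by (simp add: card_gt_0_iff)
  have "(\<Sum>z\<in>G - A. u z) \<le> (\<Sum>z\<in>G - A. s / 4)" by (intro sum_mono) (auto simp: A_def)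
  also have "\<dots> \<le> real (card G) * (s / 4)"
    using G s by (simp add: card_mono mult_right_mono)
  finally have "(\<Sum>z\<in>A. u z) \<ge> 3 / 4 * (real (card G) * s)"
    using sum.subset_diff[OF A(2) G, of u] u1 by simp
  then have "(3 / 4 * (real (card G) * s))\<^sup>2 \<le> (\<Sum>z\<in>A. u z)\<^sup>2" using cG s by (intro power_mono) auto
  also have "\<dots> \<le> (\<Sum>z\<in>A. (u z)\<^sup>2) * real (card A)"
    using sum_squared_le_sum_of_squares[of u A] by (simp add: mult.commute)
  also have "\<dots> \<le> (2 * real (card G) * s\<^sup>2) * real (card A)"
    using sum_mono2[OF G A(2), of "\<lambda>z. (u z)\<^sup>2"] u2 by (intro mult_right_mono) auto
  finally have "(real (card G) * s\<^sup>2) * (9 * real (card G)) \<le> (real (card G) * s\<^sup>2) * (32 * real (card A))"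
    by (simp add: power2_eq_square algebra_simps)
  then show ?thesis using cG s by (simp add: A_def)
qed simp

section \<open>Frequency clusters\<close>

text \<open>\<open>J\<close> consists of the points reached from x by jumps of length at most D
  inside S. At most \<open>card R\<close> jumps suffice, where R is the set of admissible jumps,
  hence the square of \<open>card S\<close>; a point of S within D of J would itself be
  reached.\<close>

lemma frequency_cluster:
  fixes S :: "'v::real_normed_vector set"
  assumes fin: "finite S" and D: "D \<ge> 0" and x: "x \<in> S"
  obtains J where "J \<subseteq> S" "x \<in> J" "\<And>y. y \<in> J \<Longrightarrow> norm (y - x) \<le> (real (card S))\<^sup>2 * D"
    "\<And>y z. y \<in> J \<Longrightarrow> z \<in> S - J \<Longrightarrow> norm (z - y) > D"
proof -
  define R where "R = {(y, z). y \<in> S \<and> z \<in> S \<and> norm (z - y) \<le> D}"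
  define J where "J = {y. (x, y) \<in> R\<^sup>*}"
  have R: "R \<subseteq> S \<times> S" by (auto simp: R_def)
  then have finR: "finite R" using fin by (meson finite_SigmaI finite_subset)
  have "J \<subseteq> S"
  proof
    fix y assume "y \<in> J"
    then have "(x, y) \<in> R\<^sup>*" by (simp add: J_def)
    then show "y \<in> S" by (induction rule: rtrancl_induct) (use x R in auto)
  qed
  moreover have "x \<in> J" by (simp add: J_def)
  moreover have "norm (y - x) \<le> (real (card S))\<^sup>2 * D" if "y \<in> J" for y
  proof -
    have "(x, y) \<in> (\<Union>n\<in>{n. n \<le> card R}. R ^^ n)"
      using that rtrancl_finite_eq_relpow[OF finR] by (simp add: J_def)
    then obtain n where n: "n \<le> card R" "(x, y) \<in> R ^^ n" by auto
    have "norm (y - x) \<le> real n * D" using n(2)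
    proof (induction n arbitrary: y)
      case (Suc n)
      then obtain z where z: "(x, z) \<in> R ^^ n" "(z, y) \<in> R" by auto
      have "norm (y - x) \<le> norm (y - z) + norm (z - x)" using norm_triangle_ineq[of "y - z" "z - x"] by simp
      also have "\<dots> \<le> D + real n * D" using z(2) Suc.IH[OF z(1)] by (intro add_mono) (auto simp: R_def)
      finally show ?case by (simp add: algebra_simps)
    qed simp
    also have "card R \<le> card (S \<times> S)" using R fin by (intro card_mono) auto
    then have "real n \<le> (real (card S))\<^sup>2"
      using n(1) by (simp add: card_cartesian_product power2_eq_square flip: of_nat_mult)
    then have "real n * D \<le> (real (card S))\<^sup>2 * D" using D by (rule mult_right_mono)
    finally show ?thesis .
  qed
  moreover have "norm (z - y) > D" if "y \<in> J" "z \<in> S - J" for y z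
  proof (rule ccontr)
    assume "\<not> ?thesis"
    then have "(y, z) \<in> R" using that \<open>J \<subseteq> S\<close> by (auto simp: R_def)
    then have "z \<in> J" using that by (auto simp: J_def intro: rtrancl_into_rtrancl)
    then show False using that by simp
  qed
  ultimately show thesis by (rule that)
qed

section \<open>Size of the cluster sum near a point and along a nodal arc\<close>

lemma norm_ee_diff_le: "norm (ee s - ee t) \<le> 2 * pi * \<bar>s - t\<bar>"
proof -
  have "(ee has_vector_derivative (2 * of_real pi * \<i> * ee x)) (at x within A)" for x A
  proof -
    have "((\<lambda>z. exp (2 * of_real pi * \<i> * z)) has_field_derivative (2 * of_real pi * \<i> * exp (2 * of_real pi * \<i> * of_real x))) (at (of_real x))"
      by (auto intro!: derivative_eq_intros)
    from has_vector_derivative_real_field[OF this, of A] show ?thesis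
      by (simp add: ee_def[abs_def])
  qed
  then have "norm (ee s - ee t) \<le> 2 * pi * \<bar>s - t\<bar>"
    by (rule vector_mean_value_bound[of "min s t" "max s t"]) (auto simp: norm_mult)
  then show ?thesis .
qed

text \<open>Factoring out the wave at \<open>\<xi>\<^sub>0\<close> does not change the modulus and
  leaves frequencies of size at most K, so the modulus varies on the scale 1/K instead of
  1/\<lambda>.\<close>

lemma cluster_modulus_variation:
  fixes a :: "real^2 \<Rightarrow> complex"
  assumes near: "\<And>\<xi>. \<xi> \<in> J \<Longrightarrow> norm (\<xi> - \<xi>\<^sub>0) \<le> K"
  shows "norm (trig_sum a J z) \<le> norm (trig_sum a J w) + 2 * pi * K * norm (z - w) * (\<Sum>\<xi>\<in>J. norm (a \<xi>))"
proof -
  define g where "g z = (\<Sum>\<xi>\<in>J. a \<xi> * ee (z \<bullet> (\<xi> - \<xi>\<^sub>0)))" for z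
  have g: "norm (trig_sum a J z) = norm (g z)" for z
  proof -
    have "trig_sum a J z = ee (z \<bullet> \<xi>\<^sub>0) * g z"
      unfolding g_def sum_distrib_left
      by (intro sum.cong refl) (simp add: inner_diff_right ee_diff)
    then show ?thesis by (simp add: norm_mult)
  qed
  have "norm (g z - g w) \<le> (\<Sum>\<xi>\<in>J. 2 * pi * K * norm (z - w) * norm (a \<xi>))"
    unfolding g_def sum_subtractf[symmetric]
  proof (rule sum_norm_le)
    fix \<xi> assume \<xi>: "\<xi> \<in> J"
    have "norm (a \<xi> * ee (z \<bullet> (\<xi> - \<xi>\<^sub>0)) - a \<xi> * ee (w \<bullet> (\<xi> - \<xi>\<^sub>0))) = norm (a \<xi>) * norm (ee (z \<bullet> (\<xi> - \<xi>\<^sub>0)) - ee (w \<bullet> (\<xi> - \<xi>\<^sub>0)))"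
      by (simp add: norm_mult flip: right_diff_distrib)
    also have "\<dots> \<le> norm (a \<xi>) * (2 * pi * \<bar>(z - w) \<bullet> (\<xi> - \<xi>\<^sub>0)\<bar>)"
      using norm_ee_diff_le[of "z \<bullet> (\<xi> - \<xi>\<^sub>0)" "w \<bullet> (\<xi> - \<xi>\<^sub>0)"] by (intro mult_left_mono) (auto simp: inner_diff_left)
    also have "\<dots> \<le> norm (a \<xi>) * (2 * pi * (norm (z - w) * K))"
    proof (intro mult_left_mono)
      have "\<bar>(z - w) \<bullet> (\<xi> - \<xi>\<^sub>0)\<bar> \<le> norm (z - w) * norm (\<xi> - \<xi>\<^sub>0)" by (rule Cauchy_Schwarz_ineq2)
      also have "\<dots> \<le> norm (z - w) * K" using near[OF \<xi>] by (rule mult_left_mono) simp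
      finally show "\<bar>(z - w) \<bullet> (\<xi> - \<xi>\<^sub>0)\<bar> \<le> norm (z - w) * K" .
    qed auto
    finally show "norm (a \<xi> * ee (z \<bullet> (\<xi> - \<xi>\<^sub>0)) - a \<xi> * ee (w \<bullet> (\<xi> - \<xi>\<^sub>0))) \<le> 2 * pi * K * norm (z - w) * norm (a \<xi>)"
      by (simp add: mult_ac)
  qed
  also have "\<dots> = 2 * pi * K * norm (z - w) * (\<Sum>\<xi>\<in>J. norm (a \<xi>))" by (rule sum_distrib_left[symmetric])
  finally show ?thesis unfolding g using norm_triangle_ineq2[of "g z" "g w"] by linarith
qed

text \<open>On a nodal arc the cluster sum equals minus the sum over the remaining frequencies, and the
  product of the two oscillates along the arc.\<close>

lemma (in curved_arc) cluster_mean_square_on_nodal_arc: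
  fixes a :: "real^2 \<Rightarrow> complex"
  assumes S: "finite S" "J \<subseteq> S" and M: "\<And>\<xi>. \<xi> \<in> S \<Longrightarrow> norm (a \<xi>) \<le> M"
    and zero: "\<And>t. t \<in> {0..l} \<Longrightarrow> trig_sum a S (\<gamma> t) = 0"
    and sep: "\<And>\<xi> \<eta>. \<xi> \<in> J \<Longrightarrow> \<eta> \<in> S - J \<Longrightarrow> D \<le> norm (\<eta> - \<xi>)" and D: "0 \<le> D"
    and W: "1 \<le> W" "W \<le> \<kappa> * l\<^sup>2 * D"
  shows "integral {0..l} (\<lambda>t. (norm (trig_sum a J (\<gamma> t)))\<^sup>2) \<le> (real (card S))\<^sup>2 * M\<^sup>2 * (20 * l / sqrt W)"
proof -
  define f where "f t = trig_sum a J (\<gamma> t)" for t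
  have finJ: "finite J" using S finite_subset by blast
  have cf: "continuous_on {0..l} f"
    unfolding f_def by (intro continuous_intros continuous_on_arc)
  have f: "f t = - (\<Sum>\<eta>\<in>S - J. a \<eta> * ee (\<gamma> t \<bullet> \<eta>))" if "t \<in> {0..l}" for t
    using zero[OF that] sum.subset_diff[OF S(2,1), of "\<lambda>\<xi>. a \<xi> * ee (\<gamma> t \<bullet> \<xi>)"]
    by (simp add: f_def eq_neg_iff_add_eq_0 add.commute)
  \<comment> \<open>Only one of the two factors f is replaced by the sum over the other frequencies,
    so every product pairs a frequency outside \<open>J\<close> with one inside and no constant term
    survives.\<close>
  have sq: "complex_of_real ((norm (f t))\<^sup>2) = - (\<Sum>\<eta>\<in>S - J. \<Sum>\<xi>\<in>J. a \<eta> * cnj (a \<xi>) * ee ((\<eta> - \<xi>) \<bullet> \<gamma> t))" if t: "t \<in> {0..l}" for t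
  proof -
    have "complex_of_real ((norm (f t))\<^sup>2) = - (\<Sum>\<eta>\<in>S - J. a \<eta> * ee (\<gamma> t \<bullet> \<eta>)) * cnj (f t)"
      unfolding complex_norm_square using f[OF t] by simp
    also have "\<dots> = - (\<Sum>\<eta>\<in>S - J. \<Sum>\<xi>\<in>J. a \<eta> * cnj (a \<xi>) * ee ((\<eta> - \<xi>) \<bullet> \<gamma> t))"
      unfolding f_def cnj_sum minus_mult_left[symmetric] sum_product
      by (intro arg_cong[where f = uminus] sum.cong refl)
        (simp add: cnj_ee ee_minus ee_diff inner_diff_right inner_commute[of _ "\<gamma> t"] divide_inverse mult_ac)
    finally show ?thesis .
  qed
  have int: "(\<lambda>t. a \<eta> * cnj (a \<xi>) * ee ((\<eta> - \<xi>) \<bullet> \<gamma> t)) integrable_on {0..l}" for \<xi> \<eta>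
    by (intro integrable_continuous_real continuous_intros continuous_on_arc)
  let ?I = "integral {0..l} (\<lambda>t. (norm (f t))\<^sup>2)"
  have "complex_of_real (?I) = integral {0..l} (\<lambda>t. complex_of_real ((norm (f t))\<^sup>2))"
  proof -
    have "(\<lambda>t. (norm (f t))\<^sup>2) integrable_on {0..l}"
      by (intro integrable_continuous_real continuous_intros cf)
    from integral_linear[OF this bounded_linear_of_real[where 'a = complex]] show ?thesis
      by (simp add: o_def)
  qed
  also have "\<dots> = integral {0..l} (\<lambda>t. - (\<Sum>\<eta>\<in>S - J. \<Sum>\<xi>\<in>J. a \<eta> * cnj (a \<xi>) * ee ((\<eta> - \<xi>) \<bullet> \<gamma> t)))"
    by (rule integral_cong) (rule sq)
  also have "\<dots> = - (\<Sum>\<eta>\<in>S - J. \<Sum>\<xi>\<in>J. integral {0..l} (\<lambda>t. a \<eta> * cnj (a \<xi>) * ee ((\<eta> - \<xi>) \<bullet> \<gamma> t)))"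
    using S finJ int by (simp add: integral_sum integrable_sum)
  finally have eq: "complex_of_real (?I) = - (\<Sum>\<eta>\<in>S - J. \<Sum>\<xi>\<in>J. integral {0..l} (\<lambda>t. a \<eta> * cnj (a \<xi>) * ee ((\<eta> - \<xi>) \<bullet> \<gamma> t)))" .
  have term_le: "norm (integral {0..l} (\<lambda>t. a \<eta> * cnj (a \<xi>) * ee ((\<eta> - \<xi>) \<bullet> \<gamma> t))) \<le> M\<^sup>2 * (20 * l / sqrt W)"
    if "\<eta> \<in> S - J" "\<xi> \<in> J" for \<xi> \<eta>
  proof -
    have "W \<le> \<kappa> * l\<^sup>2 * norm (\<eta> - \<xi>)"
    proof -
      have "\<kappa> * l\<^sup>2 * D \<le> \<kappa> * l\<^sup>2 * norm (\<eta> - \<xi>)" using sep[OF that(2,1)] kappa by (intro mult_left_mono) auto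
      then show ?thesis using W by simp
    qed
    from arc_exponential_integral[OF W(1) this]
    have I: "norm (integral {0..l} (\<lambda>t. ee ((\<eta> - \<xi>) \<bullet> \<gamma> t))) \<le> 20 * l / sqrt W" .
    have "norm (a \<eta>) * norm (a \<xi>) \<le> M * M"
      using M[of \<eta>] M[of \<xi>] that S order_trans[OF norm_ge_zero M[of \<eta>]] by (intro mult_mono) auto
    from mult_mono[OF this I] have "(norm (a \<eta>) * norm (a \<xi>)) * norm (integral {0..l} (\<lambda>t. ee ((\<eta> - \<xi>) \<bullet> \<gamma> t))) \<le> (M * M) * (20 * l / sqrt W)"
      by auto
    then show ?thesis by (simp add: norm_mult power2_eq_square)
  qed
  have "?I \<le> norm (complex_of_real (?I))" by simp
  also have "\<dots> \<le> (\<Sum>\<eta>\<in>S - J. \<Sum>\<xi>\<in>J. M\<^sup>2 * (20 * l / sqrt W))"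
    unfolding eq norm_minus_cancel by (intro sum_norm_le term_le)
  also have "\<dots> = real (card (S - J)) * real (card J) * (M\<^sup>2 * (20 * l / sqrt W))" by simp
  also have "\<dots> \<le> real (card S) * real (card S) * (M\<^sup>2 * (20 * l / sqrt W))"
    using S l W by (intro mult_right_mono mult_mono) (auto intro!: card_mono)
  finally show ?thesis by (simp add: f_def power2_eq_square mult_ac)
qed

lemma emeasure_superlevel_le_integral:
  fixes g :: "real \<Rightarrow> real"
  assumes g: "continuous_on {a..b} g" "\<And>t. t \<in> {a..b} \<Longrightarrow> 0 \<le> g t" and c: "c > 0"
  shows "emeasure lborel {t \<in> {a..b}. c \<le> g t} \<le> ennreal (integral {a..b} g / c)"
proof -
  let ?L = "{t \<in> {a..b}. c \<le> g t}"
  have cl: "closed ?L"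
    using continuous_closed_preimage[OF g(1) closed_real_atLeastAtMost closed_atLeast[of c]]
    by (simp add: vimage_def Int_def)
  have "ennreal c * emeasure lborel ?L = (\<integral>\<^sup>+t. ennreal c * indicator ?L t \<partial>lborel)"
    using cl by (intro nn_integral_cmult_indicator[symmetric]) (simp add: borel_closed)
  also have "\<dots> \<le> (\<integral>\<^sup>+t. ennreal (indicator {a..b} t * g t) \<partial>lborel)"
    by (intro nn_integral_mono) (auto simp: indicator_def intro: ennreal_leI)
  also have "\<dots> = ennreal (integral {a..b} g)"
    by (rule nn_integral_has_integral_lebesgue) (use g in \<open>auto intro!: integrable_integral integrable_continuous_real\<close>)
  finally have le: "ennreal c * emeasure lborel ?L \<le> ennreal (integral {a..b} g)" .
  have "integral {a..b} g \<ge> 0" by (intro integral_nonneg integrable_continuous_real g)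
  have "emeasure lborel ?L = ennreal (1 / c) * (ennreal c * emeasure lborel ?L)"
    using c by (simp add: mult.assoc[symmetric] ennreal_mult[symmetric])
  also have "\<dots> \<le> ennreal (1 / c) * ennreal (integral {a..b} g)" using le by (rule mult_left_mono) simp
  also have "\<dots> = ennreal (integral {a..b} g / c)"
    using c \<open>integral {a..b} g \<ge> 0\<close> by (simp add: ennreal_mult[symmetric])
  finally show ?thesis .
qed

section \<open>Projections and Hausdorff measure\<close>

lemma real_set_in_interval:
  fixes S :: "real set"
  assumes "S \<noteq> {}" and d: "\<And>x y. x \<in> S \<Longrightarrow> y \<in> S \<Longrightarrow> \<bar>x - y\<bar> \<le> d"
  obtains a b where "S \<subseteq> {a..b}" "b - a \<le> d" "a \<le> b"
proof -
  obtain s where s: "s \<in> S" using assms by auto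
  have le: "x \<le> y + d" if "x \<in> S" "y \<in> S" for x y using d[OF that] by linarith
  have bdd: "bdd_above S" "bdd_below S"
    using le[OF _ s] le[OF s] by (auto intro!: bdd_aboveI[of _ "s + d"] bdd_belowI[of _ "s - d"]) (smt (verit))
  have "Sup S \<le> Inf S + d"
  proof -
    have "Sup S - d \<le> y" if "y \<in> S" for y
      using cSup_least[of S "y + d"] le[OF _ that] assms(1) by force
    then have "Sup S - d \<le> Inf S" using assms(1) by (intro cInf_greatest) auto
    then show ?thesis by simp
  qed
  moreover have "S \<subseteq> {Inf S..Sup S}" using bdd by (auto intro: cInf_lower cSup_upper)
  moreover have "Inf S \<le> Sup S" using s calculation(2) by force
  ultimately show thesis using that[of "Inf S" "Sup S"] by simp
qed

text \<open>T is covered by short cells inside a neighbourhood of almost the same measure; g sends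
  the part of T in a cell into an interval no longer than the cell. This later compares the shadow
  of an arc with the time spent in a window.\<close>

lemma emeasure_lborel_contraction:
  fixes g :: "real \<Rightarrow> real"
  assumes T: "compact T" and Z: "Z \<subseteq> g ` T" "Z \<in> sets borel"
    and lip: "\<And>s t. s \<in> T \<Longrightarrow> t \<in> T \<Longrightarrow> \<bar>g s - g t\<bar> \<le> \<bar>s - t\<bar>"
  shows "emeasure lborel Z \<le> emeasure lborel T"
proof (rule ennreal_le_epsilon)
  fix e :: real assume e: "0 < e"
  have Tb: "T \<in> sets borel" using T by (simp add: borel_compact)
  obtain U where U: "open U" "T \<subseteq> U" "emeasure lborel (U - T) < e"
    using outer_regular_lborel[OF Tb e] by blast
  have "emeasure lborel U = emeasure lborel (T \<union> (U - T))" using U(2) by (simp add: Un_absorb1)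
  also have "\<dots> \<le> emeasure lborel T + emeasure lborel (U - T)"
    using Tb U(1) by (intro emeasure_subadditive) auto
  also have "\<dots> \<le> emeasure lborel T + ennreal e" using U(3) by (intro add_left_mono) (rule less_imp_le)
  finally have Ue: "emeasure lborel U \<le> emeasure lborel T + ennreal e" .
  \<comment> \<open>Cells shorter than the distance from the compact T to the complement of U stay
    in U once they meet T.\<close>
  obtain d where d: "d > 0" "\<And>t y. t \<in> T \<Longrightarrow> \<bar>t - y\<bar> < d \<Longrightarrow> y \<in> U"
  proof -
    have "T \<inter> - U = {}" using U(2) by auto
    then obtain d where "d > 0" "\<And>x y. x \<in> T \<Longrightarrow> y \<in> - U \<Longrightarrow> d \<le> dist x y"
      using separate_compact_closed[of T "- U"] T U(1) by (auto simp: closed_open)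
    then show thesis using that[of d] by (force simp: dist_real_def not_less[symmetric])
  qed
  define h where "h = d / 2"
  have h: "h > 0" "h < d" using d(1) by (auto simp: h_def)
  define K where "K j = {of_int j * h..<(of_int j + 1) * h}" for j :: int
  define J where "J = {j. K j \<inter> T \<noteq> {}}"
  have Kin: "t \<in> K \<lfloor>t / h\<rfloor>" for t
  proof -
    have "of_int \<lfloor>t / h\<rfloor> * h \<le> t" "t < (of_int \<lfloor>t / h\<rfloor> + 1) * h"
      using h floor_divide_lower[of h t] floor_divide_upper[of h t] by auto
    then show ?thesis by (simp add: K_def)
  qed
  have Kuniq: "j = \<lfloor>t / h\<rfloor>" if "t \<in> K j" for t j
    using that h by (intro floor_unique[symmetric]) (auto simp: K_def field_simps)
  have finJ: "finite J"
  proof -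
    obtain B where B: "\<And>t. t \<in> T \<Longrightarrow> \<bar>t\<bar> \<le> B"
      using compact_imp_bounded[OF T] by (auto simp: bounded_iff)
    have "J \<subseteq> {\<lfloor>- B / h\<rfloor>..\<lfloor>B / h\<rfloor>}"
    proof
      fix j assume "j \<in> J"
      then obtain t where t: "t \<in> K j" "t \<in> T" by (auto simp: J_def)
      have "- B \<le> t" "t \<le> B" using B[OF t(2)] by auto
      then have "- B / h \<le> t / h" "t / h \<le> B / h" using h by (intro divide_right_mono; simp)+
      then show "j \<in> {\<lfloor>- B / h\<rfloor>..\<lfloor>B / h\<rfloor>}" using Kuniq[OF t(1)] by (auto intro: floor_mono)
    qed
    then show ?thesis by (rule finite_subset) simp
  qed
  have "\<exists>a b. g ` (K j \<inter> T) \<subseteq> {a..b} \<and> b - a \<le> h \<and> a \<le> b" if "j \<in> J" for j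
  proof -
    have ne: "g ` (K j \<inter> T) \<noteq> {}" using that by (auto simp: J_def)
    have "\<bar>x - y\<bar> \<le> h" if xy: "x \<in> g ` (K j \<inter> T)" "y \<in> g ` (K j \<inter> T)" for x y
    proof -
      obtain s t where st: "s \<in> K j" "t \<in> K j" "s \<in> T" "t \<in> T" "x = g s" "y = g t"
        using xy by auto
      have "\<bar>s - t\<bar> \<le> h" using st(1,2) by (auto simp: K_def algebra_simps abs_le_iff)
      then show ?thesis using lip[OF st(3,4)] h st by auto
    qed
    from real_set_in_interval[OF ne this] show ?thesis by metis
  qed
  then obtain a b where ab: "\<And>j. j \<in> J \<Longrightarrow> g ` (K j \<inter> T) \<subseteq> {a j..b j} \<and> b j - a j \<le> h \<and> a j \<le> b j"
    by metis
  have "Z \<subseteq> (\<Union>j\<in>J. {a j..b j})"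
  proof
    fix z assume "z \<in> Z"
    then obtain t where t: "t \<in> T" "z = g t" using Z by auto
    have "\<lfloor>t / h\<rfloor> \<in> J" using Kin[of t] t by (auto simp: J_def)
    moreover have "z \<in> g ` (K \<lfloor>t / h\<rfloor> \<inter> T)" using Kin[of t] t by auto
    ultimately show "z \<in> (\<Union>j\<in>J. {a j..b j})" using ab by blast
  qed
  then have "emeasure lborel Z \<le> emeasure lborel (\<Union>j\<in>J. {a j..b j})"
    by (rule emeasure_mono) (use finJ in auto)
  also have "\<dots> \<le> (\<Sum>j\<in>J. emeasure lborel {a j..b j})"
    by (intro emeasure_subadditive_finite finJ) auto
  also have "\<dots> \<le> (\<Sum>j\<in>J. emeasure lborel (K j))"
  proof (rule sum_mono)
    fix j assume "j \<in> J"
    then show "emeasure lborel {a j..b j} \<le> emeasure lborel (K j)"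
      using ab[of j] h by (simp add: K_def algebra_simps ennreal_leI)
  qed
  also have "\<dots> = emeasure lborel (\<Union>j\<in>J. K j)"
  proof (rule sum_emeasure)
    show "disjoint_family_on K J"
      unfolding disjoint_family_on_def using Kuniq by blast
  qed (auto simp: K_def finJ)
  also have "\<dots> \<le> emeasure lborel U"
  proof (rule emeasure_mono)
    show "(\<Union>j\<in>J. K j) \<subseteq> U"
    proof (intro UN_least subsetI)
      fix j y assume j: "j \<in> J" and y: "y \<in> K j"
      obtain t where t: "t \<in> T" "t \<in> K j" using j by (auto simp: J_def)
      have "\<bar>t - y\<bar> \<le> h" using y t(2) by (auto simp: K_def algebra_simps abs_le_iff)
      then show "y \<in> U" using d(2)[OF t(1), of y] h by auto
    qed
  qed (use U in auto)
  finally show "emeasure lborel Z \<le> emeasure lborel T + ennreal e" using Ue by (rule order_trans)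
qed

text \<open>In a cover by sets of diameter below \<delta>, each set meets at most one of the
  separated pieces, and its trace there projects into an interval no longer than its diameter. Hence
  no diameter is counted twice.\<close>

lemma hausdorff_length_ge_projections:
  fixes h :: "'b \<Rightarrow> 'a::metric_space" and p :: "'k \<Rightarrow> 'b \<Rightarrow> real"
  assumes fin: "finite I" and \<delta>: "\<delta> > 0"
    and sep: "\<And>k l x y. k \<in> I \<Longrightarrow> l \<in> I \<Longrightarrow> k \<noteq> l \<Longrightarrow> x \<in> A k \<Longrightarrow> y \<in> A l \<Longrightarrow> dist (h x) (h y) \<ge> \<delta>"
    and lip: "\<And>k x y. k \<in> I \<Longrightarrow> x \<in> A k \<Longrightarrow> y \<in> A k \<Longrightarrow> \<bar>p k x - p k y\<bar> \<le> dist (h x) (h y)"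
    and sub: "\<And>k. k \<in> I \<Longrightarrow> h ` A k \<subseteq> M"
    and X: "\<And>k. k \<in> I \<Longrightarrow> X k \<in> sets borel" "\<And>k. k \<in> I \<Longrightarrow> X k \<subseteq> p k ` A k"
  shows "(\<Sum>k\<in>I. emeasure lborel (X k)) \<le> hausdorff_length M"
proof -
  have "(\<Sum>k\<in>I. emeasure lborel (X k)) \<le> (\<Sum>i. ennreal (diameter (U i)))"
    if cov: "M \<subseteq> (\<Union>i. U i)" and bd: "\<And>i. bounded (U i)" and dm: "\<And>i. diameter (U i) \<le> \<delta> / 2" for U :: "nat \<Rightarrow> 'a set"
  proof -
    define w where "w k i = (if h ` A k \<inter> U i \<noteq> {} then ennreal (diameter (U i)) else 0)" for k i
    have one: "k = l" if "k \<in> I" "l \<in> I" "h ` A k \<inter> U i \<noteq> {}" "h ` A l \<inter> U i \<noteq> {}" for k l i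
    proof (rule ccontr)
      assume "k \<noteq> l"
      obtain x y where xy: "x \<in> A k" "h x \<in> U i" "y \<in> A l" "h y \<in> U i" using \<open>h ` A k \<inter> U i \<noteq> {}\<close> \<open>h ` A l \<inter> U i \<noteq> {}\<close> by blast
      have "\<delta> \<le> dist (h x) (h y)" using sep[OF \<open>k \<in> I\<close> \<open>l \<in> I\<close> \<open>k \<noteq> l\<close> xy(1,3)] .
      also have "\<dots> \<le> diameter (U i)" using xy bd by (intro diameter_bounded_bound) auto
      also have "\<dots> \<le> \<delta> / 2" by (rule dm)
      finally show False using \<delta> by simp
    qed
    have Xw: "emeasure lborel (X k) \<le> (\<Sum>i. w k i)" if k: "k \<in> I" for k
    proof -
      have "\<exists>V. p k ` (A k \<inter> h -` U i) \<subseteq> V \<and> V \<in> sets borel \<and> emeasure lborel V \<le> w k i" for i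
      proof (cases "h ` A k \<inter> U i = {}")
        case True
        then show ?thesis by (intro exI[of _ "{}"]) auto
      next
        case False
        have "\<bar>x - y\<bar> \<le> diameter (U i)" if xy: "x \<in> p k ` (A k \<inter> h -` U i)" "y \<in> p k ` (A k \<inter> h -` U i)" for x y
        proof -
          obtain x' where x': "x' \<in> A k" "h x' \<in> U i" "x = p k x'" using xy(1) by blast
          obtain y' where y': "y' \<in> A k" "h y' \<in> U i" "y = p k y'" using xy(2) by blast
          note * = x'(1,2) y'(1,2) x'(3) y'(3)
          show ?thesis using lip[OF k *(1,3)] diameter_bounded_bound[OF bd *(2,4)] * by simp
        qed
        moreover have "p k ` (A k \<inter> h -` U i) \<noteq> {}" using False by auto
        ultimately obtain a b where ab: "p k ` (A k \<inter> h -` U i) \<subseteq> {a..b}" "b - a \<le> diameter (U i)" "a \<le> b"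
          using real_set_in_interval[of "p k ` (A k \<inter> h -` U i)" "diameter (U i)"] by metis
        then show ?thesis using False by (intro exI[of _ "{a..b}"]) (auto simp: w_def ennreal_leI)
      qed
      then obtain V where V: "\<And>i. p k ` (A k \<inter> h -` U i) \<subseteq> V i" "\<And>i. V i \<in> sets borel" "\<And>i. emeasure lborel (V i) \<le> w k i"
        by metis
      have "X k \<subseteq> (\<Union>i. V i)"
      proof
        fix z assume "z \<in> X k"
        then obtain x where x: "x \<in> A k" "z = p k x" using X(2)[OF k] by auto
        then obtain i where "h x \<in> U i" using sub[OF k] cov by blast
        then show "z \<in> (\<Union>i. V i)" using V(1)[of i] x by auto
      qed
      then have "emeasure lborel (X k) \<le> emeasure lborel (\<Union>i. V i)"
        using V by (intro emeasure_mono) auto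
      also have "\<dots> \<le> (\<Sum>i. emeasure lborel (V i))"
        using V by (intro emeasure_subadditive_countably) auto
      also have "\<dots> \<le> (\<Sum>i. w k i)" by (intro suminf_le V(3)) auto
      finally show ?thesis .
    qed
    have "(\<Sum>k\<in>I. emeasure lborel (X k)) \<le> (\<Sum>k\<in>I. \<Sum>i. w k i)" by (intro sum_mono Xw)
    also have "\<dots> = (\<Sum>i. \<Sum>k\<in>I. w k i)" by (rule suminf_sum[symmetric]) auto
    also have "\<dots> \<le> (\<Sum>i. ennreal (diameter (U i)))"
    proof (intro suminf_le)
      fix i
      show "(\<Sum>k\<in>I. w k i) \<le> ennreal (diameter (U i))"
      proof (cases "\<exists>k\<in>I. h ` A k \<inter> U i \<noteq> {}")
        case True
        then obtain k where k: "k \<in> I" "h ` A k \<inter> U i \<noteq> {}" by auto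
        have "(\<Sum>l\<in>I. w l i) = (\<Sum>l\<in>{k}. w l i)"
        proof (intro sum.mono_neutral_right fin ballI)
          fix l assume "l \<in> I - {k}"
          then show "w l i = 0" using one[of l k i] k by (auto simp: w_def)
        qed (use k in auto)
        then show ?thesis using k by (simp add: w_def)
      next
        case False
        then have "(\<Sum>l\<in>I. w l i) = 0" by (intro sum.neutral) (auto simp: w_def)
        then show ?thesis by simp
      qed
    qed auto
    finally show ?thesis .
  qed
  \<comment> \<open>The supremum over scales is bounded below by the single scale \<delta>/2,
    strictly below the separation.\<close>
  then show ?thesis
    unfolding hausdorff_length_def
    by (intro SUP_upper2[where i = "\<delta> / 2"] INF_greatest) (use \<delta> in auto)
qed

section \<open>Windows in the torus\<close>

lemma dist_torus_of: "dist (torus_of x) (torus_of y) = infdist (x - y) int_lattice"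
  by (rule dist_torus.abs_eq)

lemma dist_torus_of_ge:
  assumes "\<And>v. v \<in> int_lattice \<Longrightarrow> \<delta> \<le> norm (x - y - v)"
  shows "\<delta> \<le> dist (torus_of x) (torus_of y)"
proof -
  obtain v where "v \<in> int_lattice" "infdist (x - y) int_lattice = dist (x - y) v"
    using infdist_attains_inf[OF closed_int_lattice] int_lattice_0 by blast
  then show ?thesis using assms by (simp add: dist_torus_of dist_norm)
qed

lemma dist_torus_of_le: "dist (torus_of x) (torus_of y) \<le> norm (x - y)"
  using infdist_le[OF int_lattice_0, of "x - y"] by (simp add: dist_torus_of)

lemma continuous_on_torus_of: "continuous_on A torus_of"
  unfolding continuous_on_iff using dist_torus_of_le by (metis dist_norm le_less_trans)

text \<open>An integer shift cannot shorten a coordinate difference of at most 1/2. Coordinates are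
  therefore 1-Lipschitz for the torus distance on windows of side at most 1/2.\<close>

lemma component_diff_le_dist_torus:
  assumes "\<bar>x $ d - y $ d\<bar> \<le> 1 / 2"
  shows "\<bar>x $ d - y $ d\<bar> \<le> dist (torus_of x) (torus_of y)"
proof (rule dist_torus_of_ge)
  fix v assume "v \<in> int_lattice"
  then obtain n where n: "v $ d = of_int n" by (auto simp: int_lattice_def elim: Ints_cases)
  have "\<bar>x $ d - y $ d\<bar> \<le> \<bar>x $ d - y $ d - of_int n\<bar>"
  proof (cases "n = 0")
    case False
    then have "\<bar>real_of_int n\<bar> \<ge> 1" by linarith
    then show ?thesis using assms by linarith
  qed simp
  then show "\<bar>x $ d - y $ d\<bar> \<le> norm (x - y - v)"
    using component_le_norm_cart[of "x - y - v" d] n by simp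
qed

definition window :: "real^2 \<Rightarrow> real \<Rightarrow> (real^2) set" where
  "window c r = {w. \<forall>d. c $ d \<le> w $ d \<and> w $ d \<le> c $ d + r}"

lemma compact_window: "compact (window c r)"
proof -
  have "window c r = cbox c (\<chi> d. c $ d + r)" by (auto simp: window_def mem_box_cart)
  then show ?thesis by simp
qed

lemma window_component_diff: "w \<in> window c r \<Longrightarrow> w' \<in> window c r \<Longrightarrow> \<bar>w $ d - w' $ d\<bar> \<le> r"
  unfolding window_def by (smt (verit) mem_Collect_eq)

lemma norm_diff_window_le:
  assumes "w \<in> window c r"
  shows "norm (w - c) \<le> 2 * r"
proof -
  have "\<bar>(w - c) $ d\<bar> \<le> r" for d using assms by (auto simp: window_def abs_le_iff algebra_simps)
  then have "(\<Sum>d\<in>UNIV. \<bar>(w - c) $ d\<bar>) \<le> 2 * r" using sum_bounded_above[of "UNIV :: 2 set" "\<lambda>d. \<bar>(w - c) $ d\<bar>" r] by simp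
  then show ?thesis using norm_le_l1_cart[of "w - c"] by simp
qed

text \<open>Modulo 1, two distinct grid corners differ by at least 1/n in some coordinate, since i -
  j is not a multiple of n; the extent of the windows costs at most r.\<close>

lemma dist_torus_distinct_windows:
  assumes z: "z \<in> grid n" "z' \<in> grid n" "z \<noteq> z'"
    and w: "w \<in> window (grid_point n z) r" "w' \<in> window (grid_point n z') r"
  shows "1 / real n - r \<le> dist (torus_of w) (torus_of w')"
proof (rule dist_torus_of_ge)
  fix v assume v: "v \<in> int_lattice"
  have n: "n > 0" using z by auto
  have *: "1 / real n - r \<le> \<bar>x - x' - v $ d\<bar>"
    if ij: "i < n" "j < n" "i \<noteq> j" and x: "real i / real n \<le> x" "x \<le> real i / real n + r"
      "real j / real n \<le> x'" "x' \<le> real j / real n + r" for i j x x' d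
  proof -
    obtain m where m: "v $ d = of_int m" using v by (auto simp: int_lattice_def elim: Ints_cases)
    define k where "k = int i - int j - m * int n"
    have "k \<noteq> 0"
    proof
      assume "k = 0"
      then have eq: "int i - int j = m * int n" by (simp add: k_def)
      have "m = 0"
      proof (rule ccontr)
        assume "m \<noteq> 0"
        then have "1 * int n \<le> \<bar>m\<bar> * int n" by (intro mult_right_mono) auto
        also have "\<dots> = \<bar>int i - int j\<bar>" unfolding eq by (simp add: abs_mult)
        also have "\<dots> < int n" using ij by linarith
        finally show False by simp
      qed
      then show False using eq ij by simp
    qed
    then have "1 \<le> \<bar>real_of_int k\<bar>" by linarith
    then have "1 / real n \<le> \<bar>real_of_int k / real n\<bar>" using n by (simp add: divide_right_mono)
    also have "real_of_int k / real n = real i / real n - real j / real n - of_int m"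
      using n by (simp add: k_def field_simps)
    finally show ?thesis using x m by linarith
  qed
  have "\<exists>d. 1 / real n - r \<le> \<bar>(w - w' - v) $ d\<bar>"
  proof (cases "fst z = fst z'")
    case False
    have "1 / real n - r \<le> \<bar>w $ 1 - w' $ 1 - v $ 1\<bar>"
      by (rule *[of "fst z" "fst z'"]) (use z w False in \<open>auto simp: window_def forall_2\<close>)
    then show ?thesis by (intro exI[of _ 1]) simp
  next
    case True
    then have "snd z \<noteq> snd z'" using z(3) by (simp add: prod_eq_iff)
    then have "1 / real n - r \<le> \<bar>w $ 2 - w' $ 2 - v $ 2\<bar>"
      by (intro *[of "snd z" "snd z'"]) (use z w in \<open>auto simp: window_def forall_2\<close>)
    then show ?thesis by (intro exI[of _ 2]) simp
  qed
  then show "1 / real n - r \<le> norm (w - w' - v)" using component_le_norm_cart order_trans by metis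
qed

lemma toral_eigenfunction_expansion:
  assumes "toral_eigenfunction E \<phi>"
  obtains a \<xi>\<^sub>0 where "\<xi>\<^sub>0 \<in> freqs E" "a \<xi>\<^sub>0 \<noteq> 0" "\<And>x. of_real (\<phi> (torus_of x)) = trig_sum a (freqs E) x"
proof -
  obtain p a where p: "\<phi> p \<noteq> 0"
    and rep: "\<And>x. complex_of_real (\<phi> (torus_of x)) = trig_sum a (freqs E) x"
    using assms unfolding toral_eigenfunction_def ee_def by blast
  have "\<exists>x. p = torus_of x" by (induct p rule: torus.abs_induct) blast
  then obtain x where "p = torus_of x" by blast
  then have "trig_sum a (freqs E) x \<noteq> 0" using rep[of x] p by auto
  then obtain \<xi>\<^sub>0 where "\<xi>\<^sub>0 \<in> freqs E" "a \<xi>\<^sub>0 \<noteq> 0" by (metis (no_types, lifting) mult_eq_0_iff sum.neutral)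
  then show thesis using that rep by blast
qed

text \<open>The integer part of lam/2 serves as the number n of grid points per side. The upper
  bound keeps the spacing 1/n above the window side sqrt 2 / lam; the lower bound keeps n above
  cluster differences and makes the grid of order lam^2.\<close>

lemma nat_floor_half_bounds:
  assumes "lam \<ge> (4::real)"
  shows "nat \<lfloor>lam / 2\<rfloor> > 0" "real (nat \<lfloor>lam / 2\<rfloor>) \<ge> lam / 4" "real (nat \<lfloor>lam / 2\<rfloor>) \<le> lam / 2"
proof -
  have eq: "real (nat \<lfloor>lam / 2\<rfloor>) = of_int \<lfloor>lam / 2\<rfloor>" using assms by simp
  show "real (nat \<lfloor>lam / 2\<rfloor>) \<ge> lam / 4" "real (nat \<lfloor>lam / 2\<rfloor>) \<le> lam / 2"
    unfolding eq using assms by linarith+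
  show "nat \<lfloor>lam / 2\<rfloor> > 0" using assms by linarith
qed

section \<open>Windows where the cluster sum is large\<close>

text \<open>\<sigma> is the l2 norm of the coefficients of the cluster. The moment bounds give
  modulus at least \<sigma>/2 at a fixed proportion of the grid points, and the slow variation of
  the modulus loses at most \<sigma>/4 across a window.\<close>

lemma exists_good_windows:
  fixes a :: "real^2 \<Rightarrow> complex" and lam D r :: real
  defines "S \<equiv> freqs (lam\<^sup>2)" and "n \<equiv> nat \<lfloor>lam / 2\<rfloor>"
  assumes lam: "lam \<ge> 4" and \<xi>0: "\<xi>\<^sub>0 \<in> S" "a \<xi>\<^sub>0 \<noteq> 0" and D: "D > 0" and ND: "real (card S) ^ 3 * D \<le> lam / 80"
    and r: "0 \<le> r" "r \<le> 3 / (2 * lam)"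
  obtains J \<sigma> A where "J \<subseteq> S" "\<sigma> > 0" "\<And>\<xi>. \<xi> \<in> S \<Longrightarrow> norm (a \<xi>) \<le> \<sigma>"
    "\<And>\<xi> \<eta>. \<xi> \<in> J \<Longrightarrow> \<eta> \<in> S - J \<Longrightarrow> D \<le> norm (\<eta> - \<xi>)"
    "A \<subseteq> grid n" "9 * (real n)\<^sup>2 \<le> 32 * real (card A)"
    "\<And>z w. z \<in> A \<Longrightarrow> w \<in> window (grid_point n z) r \<Longrightarrow> \<sigma> / 4 \<le> norm (trig_sum a J w)"
proof -
  have fin: "finite S" by (simp add: S_def finite_freqs)
  define N where "N = card S"
  have N: "real N \<ge> 1" using fin \<xi>0 by (simp add: N_def Suc_le_eq card_gt_0_iff) blast
  have "Max ((\<lambda>\<xi>. norm (a \<xi>)) ` S) \<in> (\<lambda>\<xi>. norm (a \<xi>)) ` S" using fin \<xi>0 by (intro Max_in) auto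
  then obtain \<xi>m where \<xi>m: "\<xi>m \<in> S" "Max ((\<lambda>\<xi>. norm (a \<xi>)) ` S) = norm (a \<xi>m)" by auto
  define M where "M = norm (a \<xi>m)"
  have M: "norm (a \<xi>) \<le> M" if "\<xi> \<in> S" for \<xi>
    unfolding M_def \<xi>m(2)[symmetric] using fin that by (intro Max_ge) auto
  have Mpos: "M > 0" using M[OF \<xi>0(1)] \<xi>0(2) by (metis less_le_trans zero_less_norm_iff)
  obtain J where J: "J \<subseteq> S" "\<xi>m \<in> J" "\<And>\<xi>. \<xi> \<in> J \<Longrightarrow> norm (\<xi> - \<xi>m) \<le> (real N)\<^sup>2 * D"
      "\<And>\<xi> \<eta>. \<xi> \<in> J \<Longrightarrow> \<eta> \<in> S - J \<Longrightarrow> norm (\<eta> - \<xi>) > D"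
    using frequency_cluster[OF fin less_imp_le[OF D] \<xi>m(1)] unfolding N_def by blast
  have finJ: "finite J" using J(1) fin finite_subset by blast
  define f where "f w = trig_sum a J w" for w
  define \<sigma> where "\<sigma> = sqrt (\<Sum>\<xi>\<in>J. (norm (a \<xi>))\<^sup>2)"
  have \<sigma>2: "\<sigma>\<^sup>2 = (\<Sum>\<xi>\<in>J. (norm (a \<xi>))\<^sup>2)" by (simp add: \<sigma>_def sum_nonneg)
  \<comment> \<open>The maximal coefficient belongs to the cluster; this makes \<sigma> dominate all
    coefficients, including those outside \<open>J\<close>.\<close>
  have "M\<^sup>2 \<le> \<sigma>\<^sup>2"
    unfolding \<sigma>2 M_def using member_le_sum[of \<xi>m J "\<lambda>\<xi>. (norm (a \<xi>))\<^sup>2"] J(2) finJ by simp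
  then have M\<sigma>: "M \<le> \<sigma>" by (rule power2_le_imp_le) (simp add: \<sigma>_def sum_nonneg)
  have \<sigma>: "\<sigma> > 0" using M\<sigma> Mpos by simp
  note n = nat_floor_half_bounds[OF lam, folded n_def]
  have N2: "(real N)\<^sup>2 * D \<le> lam / 80"
  proof -
    have "(real N)\<^sup>2 * D * 1 \<le> (real N)\<^sup>2 * D * real N" using N D by (intro mult_left_mono) auto
    then show ?thesis using ND by (simp add: N_def power2_eq_square power3_eq_cube mult_ac)
  qed
  define u where "u z = (norm (f (grid_point n z)))\<^sup>2" for z
  have diam: "norm (\<xi> - \<eta>) < real n / 2" if "\<xi> \<in> J" "\<eta> \<in> J" for \<xi> \<eta>
  proof -
    have "norm (\<xi> - \<eta>) \<le> norm (\<xi> - \<xi>m) + norm (\<eta> - \<xi>m)"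
      using norm_triangle_ineq4[of "\<xi> - \<xi>m" "\<eta> - \<xi>m"] by simp
    also have "\<dots> \<le> lam / 80 + lam / 80" using J(3)[OF that(1)] J(3)[OF that(2)] N2 by linarith
    finally show ?thesis using n(2) lam by linarith
  qed
  have nE: "real n / 2 \<le> 2 * sqrt (lam\<^sup>2)" using n(3) lam by simp
  note mom = grid_fourth_moment[of n J "lam\<^sup>2" a, OF n(1) J(1)[unfolded S_def] nE diam, folded \<sigma>2]
  define A where "A = {z \<in> grid n. u z \<ge> \<sigma>\<^sup>2 / 4}"
  have cardG: "real (card (grid n)) = (real n)\<^sup>2" by (simp add: card_cartesian_product power2_eq_square)
  have cA: "9 * (real n)\<^sup>2 \<le> 32 * real (card A)"
  proof -
    have "9 * real (card (grid n)) \<le> 32 * real (card {z \<in> grid n. u z \<ge> \<sigma>\<^sup>2 / 4})"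
    proof (rule finite_paley_zygmund)
      show "(\<Sum>z\<in>grid n. u z) = real (card (grid n)) * \<sigma>\<^sup>2"
        unfolding cardG u_def f_def by (rule mom(1))
      show "(\<Sum>z\<in>grid n. (u z)\<^sup>2) \<le> 2 * real (card (grid n)) * (\<sigma>\<^sup>2)\<^sup>2"
        unfolding cardG u_def f_def by (rule mom(2))
    qed (use \<sigma> in \<open>auto simp: u_def\<close>)
    then show ?thesis unfolding cardG A_def .
  qed
  have big: "\<sigma> / 4 \<le> norm (f w)" if z: "z \<in> A" and w: "w \<in> window (grid_point n z) r" for z w
  proof -
    have "(\<sigma> / 2)\<^sup>2 \<le> (norm (f (grid_point n z)))\<^sup>2" using z by (simp add: A_def u_def power_divide)
    then have "\<sigma> / 2 \<le> norm (f (grid_point n z))" by (rule power2_le_imp_le) simp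
    also have "\<dots> \<le> norm (f w) + 2 * pi * ((real N)\<^sup>2 * D) * norm (grid_point n z - w) * (\<Sum>\<xi>\<in>J. norm (a \<xi>))"
      unfolding f_def by (rule cluster_modulus_variation[OF J(3)])
    \<comment> \<open>A point of a window lies within 3/lam of its corner, and 6.6 * 3 / 80 = 0.2475
      is just below 1/4; this fixes the 80 in the hypothesis.\<close>
    also have "2 * pi * ((real N)\<^sup>2 * D) * norm (grid_point n z - w) * (\<Sum>\<xi>\<in>J. norm (a \<xi>))
       \<le> 6.6 * ((real N)\<^sup>2 * D) * (3 / lam) * (real N * \<sigma>)"
    proof (intro mult_mono)
      have "norm (grid_point n z - w) \<le> 2 * r" using norm_diff_window_le[OF w] by (simp add: norm_minus_commute)
      also have "\<dots> \<le> 3 / lam" using r(2) lam by (simp add: field_simps)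
      finally show "norm (grid_point n z - w) \<le> 3 / lam" .
      have "(\<Sum>\<xi>\<in>J. norm (a \<xi>)) \<le> (\<Sum>\<xi>\<in>J. \<sigma>)" using M M\<sigma> J(1) by (intro sum_mono) force
      also have "\<dots> \<le> real N * \<sigma>" using \<sigma> J(1) fin by (auto simp: N_def intro!: mult_right_mono card_mono)
      finally show "(\<Sum>\<xi>\<in>J. norm (a \<xi>)) \<le> real N * \<sigma>" .
      show "2 * pi \<le> 6.6" using pi_approx by simp
    qed (use D lam in \<open>auto intro: sum_nonneg\<close>)
    also have "6.6 * ((real N)\<^sup>2 * D) * (3 / lam) * (real N * \<sigma>) = (19.8 / lam * \<sigma>) * (real N ^ 3 * D)"
      by (simp add: power2_eq_square power3_eq_cube)
    also have "\<dots> \<le> (19.8 / lam * \<sigma>) * (lam / 80)"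
      using ND \<sigma> lam by (intro mult_left_mono) (auto simp: N_def)
    also have "\<dots> \<le> \<sigma> / 4" using \<sigma> lam by simp
    finally show ?thesis by simp
  qed
  show thesis
  proof (rule that[of J \<sigma> A])
    show "norm (a \<xi>) \<le> \<sigma>" if "\<xi> \<in> S" for \<xi> using M[OF that] M\<sigma> by linarith
    show "D \<le> norm (\<eta> - \<xi>)" if "\<xi> \<in> J" "\<eta> \<in> S - J" for \<xi> \<eta> using J(4)[OF that] by simp
    show "\<sigma> / 4 \<le> norm (trig_sum a J w)" if "z \<in> A" "w \<in> window (grid_point n z) r" for z w
      using big[OF that] by (simp add: f_def)
  qed (use J \<sigma> cA in \<open>auto simp: A_def\<close>)
qed

text \<open>Chebyshev's inequality at level (\<sigma>/4)^2 for the mean square along the arc; 320 =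
  16 * 20, and \<sigma> cancels because it bounds all coefficients.\<close>

lemma (in curved_arc) emeasure_arc_in_good_region:
  fixes a :: "real^2 \<Rightarrow> complex"
  assumes S: "finite S" "J \<subseteq> S" and \<sigma>: "\<sigma> > 0" and M: "\<And>\<xi>. \<xi> \<in> S \<Longrightarrow> norm (a \<xi>) \<le> \<sigma>"
    and zero: "\<And>t. t \<in> {0..l} \<Longrightarrow> trig_sum a S (\<gamma> t) = 0"
    and sep: "\<And>\<xi> \<eta>. \<xi> \<in> J \<Longrightarrow> \<eta> \<in> S - J \<Longrightarrow> D \<le> norm (\<eta> - \<xi>)" and D: "0 \<le> D"
    and W: "1 \<le> W" "W \<le> \<kappa> * l\<^sup>2 * D"
  shows "emeasure lborel {t \<in> {0..l}. (\<sigma> / 4)\<^sup>2 \<le> (norm (trig_sum a J (\<gamma> t)))\<^sup>2}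
    \<le> ennreal (320 * (real (card S))\<^sup>2 / sqrt W * l)"
proof -
  define g where "g t = (norm (trig_sum a J (\<gamma> t)))\<^sup>2" for t
  have cg: "continuous_on {0..l} g"
    unfolding g_def by (intro continuous_intros continuous_on_arc)
  have "emeasure lborel {t \<in> {0..l}. (\<sigma> / 4)\<^sup>2 \<le> g t} \<le> ennreal (integral {0..l} g / (\<sigma> / 4)\<^sup>2)"
    by (rule emeasure_superlevel_le_integral[OF cg]) (use \<sigma> in \<open>auto simp: g_def\<close>)
  also have "\<dots> \<le> ennreal ((real (card S))\<^sup>2 * \<sigma>\<^sup>2 * (20 * l / sqrt W) / (\<sigma> / 4)\<^sup>2)"
    unfolding g_def
    by (intro ennreal_leI divide_right_mono cluster_mean_square_on_nodal_arc[OF S M zero sep D W]) auto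
  also have "(real (card S))\<^sup>2 * \<sigma>\<^sup>2 * (20 * l / sqrt W) / (\<sigma> / 4)\<^sup>2 = 320 * (real (card S))\<^sup>2 / sqrt W * l"
    using \<sigma> by (simp add: power_divide)
  finally show ?thesis unfolding g_def .
qed

text \<open>A window of side at most 1/2 contains at most one representative of a torus point, so
  its coordinate is a function of the arc parameter. That function is 1-Lipschitz on the times spent
  in the window.\<close>

lemma emeasure_arc_projection_le:
  fixes \<gamma> :: "real \<Rightarrow> real^2"
  assumes lip: "\<And>s t. s \<in> {0..l} \<Longrightarrow> t \<in> {0..l} \<Longrightarrow> norm (\<gamma> t - \<gamma> s) \<le> \<bar>t - s\<bar>"
    and r: "r \<le> 1 / 2" and C: "C = torus_of ` \<gamma> ` {0..l}"
  shows "compact {w \<in> window c r. torus_of w \<in> C}"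
    and "compact {t \<in> {0..l}. torus_of (\<gamma> t) \<in> torus_of ` window c r}"
    and "emeasure lborel ((\<lambda>w. w $ d) ` {w \<in> window c r. torus_of w \<in> C})
    \<le> emeasure lborel {t \<in> {0..l}. torus_of (\<gamma> t) \<in> torus_of ` window c r}"
proof -
  let ?T = "{t \<in> {0..l}. torus_of (\<gamma> t) \<in> torus_of ` window c r}"
  let ?Z = "{w \<in> window c r. torus_of w \<in> C}"
  have c\<gamma>: "continuous_on {0..l} \<gamma>"
    unfolding continuous_on_iff using lip by (metis dist_norm dist_real_def le_less_trans)
  have c\<tau>: "continuous_on {0..l} (\<lambda>t. torus_of (\<gamma> t))"
    using continuous_on_compose2[OF continuous_on_torus_of[of UNIV] c\<gamma>] by simp
  have "compact C" unfolding C image_image by (intro compact_continuous_image c\<tau> compact_Icc)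
  then have "closed (torus_of -` C)"
    using continuous_on_torus_of[of UNIV] by (simp add: continuous_on_closed_vimage compact_imp_closed)
  then have "compact (window c r \<inter> torus_of -` C)" by (rule compact_Int_closed[OF compact_window])
  then show cA: "compact ?Z" by (simp add: Int_def vimage_def)
  have "compact (torus_of ` window c r)" by (intro compact_continuous_image continuous_on_torus_of compact_window)
  then have "closed ({0..l} \<inter> (\<lambda>t. torus_of (\<gamma> t)) -` torus_of ` window c r)"
    by (intro continuous_closed_preimage[OF c\<tau>] compact_imp_closed) auto
  then have "compact ({0..l} \<inter> ({0..l} \<inter> (\<lambda>t. torus_of (\<gamma> t)) -` torus_of ` window c r))"
    by (intro compact_Int_closed) auto
  moreover have "{0..l} \<inter> ({0..l} \<inter> (\<lambda>t. torus_of (\<gamma> t)) -` torus_of ` window c r) = ?T"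
    by auto
  ultimately show cT: "compact ?T"
    by simp
  have "\<exists>w. w \<in> window c r \<and> torus_of w = torus_of (\<gamma> t)" if "t \<in> ?T" for t
    using that by auto
  then obtain g where g: "\<And>t. t \<in> ?T \<Longrightarrow> g t \<in> window c r \<and> torus_of (g t) = torus_of (\<gamma> t)"
    by metis
  have uniq: "w $ d = w' $ d" if "w \<in> window c r" "w' \<in> window c r" "torus_of w = torus_of w'" for w w'
    using component_diff_le_dist_torus[of w d w'] window_component_diff[OF that(1,2), of d] r that(3) by simp
  show "emeasure lborel ((\<lambda>w. w $ d) ` ?Z)
    \<le> emeasure lborel ?T"
  proof (rule emeasure_lborel_contraction[OF cT, where g = "\<lambda>t. g t $ d"])
    show "(\<lambda>w. w $ d) ` ?Z \<in> sets borel"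
      by (intro borel_compact compact_continuous_image cA continuous_intros)
    show "(\<lambda>w. w $ d) ` ?Z \<subseteq> (\<lambda>t. g t $ d) ` ?T"
    proof (rule image_subsetI)
      fix w assume w: "w \<in> ?Z"
      then obtain t where t: "t \<in> {0..l}" "torus_of w = torus_of (\<gamma> t)" by (auto simp: C)
      then have tT: "t \<in> ?T" using w by (auto intro: rev_image_eqI)
      have "w $ d = g t $ d" using uniq[of w "g t"] g[OF tT] w t(2) by simp
      then show "w $ d \<in> (\<lambda>t. g t $ d) ` ?T" using tT by blast
    qed
    fix s t assume s: "s \<in> ?T"
      and t: "t \<in> ?T"
    have "\<bar>g s $ d - g t $ d\<bar> \<le> 1 / 2" using window_component_diff[of "g s" c r "g t" d] g[OF s] g[OF t] r by linarith
    then have "\<bar>g s $ d - g t $ d\<bar> \<le> dist (torus_of (\<gamma> s)) (torus_of (\<gamma> t))"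
      using component_diff_le_dist_torus[of "g s" d "g t"] g[OF s] g[OF t] by simp
    also have "\<dots> \<le> norm (\<gamma> s - \<gamma> t)" by (rule dist_torus_of_le)
    also have "\<dots> \<le> \<bar>s - t\<bar>" using lip[of t s] s t by simp
    finally show "\<bar>g s $ d - g t $ d\<bar> \<le> \<bar>s - t\<bar>" .
  qed
qed

lemma trig_sum_periodic:
  assumes "torus_of w = torus_of w'" "J \<subseteq> int_lattice"
  shows "trig_sum a J w = trig_sum a J w'"
proof (intro sum.cong refl arg_cong2[where f = "(*)"])
  fix \<xi> assume "\<xi> \<in> J"
  then have "ee ((w - w') \<bullet> \<xi>) = 1" using assms by (intro ee_lattice) (auto simp: torus_of_eq_iff)
  then show "ee (w \<bullet> \<xi>) = ee (w' \<bullet> \<xi>)" by (simp add: inner_diff_left ee_diff)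
qed

text \<open>In each window the projection of \<open>N\<close> is covered by \<open>Y\<close>, which
  comes from \<open>N\<close> off the arcs, and the shadows \<open>Z\<close> of the arcs. A shadow
  is at most the time its arc spends in the window; the windows are disjoint, so these times add up
  to at most the measure of \<open>T C\<close>.\<close>

lemma hausdorff_length_complement_ge:
  fixes N :: "torus set" and \<gamma> :: "torus set \<Rightarrow> real \<Rightarrow> real^2" and l :: "torus set \<Rightarrow> real"
  assumes r: "r \<le> 1 / 2" "r < 1 / real n" and A: "A \<subseteq> grid n"
    and wind: "\<And>z. z \<in> A \<Longrightarrow> compact {w \<in> window (grid_point n z) r. torus_of w \<in> N}"
      "\<And>z. z \<in> A \<Longrightarrow> \<exists>d. ennreal h \<le> emeasure lborel ((\<lambda>w. w $ d) ` {w \<in> window (grid_point n z) r. torus_of w \<in> N})"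
    and fin: "finite \<C>" and lip: "\<And>C s t. C \<in> \<C> \<Longrightarrow> s \<in> {0..l C} \<Longrightarrow> t \<in> {0..l C} \<Longrightarrow> norm (\<gamma> C t - \<gamma> C s) \<le> \<bar>t - s\<bar>"
    and img: "\<And>C. C \<in> \<C> \<Longrightarrow> C = torus_of ` \<gamma> C ` {0..l C}"
    and T: "\<And>C. C \<in> \<C> \<Longrightarrow> T C \<in> sets borel"
      "\<And>C z t. C \<in> \<C> \<Longrightarrow> z \<in> A \<Longrightarrow> t \<in> {0..l C} \<Longrightarrow> torus_of (\<gamma> C t) \<in> torus_of ` window (grid_point n z) r \<Longrightarrow> t \<in> T C"
  shows "of_nat (card A) * ennreal h \<le> hausdorff_length (N - \<Union>\<C>) + (\<Sum>C\<in>\<C>. emeasure lborel (T C))"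
proof -
  have finA: "finite A" using A finite_subset by blast
  define Q where "Q z = window (grid_point n z) r" for z
  have "\<forall>z\<in>A. \<exists>d. ennreal h \<le> emeasure lborel ((\<lambda>w. w $ d) ` {w \<in> Q z. torus_of w \<in> N})"
    unfolding Q_def by (intro ballI wind(2))
  from bchoice[OF this] obtain d
    where d: "\<And>z. z \<in> A \<Longrightarrow> ennreal h \<le> emeasure lborel ((\<lambda>w. w $ d z) ` {w \<in> Q z. torus_of w \<in> N})"
    by auto
  define X where "X z = (\<lambda>w. w $ d z) ` {w \<in> Q z. torus_of w \<in> N}" for z
  define Z where "Z C z = (\<lambda>w. w $ d z) ` {w \<in> Q z. torus_of w \<in> C}" for C z
  define P where "P C z = {t \<in> {0..l C}. torus_of (\<gamma> C t) \<in> torus_of ` Q z}" for C z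
  have P: "P C z \<in> sets borel" if "C \<in> \<C>" for C z
    using emeasure_arc_projection_le(2)[OF lip[OF that] r(1) img[OF that]] unfolding P_def Q_def by (rule borel_compact)
  have ZP: "emeasure lborel (Z C z) \<le> emeasure lborel (P C z)" if "C \<in> \<C>" for C z
    using emeasure_arc_projection_le(3)[OF lip[OF that] r(1) img[OF that]] unfolding P_def Q_def Z_def .
  have Zm: "Z C z \<in> sets borel" if "C \<in> \<C>" for C z
    unfolding Z_def Q_def
    by (intro borel_compact compact_continuous_image emeasure_arc_projection_le(1)[OF lip[OF that] r(1) img[OF that]] continuous_intros)
  have Xm: "X z \<in> sets borel" if "z \<in> A" for z
    unfolding X_def Q_def by (intro borel_compact compact_continuous_image wind(1)[OF that] continuous_intros)
  \<comment> \<open>The whole shadow is discarded, so every zero in the window projecting into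
    \<open>Y z\<close> lies off the arcs.\<close>
  define Y where "Y z = X z - (\<Union>C\<in>\<C>. Z C z)" for z
  have Ym: "Y z \<in> sets borel" if "z \<in> A" for z
    unfolding Y_def using Xm[OF that] Zm fin by (intro sets.Diff sets.finite_UN) auto
  define B where "B z = {w \<in> Q z. torus_of w \<in> N - \<Union>\<C>}" for z
  have H: "(\<Sum>z\<in>A. emeasure lborel (Y z)) \<le> hausdorff_length (N - \<Union>\<C>)"
  proof (rule hausdorff_length_ge_projections[where h = torus_of and p = "\<lambda>z w. w $ d z" and A = B and \<delta> = "1 / real n - r"])
    show "1 / real n - r \<le> dist (torus_of x) (torus_of y)" if "k \<in> A" "k' \<in> A" "k \<noteq> k'" "x \<in> B k" "y \<in> B k'" for k k' x y
      using that A by (intro dist_torus_distinct_windows[of k n k']) (auto simp: B_def Q_def)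
    show "\<bar>x $ d k - y $ d k\<bar> \<le> dist (torus_of x) (torus_of y)" if "x \<in> B k" "y \<in> B k" for k x y
      using that window_component_diff[of x "grid_point n k" r y "d k"] r(1)
      by (intro component_diff_le_dist_torus) (auto simp: B_def Q_def)
    show "Y z \<subseteq> (\<lambda>w. w $ d z) ` B z" for z
    proof
      fix u assume u: "u \<in> Y z"
      then obtain w where w: "w \<in> Q z" "torus_of w \<in> N" "u = w $ d z" by (auto simp: Y_def X_def)
      have "torus_of w \<notin> \<Union>\<C>"
      proof
        assume "torus_of w \<in> \<Union>\<C>"
        then obtain C where "C \<in> \<C>" "torus_of w \<in> C" by blast
        then have "u \<in> Z C z" using w by (auto simp: Z_def)
        then show False using u \<open>C \<in> \<C>\<close> by (auto simp: Y_def)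
      qed
      then show "u \<in> (\<lambda>w. w $ d z) ` B z" using w by (auto simp: B_def)
    qed
  qed (use finA r Ym in \<open>auto simp: B_def\<close>)
  have XY: "emeasure lborel (X z) \<le> emeasure lborel (Y z) + (\<Sum>C\<in>\<C>. emeasure lborel (P C z))" if z: "z \<in> A" for z
  proof -
    have UZ: "(\<Union>C\<in>\<C>. Z C z) \<in> sets borel" by (rule sets.finite_UN[OF fin Zm])
    have "emeasure lborel (X z) \<le> emeasure lborel (Y z \<union> (\<Union>C\<in>\<C>. Z C z))"
    proof (rule emeasure_mono)
      show "X z \<subseteq> Y z \<union> (\<Union>C\<in>\<C>. Z C z)" by (auto simp: Y_def)
      show "Y z \<union> (\<Union>C\<in>\<C>. Z C z) \<in> sets lborel" using Ym[OF z] UZ by simp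
    qed
    also have "\<dots> \<le> emeasure lborel (Y z) + emeasure lborel (\<Union>C\<in>\<C>. Z C z)"
      using Ym[OF z] UZ by (intro emeasure_subadditive) simp_all
    also have "emeasure lborel (\<Union>C\<in>\<C>. Z C z) \<le> (\<Sum>C\<in>\<C>. emeasure lborel (Z C z))"
      by (intro emeasure_subadditive_finite fin) (auto intro!: Zm)
    also have "\<dots> \<le> (\<Sum>C\<in>\<C>. emeasure lborel (P C z))" by (intro sum_mono ZP)
    finally show ?thesis by (simp add: add_left_mono)
  qed
  have PT: "(\<Sum>z\<in>A. emeasure lborel (P C z)) \<le> emeasure lborel (T C)" if C: "C \<in> \<C>" for C
  proof -
    have "disjoint_family_on (P C) A"
      unfolding disjoint_family_on_def
    proof (intro ballI impI, rule ccontr)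
      fix z z' assume z: "z \<in> A" "z' \<in> A" "z \<noteq> z'" "P C z \<inter> P C z' \<noteq> {}"
      then obtain t where "t \<in> P C z" "t \<in> P C z'" by blast
      then obtain w w' where w: "w \<in> Q z" "w' \<in> Q z'" "torus_of w = torus_of w'" by (auto simp: P_def)
      then have "1 / real n - r \<le> dist (torus_of w) (torus_of w')"
        using z A unfolding Q_def by (intro dist_torus_distinct_windows[of z n z']) auto
      then show False using w(3) r(2) by simp
    qed
    then have "(\<Sum>z\<in>A. emeasure lborel (P C z)) = emeasure lborel (\<Union>z\<in>A. P C z)"
      using P[OF C] finA by (intro sum_emeasure) auto
    also have "\<dots> \<le> emeasure lborel (T C)"
      using T C by (intro emeasure_mono) (auto simp: P_def Q_def)
    finally show ?thesis .
  qed
  have "of_nat (card A) * ennreal h = (\<Sum>z\<in>A. ennreal h)" by simp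
  also have "\<dots> \<le> (\<Sum>z\<in>A. emeasure lborel (Y z) + (\<Sum>C\<in>\<C>. emeasure lborel (P C z)))"
    using d XY unfolding X_def[symmetric] by (intro sum_mono) (metis order_trans)
  also have "\<dots> = (\<Sum>z\<in>A. emeasure lborel (Y z)) + (\<Sum>C\<in>\<C>. \<Sum>z\<in>A. emeasure lborel (P C z))"
    by (simp add: sum.distrib sum.swap[of _ \<C>])
  also have "\<dots> \<le> hausdorff_length (N - \<Union>\<C>) + (\<Sum>C\<in>\<C>. emeasure lborel (T C))"
    by (intro add_mono H sum_mono PT)
  finally show ?thesis .
qed

text \<open>The lift chosen in \<open>arc_width\<close> is also the one that is parametrized, so
  different lifts never have to be compared.\<close>

lemma wide_regular_arc_curved_arc:
  assumes "regular_arc C" "w\<^sub>0 < arc_width C"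
  shows "\<exists>\<gamma> \<gamma>' \<gamma>'' l \<kappa>. curved_arc \<gamma> \<gamma>' \<gamma>'' l \<kappa> \<and> l < 1 \<and> C = torus_of ` \<gamma> ` {0..l} \<and> w\<^sub>0 \<le> \<kappa> * l\<^sup>2"
proof -
  define K where "K = (SOME K. regular_lift C K)"
  have "regular_lift C K" using assms(1) unfolding regular_arc_def K_def by (rule someI_ex)
  then have K: "regular_planar_arc K" "C = torus_of ` K" by (auto simp: regular_lift_def)
  obtain \<gamma> \<gamma>' \<gamma>'' l \<kappa> where *: "curved_arc \<gamma> \<gamma>' \<gamma>'' l \<kappa>" "l < 1" "K = \<gamma> ` {0..l}"
    by (rule regular_planar_arc_curved_arc[OF K(1)])
  have "w\<^sub>0 \<le> \<kappa> * l\<^sup>2"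
    using assms(2) curved_arc.arc_width_le[OF *(1)] unfolding arc_width_def K_def[symmetric] *(3) by simp
  moreover have "C = torus_of ` \<gamma> ` {0..l}" using K(2) *(3) by simp
  ultimately show ?thesis using *(1,2) by (intro exI conjI)
qed

section \<open>Nodal length off wide arcs\<close>

text \<open>The good windows contribute at least lam/200, of which the arcs can hide at most
  lam/1000; the difference is lam/250.\<close>

lemma nodal_length_off_wide_arcs:
  fixes lam D w\<^sub>0 :: real
  assumes lam: "lam \<ge> 4" and eig: "toral_eigenfunction (lam\<^sup>2) \<phi>"
    and D: "D > 0" and w0: "w\<^sub>0 > 0"
    and ND: "real (card (freqs (lam\<^sup>2))) ^ 3 * D \<le> lam / 80"
    and NW: "16000000 * (real (card (freqs (lam\<^sup>2))))\<^sup>2 \<le> sqrt (w\<^sub>0 * D)"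
    and disj: "disjoint \<C>" and arcs: "\<And>C. C \<in> \<C> \<Longrightarrow> regular_arc C \<and> C \<subseteq> nodal_set \<phi> \<and> arc_width C > w\<^sub>0"
  shows "hausdorff_length (nodal_set \<phi> - \<Union>\<C>) \<ge> ennreal (lam / 250)"
proof -
  let ?H = "hausdorff_length (nodal_set \<phi> - \<Union>\<C>)"
  define S where "S = freqs (lam\<^sup>2)"
  have finS: "finite S" by (simp add: S_def finite_freqs)
  have latS: "S \<subseteq> int_lattice" by (auto simp: S_def freqs_def)
  obtain a \<xi>\<^sub>0 where \<xi>0: "\<xi>\<^sub>0 \<in> S" "a \<xi>\<^sub>0 \<noteq> 0"
    and rep: "\<And>x. of_real (\<phi> (torus_of x)) = trig_sum a S x"
    using toral_eigenfunction_expansion[OF eig] unfolding S_def by blast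
  define n where "n = nat \<lfloor>lam / 2\<rfloor>"
  note n = nat_floor_half_bounds[OF lam, folded n_def]
  \<comment> \<open>The first Dirichlet eigenvalue 2 (\<pi> / s)^2 of a square of side s has to
    equal 4 \<pi>^2 lam^2.\<close>
  define s where "s = 1 / (sqrt 2 * lam)"
  have s: "s > 0" "2 * s\<^sup>2 * lam\<^sup>2 = 1" using lam by (auto simp: s_def power_divide power_mult_distrib)
  have sq2: "1.4 \<le> sqrt 2" by (rule real_le_rsqrt) (simp add: power2_eq_square)
  have sq2': "sqrt 2 \<le> 1.5" by (rule real_le_lsqrt) (simp_all add: power2_eq_square)
  have s2: "2 * s = sqrt 2 / lam"
    using real_sqrt_mult_self[of 2] lam by (simp add: s_def field_simps)
  have s_up: "2 * s \<le> 3 / (2 * lam)" unfolding s2 using sq2' lam by (simp add: field_simps)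
  have s_nonneg: "0 \<le> 2 * s" using s(1) by simp
  have s_low: "s / 2 \<ge> 1 / (3 * lam)"
    using sq2' lam by (simp add: s_def field_simps)
  obtain J \<sigma> A where J: "J \<subseteq> S" and \<sigma>: "\<sigma> > 0" "\<And>\<xi>. \<xi> \<in> S \<Longrightarrow> norm (a \<xi>) \<le> \<sigma>"
    and sep: "\<And>\<xi> \<eta>. \<xi> \<in> J \<Longrightarrow> \<eta> \<in> S - J \<Longrightarrow> D \<le> norm (\<eta> - \<xi>)"
    and A: "A \<subseteq> grid n" "9 * (real n)\<^sup>2 \<le> 32 * real (card A)"
    and good: "\<And>z w. z \<in> A \<Longrightarrow> w \<in> window (grid_point n z) (2 * s) \<Longrightarrow> \<sigma> / 4 \<le> norm (trig_sum a J w)"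
    by (rule exists_good_windows[where a = a and r = "2 * s", OF lam \<xi>0[unfolded S_def] D ND s_nonneg s_up, folded S_def n_def])
      (rule that)
  have "\<exists>\<gamma> \<gamma>' \<gamma>'' l \<kappa>. curved_arc \<gamma> \<gamma>' \<gamma>'' l \<kappa> \<and> l < 1 \<and> C = torus_of ` \<gamma> ` {0..l} \<and> w\<^sub>0 \<le> \<kappa> * l\<^sup>2" if "C \<in> \<C>" for C
    using arcs[OF that] wide_regular_arc_curved_arc by blast
  then obtain \<gamma> \<gamma>' \<gamma>'' l \<kappa> where arc: "\<And>C. C \<in> \<C> \<Longrightarrow> curved_arc (\<gamma> C) (\<gamma>' C) (\<gamma>'' C) (l C) (\<kappa> C)"
    and short: "\<And>C. C \<in> \<C> \<Longrightarrow> l C < 1" and img: "\<And>C. C \<in> \<C> \<Longrightarrow> C = torus_of ` \<gamma> C ` {0..l C}"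
    and wide: "\<And>C. C \<in> \<C> \<Longrightarrow> w\<^sub>0 \<le> \<kappa> C * (l C)\<^sup>2"
    by metis
  have inC: "torus_of (\<gamma> C t) \<in> C" if "C \<in> \<C>" "t \<in> {0..l C}" for C t
    using img[OF that(1)] that(2) by blast
  have zero: "trig_sum a S (\<gamma> C t) = 0" if "C \<in> \<C>" "t \<in> {0..l C}" for C t
    using arcs[OF that(1)] inC[OF that] rep[of "\<gamma> C t"] by (auto simp: nodal_set_def)
  have same: "C = C'" if "C \<in> \<C>" "C' \<in> \<C>" "t \<in> {0..l C}" "t' \<in> {0..l C'}" "torus_of (\<gamma> C t) = torus_of (\<gamma> C' t')" for C C' t t'
    using inC[OF that(1,3)] inC[OF that(2,4)] disj that(1,2,5) unfolding disjoint_def by (metis IntI empty_iff)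
  have total: "(\<Sum>C\<in>F. l C) \<le> 50 * lam" if F: "finite F" "F \<subseteq> \<C>" for F
  proof -
    have "(\<Sum>C\<in>F. l C) \<le> 40 * real (nat \<lceil>lam\<rceil>)"
    proof (rule sum_arc_lengths_le[where a = a and S = S and \<gamma> = \<gamma>, OF F(1) _ _ _ _ finS latS _ \<xi>0])
      show "\<bar>\<xi> $ i\<bar> \<le> real (nat \<lceil>lam\<rceil>)" if "\<xi> \<in> S" for \<xi> i
      proof -
        have "norm \<xi> = lam" using that lam power2_eq_iff_nonneg[of "norm \<xi>" lam] by (simp add: S_def freqs_def)
        then have "\<bar>\<xi> $ i\<bar> \<le> lam" using component_le_norm_cart[of \<xi> i] by simp
        then show ?thesis by linarith
      qed
    qed (use F arc short zero same in blast)+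
    also have "real (nat \<lceil>lam\<rceil>) \<le> lam + 1" using lam by linarith
    finally show ?thesis using lam by simp
  qed
  \<comment> \<open>Since 2 \<kappa> l < 1, an arc is at least twice as long as
    \<open>w\<^sub>0\<close>. With the bound on the total length this makes the collection
    finite.\<close>
  have l_low: "2 * w\<^sub>0 \<le> l C" if "C \<in> \<C>" for C
  proof -
    interpret curved_arc "\<gamma> C" "\<gamma>' C" "\<gamma>'' C" "l C" "\<kappa> C" by (rule arc[OF that])
    have "(2 * \<kappa> C * l C) * l C \<le> 1 * l C" using turn l by (intro mult_right_mono) auto
    then show ?thesis using wide[OF that] by (simp add: power2_eq_square)
  qed
  have fin\<C>: "finite \<C>"
  proof (rule ccontr)
    assume "infinite \<C>"
    then obtain F where F: "finite F" "card F = Suc (nat \<lceil>50 * lam / (2 * w\<^sub>0)\<rceil>)" "F \<subseteq> \<C>"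
      using infinite_arbitrarily_large by blast
    have "real (card F) * (2 * w\<^sub>0) \<le> (\<Sum>C\<in>F. l C)"
      using sum_mono[of F "\<lambda>_. 2 * w\<^sub>0" l] l_low F(3) by (simp add: subset_iff)
    also have "\<dots> \<le> 50 * lam" by (rule total[OF F(1,3)])
    finally have "real (card F) \<le> 50 * lam / (2 * w\<^sub>0)" using w0 by (simp add: field_simps)
    then show False unfolding F(2) by linarith
  qed
  define W where "W = w\<^sub>0 * D"
  have N1: "1 \<le> (real (card S))\<^sup>2"
  proof -
    have "0 < card S" using \<xi>0(1) finS card_gt_0_iff by blast
    then show ?thesis by (simp add: one_le_power Suc_le_eq)
  qed
  have sW: "16000000 * (real (card S))\<^sup>2 \<le> sqrt W" using NW by (simp add: S_def W_def)
  then have sW1: "1 \<le> sqrt W" using N1 by linarith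
  then have W1: "1 \<le> W" by simp
  define T where "T C = {t \<in> {0..l C}. (\<sigma> / 4)\<^sup>2 \<le> (norm (trig_sum a J (\<gamma> C t)))\<^sup>2}" for C
  have Tm: "T C \<in> sets borel" if "C \<in> \<C>" for C
  proof -
    have "continuous_on {0..l C} (\<lambda>t. (norm (trig_sum a J (\<gamma> C t)))\<^sup>2)"
      by (intro continuous_intros curved_arc.continuous_on_arc[OF arc[OF that]])
    from continuous_closed_preimage[OF this closed_real_atLeastAtMost closed_atLeast[of "(\<sigma> / 4)\<^sup>2"]]
    show ?thesis by (simp add: T_def vimage_def Int_def borel_closed)
  qed
  \<comment> \<open>The hypothesis \<open>NW\<close> is tuned here: 16000000 = 320 * 50000, and a
    total arc length of at most 50 lam divided by 50000 is lam/1000.\<close>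
  have Te: "emeasure lborel (T C) \<le> ennreal (l C / 50000)" if C: "C \<in> \<C>" for C
  proof -
    interpret curved_arc "\<gamma> C" "\<gamma>' C" "\<gamma>'' C" "l C" "\<kappa> C" by (rule arc[OF C])
    have "W \<le> \<kappa> C * (l C)\<^sup>2 * D" unfolding W_def using wide[OF C] D by (intro mult_right_mono) auto
    then have "emeasure lborel (T C) \<le> ennreal (320 * (real (card S))\<^sup>2 / sqrt W * l C)"
      unfolding T_def using D C by (intro emeasure_arc_in_good_region[OF finS J \<sigma> zero sep _ W1]) auto
    also have "\<dots> \<le> ennreal (1 / 50000 * l C)"
    proof (intro ennreal_leI mult_right_mono)
      show "320 * (real (card S))\<^sup>2 / sqrt W \<le> 1 / 50000" using sW sW1 by (simp add: field_simps)
    qed (use l in simp)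
    finally show ?thesis by simp
  qed
  have "of_nat (card A) * ennreal (s / 2) \<le> ?H + (\<Sum>C\<in>\<C>. emeasure lborel (T C))"
  proof (rule hausdorff_length_complement_ge[where r = "2 * s" and n = n and \<gamma> = \<gamma> and l = l, OF _ _ A(1) _ _ fin\<C> _ img Tm])
    have "3 / (2 * lam) \<le> 1 / 2" using lam by (simp add: field_simps)
    then show "2 * s \<le> 1 / 2" using s_up by linarith
    show "2 * s < 1 / real n"
    proof -
      have "3 / (2 * lam) < 1 / (lam / 2)" using lam by (simp add: field_simps)
      also have "\<dots> \<le> 1 / real n" using n by (intro divide_left_mono) auto
      finally show ?thesis using s_up by simp
    qed
    have set_eq: "{w \<in> window c (2 * s). torus_of w \<in> nodal_set \<phi>} = {z. (\<forall>d. c $ d \<le> z $ d \<and> z $ d \<le> c $ d + 2 * s) \<and> \<phi> (torus_of z) = 0}" for c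
      by (auto simp: window_def nodal_set_def)
    have nrm: "(norm \<xi>)\<^sup>2 = lam\<^sup>2" if "\<xi> \<in> S" for \<xi> using that by (simp add: S_def freqs_def)
    show "compact {w \<in> window (grid_point n z) (2 * s). torus_of w \<in> nodal_set \<phi>}" for z
      unfolding set_eq by (rule window_projection_measure(1)[OF finS rep nrm s])
    show "\<exists>d. ennreal (s / 2) \<le> emeasure lborel ((\<lambda>w. w $ d) ` {w \<in> window (grid_point n z) (2 * s). torus_of w \<in> nodal_set \<phi>})" for z
      unfolding set_eq by (rule window_projection_measure(2)[OF finS rep nrm s])
    show "norm (\<gamma> C t - \<gamma> C t') \<le> \<bar>t - t'\<bar>" if "C \<in> \<C>" "t' \<in> {0..l C}" "t \<in> {0..l C}" for C t t'
      using curved_arc.arc_lipschitz[OF arc[OF that(1)] that(2,3)] .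
    show "t \<in> T C" if t: "C \<in> \<C>" "z \<in> A" "t \<in> {0..l C}" "torus_of (\<gamma> C t) \<in> torus_of ` window (grid_point n z) (2 * s)" for C z t
    proof -
      obtain w where w: "w \<in> window (grid_point n z) (2 * s)" "torus_of (\<gamma> C t) = torus_of w" using t(4) by blast
      have "\<sigma> / 4 \<le> norm (trig_sum a J (\<gamma> C t))"
        using good[OF t(2) w(1)] trig_sum_periodic[OF w(2), of J a] J latS by auto
      then show ?thesis using t(3) \<sigma>(1) by (auto simp: T_def intro!: power_mono)
    qed
  qed
  also have "(\<Sum>C\<in>\<C>. emeasure lborel (T C)) \<le> ennreal (lam / 1000)"
  proof -
    have "(\<Sum>C\<in>\<C>. emeasure lborel (T C)) \<le> (\<Sum>C\<in>\<C>. ennreal (l C / 50000))" by (intro sum_mono Te)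
    also have "\<dots> = ennreal (\<Sum>C\<in>\<C>. l C / 50000)"
      using curved_arc.l[OF arc] by (intro sum_ennreal) (auto intro: less_imp_le)
    also have "\<dots> \<le> ennreal (lam / 1000)"
      using total[OF fin\<C>] by (intro ennreal_leI) (simp add: sum_divide_distrib[symmetric])
    finally show ?thesis .
  qed
  finally have le: "of_nat (card A) * ennreal (s / 2) \<le> ?H + ennreal (lam / 1000)"
    by (simp add: add_left_mono)
  \<comment> \<open>At least 9/32 of the n^2 >= lam^2 / 16 windows contribute s/2 >= 1/(3 lam) each,
    that is 3 lam / 512 in total.\<close>
  have "lam / 200 \<le> real (card A) * (s / 2)"
  proof -
    have "(lam / 4)\<^sup>2 \<le> (real n)\<^sup>2" using n lam by (intro power_mono) auto
    then have cA: "9 * lam\<^sup>2 / 512 \<le> real (card A)" using A(2) by (simp add: power_divide)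
    have "lam / 200 \<le> (9 * lam\<^sup>2 / 512) * (1 / (3 * lam))" using lam by (simp add: power2_eq_square field_simps)
    also have "\<dots> \<le> real (card A) * (s / 2)" using lam by (intro mult_mono cA s_low) auto
    finally show ?thesis .
  qed
  then have "ennreal (lam / 200) \<le> ennreal (real (card A) * (s / 2))" by (rule ennreal_leI)
  also have "\<dots> = of_nat (card A) * ennreal (s / 2)" using s(1) by (subst ennreal_mult) (simp_all add: ennreal_of_nat_eq_real_of_nat)
  also note le
  finally have "ennreal (lam / 250) + ennreal (lam / 1000) \<le> ?H + ennreal (lam / 1000)"
    using lam by (simp add: ennreal_plus[symmetric] del: ennreal_plus)
  then show ?thesis by (simp add: ennreal_add_left_cancel_le add.commute)
qed

text \<open>With \<open>w\<^sub>0\<close> = lam^(\<epsilon>-1) and D = lam^(1-\<epsilon>/2), the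
  first condition has exponent 1 - 5 \<epsilon>/16 against 1, the second \<epsilon>/8 against
  \<epsilon>/4. The spare powers absorb all constants.\<close>

lemma eventually_parameters:
  fixes \<epsilon> C :: real
  assumes \<epsilon>: "\<epsilon> > 0" and C: "C > 0"
  shows "\<forall>\<^sub>F lam in at_top. (C * lam powr (\<epsilon> / 16)) ^ 3 * lam powr (1 - \<epsilon> / 2) \<le> lam / 80 \<and>
     16000000 * (C * lam powr (\<epsilon> / 16))\<^sup>2 \<le> sqrt (lam powr (- 1 + \<epsilon>) * lam powr (1 - \<epsilon> / 2))"
proof -
  have lim: "((\<lambda>lam. lam powr (- b)) \<longlongrightarrow> 0) at_top" if "b > 0" for b :: real
    using that by (intro tendsto_neg_powr filterlim_ident) auto
  have "\<forall>\<^sub>F lam in at_top. lam powr (- (5 * \<epsilon> / 16)) < 1 / (80 * C ^ 3)"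
    using C \<epsilon> by (intro order_tendstoD(2)[OF lim]) auto
  moreover have "\<forall>\<^sub>F lam in at_top. lam powr (- (\<epsilon> / 8)) < 1 / (16000000 * C\<^sup>2)"
    using C \<epsilon> by (intro order_tendstoD(2)[OF lim]) auto
  moreover have "\<forall>\<^sub>F lam in at_top. lam > (0::real)" by (rule eventually_gt_at_top)
  ultimately show ?thesis
  proof eventually_elim
    case (elim lam)
    have pw: "(lam powr c) ^ k = lam powr (c * real k)" for c k
      using elim(3) by (simp add: powr_powr[symmetric] powr_realpow)
    have "(C * lam powr (\<epsilon> / 16)) ^ 3 * lam powr (1 - \<epsilon> / 2) = C ^ 3 * (lam powr (\<epsilon> / 16 * real 3) * lam powr (1 - \<epsilon> / 2))"
      by (simp add: power_mult_distrib pw)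
    also have "lam powr (\<epsilon> / 16 * real 3) * lam powr (1 - \<epsilon> / 2) = lam powr (1 + - (5 * \<epsilon> / 16))"
      unfolding powr_add[symmetric] by (rule arg_cong[of _ _ "(powr) lam"]) simp
    also have "\<dots> = lam * lam powr (- (5 * \<epsilon> / 16))"
      by (subst powr_add) (use elim(3) in simp)
    also have "C ^ 3 * (lam * lam powr (- (5 * \<epsilon> / 16))) \<le> C ^ 3 * (lam * (1 / (80 * C ^ 3)))"
      using C elim by (intro mult_left_mono) auto
    also have "\<dots> = lam / 80" using C by simp
    finally have 1: "(C * lam powr (\<epsilon> / 16)) ^ 3 * lam powr (1 - \<epsilon> / 2) \<le> lam / 80" .
    have "sqrt (lam powr (- 1 + \<epsilon>) * lam powr (1 - \<epsilon> / 2)) = lam powr (\<epsilon> / 4)"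
    proof -
      have "lam powr (- 1 + \<epsilon>) * lam powr (1 - \<epsilon> / 2) = lam powr (\<epsilon> / 4 * real 2)"
        unfolding powr_add[symmetric] by (rule arg_cong[of _ _ "(powr) lam"]) simp
      also have "\<dots> = (lam powr (\<epsilon> / 4))\<^sup>2" by (rule pw[symmetric])
      finally show ?thesis by simp
    qed
    moreover have "16000000 * (C * lam powr (\<epsilon> / 16))\<^sup>2 \<le> lam powr (\<epsilon> / 4)"
    proof -
      have "lam powr (\<epsilon> / 8) = lam powr (\<epsilon> / 4) * lam powr (- (\<epsilon> / 8))"
        unfolding powr_add[symmetric] by (rule arg_cong[of _ _ "(powr) lam"]) simp
      also have "\<dots> \<le> lam powr (\<epsilon> / 4) * (1 / (16000000 * C\<^sup>2))" using elim(2) by (intro mult_left_mono) auto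
      finally have "16000000 * C\<^sup>2 * lam powr (\<epsilon> / 8) \<le> lam powr (\<epsilon> / 4)" using C by (simp add: field_simps)
      then show ?thesis by (simp add: power_mult_distrib pw mult.assoc)
    qed
    ultimately show ?case using 1 by simp
  qed
qed

theorem theorem3:
  shows "\<exists>c\<^sub>0 > 0 :: real. \<forall>\<epsilon> > 0 :: real. \<forall>\<^sub>F lam in at_top.
    \<forall>\<phi> (\<C> :: torus set set).
      toral_eigenfunction (lam\<^sup>2) \<phi> \<longrightarrow>
      disjoint \<C> \<longrightarrow>
      (\<forall>C\<in>\<C>. regular_arc C \<and> C \<subseteq> nodal_set \<phi> \<and> arc_width C > lam powr (- 1 + \<epsilon>)) \<longrightarrow>
      hausdorff_length (nodal_set \<phi> - \<Union>\<C>) > ennreal (c\<^sub>0 * lam)"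
proof (intro exI[of _ "1 / 1000"] conjI allI impI)
  fix \<epsilon> :: real assume \<epsilon>: "\<epsilon> > 0"
  obtain C where C: "C > 0" "\<And>lam. lam \<ge> 1 \<Longrightarrow> real (card (freqs (lam\<^sup>2))) \<le> C * lam powr (\<epsilon> / 16)"
    using card_freqs_subpolynomial[of "\<epsilon> / 16"] \<epsilon> by auto
  from eventually_parameters[OF \<epsilon> C(1)] eventually_ge_at_top[of 4]
  show "\<forall>\<^sub>F lam in at_top. \<forall>\<phi> (\<C> :: torus set set). toral_eigenfunction (lam\<^sup>2) \<phi> \<longrightarrow> disjoint \<C> \<longrightarrow>
      (\<forall>C\<in>\<C>. regular_arc C \<and> C \<subseteq> nodal_set \<phi> \<and> arc_width C > lam powr (- 1 + \<epsilon>)) \<longrightarrow>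
      hausdorff_length (nodal_set \<phi> - \<Union>\<C>) > ennreal (1 / 1000 * lam)"
  proof eventually_elim
    case (elim lam)
    let ?N = "real (card (freqs (lam\<^sup>2)))"
    have card: "?N \<le> C * lam powr (\<epsilon> / 16)" using C(2) elim by simp
    have 1: "?N ^ 3 * lam powr (1 - \<epsilon> / 2) \<le> lam / 80"
    proof -
      have "?N ^ 3 \<le> (C * lam powr (\<epsilon> / 16)) ^ 3" using card by (intro power_mono) auto
      then have "?N ^ 3 * lam powr (1 - \<epsilon> / 2) \<le> (C * lam powr (\<epsilon> / 16)) ^ 3 * lam powr (1 - \<epsilon> / 2)"
        by (intro mult_right_mono) auto
      then show ?thesis using elim by linarith
    qed
    have 2: "16000000 * (?N)\<^sup>2 \<le> sqrt (lam powr (- 1 + \<epsilon>) * lam powr (1 - \<epsilon> / 2))"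
    proof -
      have "(?N)\<^sup>2 \<le> (C * lam powr (\<epsilon> / 16))\<^sup>2" using card by (intro power_mono) auto
      then show ?thesis using elim by linarith
    qed
    show ?case
    proof (intro allI impI)
      fix \<phi> and \<C> :: "torus set set"
      assume *: "toral_eigenfunction (lam\<^sup>2) \<phi>" "disjoint \<C>"
        "\<forall>C\<in>\<C>. regular_arc C \<and> C \<subseteq> nodal_set \<phi> \<and> arc_width C > lam powr (- 1 + \<epsilon>)"
      \<comment> \<open>The gap between 1/1000 and 1/250 turns the weak inequality into a strict
        one.\<close>
      have "ennreal (1 / 1000 * lam) < ennreal (lam / 250)" using elim by (intro ennreal_lessI) auto
      also have "\<dots> \<le> hausdorff_length (nodal_set \<phi> - \<Union>\<C>)"
        by (rule nodal_length_off_wide_arcs[OF _ *(1) _ _ 1 2 *(2)]) (use elim *(3) in auto)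
      finally show "hausdorff_length (nodal_set \<phi> - \<Union>\<C>) > ennreal (1 / 1000 * lam)" .
    qed
  qed
qed simp

end
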